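(* Let $h_1,h_2\ge 0$ be real numbers, $\mathbf h=(h_1,h_2)$, and let $a,b>0$. Then, almost surely and in $L^1$, $$\lim_{t\to\infty}\frac{L^{\mathbf h}_{(at,bt)}}{t}=f^{\mathbf h}(a,b):=\begin{cases}\dfrac{2(ah_2+bh_1)-2\sqrt{(ah_2-bh_1)^2+ab}}{4h_1h_2-1}&\text{if }h_1h_2\ne 1/4,\\[2mm] \dfrac{ab}{h_1b+h_2a}&\text{if }h_1h_2=1/4.\end{cases}$$
   Context: Let $\Xi$ be a homogeneous Poisson point process with intensity $1$ in $(0,+\infty)^2$. For $\mathbf h=(h_1,h_2)$ with $h_1,h_2\ge 0$ real, write $(y,s)\stackrel{\mathbf h}{\prec}(y',s')$ if $y+h_1\le y'$ and $s+h_2\le s'$. For $x,t>0$, $L^{\mathbf h}_{(x,t)}$ is the maximal integer $L\ge 0$ such that there are points $(y_1,s_1),\dots,(y_L,s_L)\in\Xi$ with $0<y_1<\dots<y_L<x$, $0<s_1<\dots<s_L<t$ and $(y_1,s_1)\stackrel{\mathbf h}{\prec}(y_2,s_2)\stackrel{\mathbf h}{\prec}\dots\stackrel{\mathbf h}{\prec}(y_L,s_L)$. *)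

theory Defs
  imports "HOL-Probability.Probability"
begin

text \<open>
  A point process is modelled as a random set of points of \<open>S\<close> that is finite on bounded sets for
  every outcome. Over bounded Borel sets the counts are Poisson and, for disjoint sets,
  independent. The probability mass function is written out because the areas may be \<open>0\<close>
  (so that \<open>0 ^ 0 = 1\<close> matters), whereas \<^const>\<open>poisson_pmf\<close> is only meaningful for a positive rate.
\<close>

locale homogeneous_poisson_process = prob_space M
  for M :: "'w measure" +
  fixes c :: real
    and S :: "(real \<times> real) set"
    and \<Xi> :: "'w \<Rightarrow> (real \<times> real) set"
  assumes intensity_nonneg: "0 \<le> c"
    and points_in_region: "\<And>\<omega>. \<omega> \<in> space M \<Longrightarrow> \<Xi> \<omega> \<subseteq> S"
    and locally_finite: "\<And>\<omega> B. \<omega> \<in> space M \<Longrightarrow> bounded B \<Longrightarrow> finite (\<Xi> \<omega> \<inter> B)"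
    and count_measurable:
      "\<And>B. B \<in> sets borel \<Longrightarrow> bounded B \<Longrightarrow> B \<subseteq> S \<Longrightarrow>
        (\<lambda>\<omega>. card (\<Xi> \<omega> \<inter> B)) \<in> measurable M (count_space UNIV)"
    and count_poisson:
      "\<And>B k. B \<in> sets borel \<Longrightarrow> bounded B \<Longrightarrow> B \<subseteq> S \<Longrightarrow>
        prob {\<omega> \<in> space M. card (\<Xi> \<omega> \<inter> B) = k}
          = exp (- (c * measure lborel B)) * (c * measure lborel B) ^ k / fact k"
    and count_indep:
      "\<And>(I :: nat set) B. finite I \<Longrightarrow> disjoint_family_on B I \<Longrightarrow>
        (\<And>i. i \<in> I \<Longrightarrow> B i \<in> sets borel \<and> bounded (B i) \<and> B i \<subseteq> S) \<Longrightarrow>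
        indep_vars (\<lambda>_. count_space UNIV) (\<lambda>i \<omega>. card (\<Xi> \<omega> \<inter> B i)) I"

definition prec_h :: "real \<times> real \<Rightarrow> real \<times> real \<Rightarrow> real \<times> real \<Rightarrow> bool" where
  "prec_h h p q \<longleftrightarrow> fst p + fst h \<le> fst q \<and> snd p + snd h \<le> snd q"

text \<open>
  Strict increase of both coordinates is required separately: \<^const>\<open>prec_h\<close> does not imply it
  when a component of \<open>h\<close> is \<open>0\<close>.
\<close>

definition h_chain ::
  "real \<times> real \<Rightarrow> (real \<times> real) set \<Rightarrow> real \<times> real \<Rightarrow> (real \<times> real) list \<Rightarrow> bool" where
  "h_chain h X z ps \<longleftrightarrow>
     set ps \<subseteq> X \<inter> ({0<..<fst z} \<times> {0<..<snd z}) \<and>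
     successively (\<lambda>p q. fst p < fst q \<and> snd p < snd q \<and> prec_h h p q) ps"

definition longest_chain ::
  "real \<times> real \<Rightarrow> (real \<times> real) set \<Rightarrow> real \<times> real \<Rightarrow> nat" where
  "longest_chain h X z = (GREATEST n. \<exists>ps. h_chain h X z ps \<and> length ps = n)"

definition limit_shape :: "real \<times> real \<Rightarrow> real \<Rightarrow> real \<Rightarrow> real" where
  "limit_shape h a b =
     (let h1 = fst h; h2 = snd h in
      if h1 * h2 \<noteq> 1 / 4
      then (2 * (a * h2 + b * h1) - 2 * sqrt ((a * h2 - b * h1)\<^sup>2 + a * b)) / (4 * h1 * h2 - 1)
      else a * b / (h1 * b + h2 * a))"

end

theory Submission
  imports Defs "HOL-Real_Asymp.Real_Asymp"
begin

text \<open>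
  Two facts determine the limit.

  Gaps only cost room. Explore the plane outwards from the origin and let \<open>R\<close> be the region in which
  the second point of a chain may lie. It is generated by the points outside of it, so that, given
  \<open>R\<close>, the points inside of \<open>R\<close> are still fresh. Enlarging the gap translates \<open>R\<close>, and fresh points do
  not notice a translation. By induction, \<open>k + 1\<close> points with gap \<open>h\<close> fit into the rectangle \<open>(x, y)\<close>
  with the same probability as \<open>k + 1\<close> points without gap fit into \<open>(x - k h1, y - k h2)\<close>
  (\<open>prob_has_chain_gap\<close>). If the limit is \<open>2 * sqrt (a * b)\<close> without gap, then the limit \<open>f\<close> with
  gap must solve \<open>f = 2 * sqrt ((a - f * h1) * (b - f * h2))\<close>, and the stated formula is the root of
  this equation (\<open>limit_shape_fixpoint\<close>).

  Without gap the limit is \<open>2 * sqrt (a * b)\<close> (Hammersley's problem). Put sources on the bottom side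
  and sinks on the left side of the rectangle, and let a path collect either sources or sinks before
  it moves into the interior. For suitable rates the increments of the resulting last passage time
  are stationary: those on the right side are again independent, with the rate of the sinks
  (\<open>right_increments_law\<close>). The last passage time is therefore a sum of two sums of independent
  variables, one along the bottom and one along the right side, and it concentrates exponentially.
  As it dominates every chain, the rates that minimise its mean give the upper bound
  (\<open>strict_chain_upper_tail\<close>). For the same rates, an optimal path cannot gain a positive proportion
  on the boundary, because a comparison with slightly tilted rates shows that the remaining
  interior is then too poor. So the interior alone already supplies almost the whole value
  (\<open>strict_chain_lower_tail\<close>).

  Both arguments are elementary on a grid. The cells of side \<open>1 / N\<close> that contain a point of the
  Poisson process form a Bernoulli random set (\<open>occupied_law\<close>), a chain of cells yields a chain of
  points, and a chain of points yields a chain of cells unless two points share a row or a column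
  of cells, which has probability of order \<open>1 / N\<close>. The exponential bounds do not depend on \<open>N\<close>, so
  \<open>N\<close> may tend to infinity while the rectangle is kept fixed. This gives
  \<open>longest_chain_deviation\<close>: deviations of order \<open>t\<close> are exponentially unlikely. The
  Borel-Cantelli lemma along the integers together with monotonicity in \<open>t\<close> yields almost sure
  convergence. Convergence in mean follows since the number of points, which bounds the length of
  every chain, has a second moment of polynomial order.
\<close>

section \<open>Bernoulli random sets\<close>

definition bernoulli_set :: "'a set \<Rightarrow> real \<Rightarrow> 'a set pmf" where
  "bernoulli_set A p = map_pmf Collect (Pi_pmf A False (\<lambda>_. bernoulli_pmf p))"

lemma bernoulli_set_subset:
  assumes "finite A" "X \<in> set_pmf (bernoulli_set A p)"
  shows "X \<subseteq> A"
  using assms set_Pi_pmf_subset[OF assms(1)] unfolding bernoulli_set_def by fastforce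

lemma bernoulli_set_restrict:
  assumes "finite A" "B \<subseteq> A"
  shows "map_pmf (\<lambda>X. X \<inter> B) (bernoulli_set A p) = bernoulli_set B p"
  unfolding bernoulli_set_def Pi_pmf_subset[OF assms] map_pmf_comp
  by (intro map_pmf_cong) auto

lemma bernoulli_set_union:
  assumes "finite A" "finite B" "A \<inter> B = {}"
  shows "bernoulli_set (A \<union> B) p =
         map_pmf (\<lambda>(X, Y). X \<union> Y) (pair_pmf (bernoulli_set A p) (bernoulli_set B p))"
proof -
  have "map_pmf (\<lambda>(X, Y). X \<union> Y) (pair_pmf (bernoulli_set A p) (bernoulli_set B p))
      = map_pmf (\<lambda>(f, g). Collect f \<union> Collect g)
          (pair_pmf (Pi_pmf A False (\<lambda>_. bernoulli_pmf p)) (Pi_pmf B False (\<lambda>_. bernoulli_pmf p)))"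
    unfolding bernoulli_set_def map_pair[symmetric] map_pmf_comp by (simp add: case_prod_unfold)
  also have "\<dots> = map_pmf Collect (map_pmf (\<lambda>(f, g) x. if x \<in> A then f x else g x)
          (pair_pmf (Pi_pmf A False (\<lambda>_. bernoulli_pmf p)) (Pi_pmf B False (\<lambda>_. bernoulli_pmf p))))"
    unfolding map_pmf_comp
  proof (intro map_pmf_cong refl)
    fix z assume "z \<in> set_pmf (pair_pmf (Pi_pmf A False (\<lambda>_. bernoulli_pmf p)) (Pi_pmf B False (\<lambda>_. bernoulli_pmf p)))"
    then have "\<And>x. x \<notin> A \<Longrightarrow> \<not> fst z x" "\<And>x. x \<notin> B \<Longrightarrow> \<not> snd z x"
      using set_Pi_pmf_subset[OF assms(1), of False "\<lambda>_. bernoulli_pmf p"]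
        set_Pi_pmf_subset[OF assms(2), of False "\<lambda>_. bernoulli_pmf p"] by auto
    then show "(case z of (f, g) \<Rightarrow> Collect f \<union> Collect g) =
        Collect (case z of (f, g) \<Rightarrow> \<lambda>x. if x \<in> A then f x else g x)"
      using assms(3) by (auto simp: case_prod_unfold)
  qed
  finally show ?thesis by (simp only: bernoulli_set_def Pi_pmf_union[OF assms])
qed

lemma bernoulli_set_image:
  assumes "finite A" "inj_on f A"
  shows "map_pmf (\<lambda>X. f ` X) (bernoulli_set A p) = bernoulli_set (f ` A) p"
  using assms
proof (induction A rule: finite_induct)
  case empty
  then show ?case by (simp add: bernoulli_set_def)
next
  case (insert x A)
  have single: "map_pmf (\<lambda>X. f ` X) (bernoulli_set {x} p) = bernoulli_set {f x} p"
    by (auto simp: bernoulli_set_def Pi_pmf_singleton map_pmf_comp intro!: map_pmf_cong)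
  have "bernoulli_set ({f x} \<union> f ` A) p = map_pmf (\<lambda>(X, Y). X \<union> Y)
      (pair_pmf (map_pmf (\<lambda>X. f ` X) (bernoulli_set {x} p)) (map_pmf (\<lambda>X. f ` X) (bernoulli_set A p)))"
    using insert by (subst bernoulli_set_union) (auto simp: single)
  also have "\<dots> = map_pmf (\<lambda>(X, Y). f ` X \<union> f ` Y) (pair_pmf (bernoulli_set {x} p) (bernoulli_set A p))"
    unfolding map_pair[symmetric] map_pmf_comp by (simp only: case_prod_unfold fst_conv snd_conv)
  also have "\<dots> = map_pmf (\<lambda>X. f ` X) (bernoulli_set ({x} \<union> A) p)"
    using bernoulli_set_union[of "{x}" A p] insert.hyps
    by (simp add: map_pmf_comp case_prod_unfold image_Un)
  finally show ?case by simp
qed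

lemma bernoulli_set_prob_mono:
  assumes "finite A" "B \<subseteq> A" "\<And>X. X \<subseteq> A \<Longrightarrow> P (X \<inter> B) \<Longrightarrow> Q X"
  shows "measure_pmf.prob (bernoulli_set B p) {X. P X} \<le> measure_pmf.prob (bernoulli_set A p) {X. Q X}"
proof -
  have "measure_pmf.prob (bernoulli_set B p) {X. P X}
      = measure_pmf.prob (bernoulli_set A p) {X. P (X \<inter> B)}"
    unfolding bernoulli_set_restrict[OF assms(1,2), symmetric] by (simp add: vimage_def)
  also have "\<dots> \<le> measure_pmf.prob (bernoulli_set A p) {X. Q X}"
    using assms bernoulli_set_subset[OF assms(1)]
    by (intro measure_pmf.finite_measure_mono_AE) (auto simp: AE_measure_pmf_iff)
  finally show ?thesis .
qed

lemma pair_pmf_prob_Times: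
  "measure_pmf.prob (pair_pmf p q) {(x, y). x \<in> A \<and> y \<in> B} = measure_pmf.prob p A * measure_pmf.prob q B"
proof -
  have "measure_pmf.prob (pair_pmf p q) {(x, y). x \<in> A \<and> y \<in> B}
      = measure_pmf.prob (pair_pmf p q) ((A \<inter> set_pmf p) \<times> (B \<inter> set_pmf q))"
    by (intro measure_pmf.finite_measure_eq_AE) (auto simp: AE_measure_pmf_iff)
  also have "\<dots> = measure_pmf.prob p (A \<inter> set_pmf p) * measure_pmf.prob q (B \<inter> set_pmf q)"
    by (rule measure_pmf_prob_product) (simp_all add: countable_Int2)
  finally show ?thesis
    unfolding measure_Int_set_pmf .
qed

lemma bernoulli_set_indep:
  assumes "finite A"
  shows "measure_pmf.prob (bernoulli_set A p) {X. P (X - u) \<and> Q (X \<inter> u)} =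
         measure_pmf.prob (bernoulli_set A p) {X. P (X - u)} *
         measure_pmf.prob (bernoulli_set A p) {X. Q (X \<inter> u)}"
proof -
  let ?B = "A - u" and ?C = "A \<inter> u"
  let ?\<mu> = "pair_pmf (bernoulli_set ?B p) (bernoulli_set ?C p)"
  have "?B \<union> ?C = A" "?B \<inter> ?C = {}" by blast+
  then have A: "bernoulli_set A p = map_pmf (\<lambda>(X, Y). X \<union> Y) ?\<mu>"
    using bernoulli_set_union[of ?B ?C p] assms by simp
  have e: "measure_pmf.prob (bernoulli_set A p) {X. R (X - u) (X \<inter> u)} = measure_pmf.prob ?\<mu> {(X, Y). R X Y}" for R
    unfolding A measure_map_pmf
  proof (intro measure_pmf.finite_measure_eq_AE AE_pmfI)
    fix z assume "z \<in> set_pmf ?\<mu>"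
    then have "fst z \<subseteq> ?B" "snd z \<subseteq> ?C"
      using bernoulli_set_subset[of ?B "fst z" p] bernoulli_set_subset[of ?C "snd z" p] assms
      by (simp_all add: mem_Times_iff)
    then have "fst z \<union> snd z - u = fst z" "(fst z \<union> snd z) \<inter> u = snd z" by blast+
    then show "z \<in> (\<lambda>(X, Y). X \<union> Y) -` {X. R (X - u) (X \<inter> u)} \<longleftrightarrow> z \<in> {(X, Y). R X Y}"
      by (simp add: case_prod_unfold)
  qed simp_all
  have "measure_pmf.prob ?\<mu> {(X, Y). P X \<and> Q Y} = measure_pmf.prob (bernoulli_set ?B p) {X. P X} *
      measure_pmf.prob (bernoulli_set ?C p) {Y. Q Y}"
    using pair_pmf_prob_Times[of "bernoulli_set ?B p" "bernoulli_set ?C p" "{X. P X}" "{Y. Q Y}"]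
    by simp
  moreover have "measure_pmf.prob ?\<mu> {(X, Y). P X} = measure_pmf.prob (bernoulli_set ?B p) {X. P X}"
    using measure_map_pmf[of fst ?\<mu> "{X. P X}"] by (simp add: map_fst_pair_pmf vimage_def case_prod_unfold)
  moreover have "measure_pmf.prob ?\<mu> {(X, Y). Q Y} = measure_pmf.prob (bernoulli_set ?C p) {X. Q X}"
    using measure_map_pmf[of snd ?\<mu> "{X. Q X}"] by (simp add: map_snd_pair_pmf vimage_def case_prod_unfold)
  ultimately show ?thesis
    using e[of "\<lambda>X Y. P X \<and> Q Y"] e[of "\<lambda>X Y. P X"] e[of "\<lambda>X Y. Q Y"] by simp
qed

section \<open>Gaps in chains of a Bernoulli set\<close>

definition gap_le :: "nat \<times> nat \<Rightarrow> nat \<times> nat \<Rightarrow> nat \<times> nat \<Rightarrow> bool" where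
  "gap_le g c d \<longleftrightarrow> fst c + fst g \<le> fst d \<and> snd c + snd g \<le> snd d"

text \<open>
  The set \<open>a\<close> constrains the first point only. In this form a chain can be taken apart from its
  lower end, by replacing \<open>a\<close> with the region that its first points leave to the second one.
\<close>

definition has_chain ::
  "nat \<times> nat \<Rightarrow> (nat \<times> nat) set \<Rightarrow> (nat \<times> nat) set \<Rightarrow> nat \<Rightarrow> bool" where
  "has_chain g X a k \<longleftrightarrow>
     (\<exists>cs. length cs = k \<and> set cs \<subseteq> X \<and> successively (gap_le g) cs \<and> (cs \<noteq> [] \<longrightarrow> hd cs \<in> a))"

definition next_region ::
  "nat \<times> nat \<Rightarrow> (nat \<times> nat) set \<Rightarrow> (nat \<times> nat) set \<Rightarrow> (nat \<times> nat) set" where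
  "next_region g X a = {d. \<exists>c\<in>X \<inter> a. gap_le g c d}"

lemma has_chain_Suc_0: "has_chain g X a (Suc 0) \<longleftrightarrow> X \<inter> a \<noteq> {}"
proof -
  have "X \<inter> a \<noteq> {} \<Longrightarrow> has_chain g X a (Suc 0)"
    unfolding has_chain_def by (metis (no_types) disjoint_iff empty_subsetI insert_subset length_Cons
      list.sel(1) list.set(1,2) list.size(3) successively.simps(2))
  then show ?thesis unfolding has_chain_def by (auto simp: length_Suc_conv)
qed

lemma has_chain_Suc_Suc:
  "has_chain g X a (Suc (Suc k)) \<longleftrightarrow> has_chain g X (next_region g X a) (Suc k)"
proof
  assume "has_chain g X a (Suc (Suc k))"
  then obtain cs0 where cs0: "length cs0 = Suc (Suc k)" "set cs0 \<subseteq> X" "successively (gap_le g) cs0"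
      "cs0 \<noteq> [] \<longrightarrow> hd cs0 \<in> a"
    unfolding has_chain_def by blast
  then obtain c cs where "cs0 = c # cs" by (cases cs0) auto
  with cs0 have c: "length cs = Suc k" "c \<in> X" "set cs \<subseteq> X" "successively (gap_le g) (c # cs)" "c \<in> a"
    by auto
  then have "hd cs \<in> next_region g X a"
    by (cases cs) (auto simp: next_region_def)
  then show "has_chain g X (next_region g X a) (Suc k)"
    using c unfolding has_chain_def by (intro exI[of _ cs]) (auto simp: successively_Cons)
next
  assume "has_chain g X (next_region g X a) (Suc k)"
  then obtain cs where c: "length cs = Suc k" "set cs \<subseteq> X" "successively (gap_le g) cs"
      "hd cs \<in> next_region g X a"
    unfolding has_chain_def by (metis length_0_conv nat.distinct(1))
  then obtain c where "c \<in> X" "c \<in> a" "gap_le g c (hd cs)"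
    by (auto simp: next_region_def)
  then have "length (c # cs) = Suc (Suc k) \<and> set (c # cs) \<subseteq> X \<and> successively (gap_le g) (c # cs)
      \<and> (c # cs \<noteq> [] \<longrightarrow> hd (c # cs) \<in> a)"
    using c by (cases cs) auto
  then show "has_chain g X a (Suc (Suc k))"
    unfolding has_chain_def by blast
qed

lemma has_chain_mono:
  assumes "has_chain g X a k" "X \<subseteq> Y"
  shows "has_chain g Y a k"
  using assms unfolding has_chain_def by blast

lemma has_chain_cong:
  assumes "\<And>c. c \<in> X \<Longrightarrow> c \<in> a \<longleftrightarrow> c \<in> b"
  shows "has_chain g X a k \<longleftrightarrow> has_chain g X b k"
  unfolding has_chain_def using assms by (metis hd_in_set subsetD)

lemma has_chain_shorter:
  assumes "has_chain g X a k" "j \<le> k"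
  shows "has_chain g X a j"
proof -
  obtain cs where cs: "length cs = k" "set cs \<subseteq> X" "successively (gap_le g) cs" "cs \<noteq> [] \<longrightarrow> hd cs \<in> a"
    using assms by (auto simp: has_chain_def)
  have "successively (gap_le g) (take j cs)"
    using cs(3) successively_append_iff[of "gap_le g" "take j cs" "drop j cs"] by simp
  moreover have "take j cs \<noteq> [] \<longrightarrow> hd (take j cs) \<in> a" using cs(4) by (cases j) auto
  ultimately show ?thesis
    unfolding has_chain_def
    using cs(1,2) assms(2) order_trans[OF set_take_subset[of j cs] cs(2)]
    by (intro exI[of _ "take j cs"]) simp
qed

lemma gap_le_trans: "gap_le g c d \<Longrightarrow> gap_le g d e \<Longrightarrow> gap_le g c e"
  by (auto simp: gap_le_def)

lemma gap_chain_sorted: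
  assumes "successively (gap_le g) (c # cs)" "d \<in> set cs"
  shows "gap_le g c d"
proof -
  have "transp (gap_le g)" by (rule transpI) (rule gap_le_trans)
  then have "sorted_wrt (gap_le g) (c # cs)"
    using assms(1) successively_iff_sorted_wrt_strong[of "c # cs" "gap_le g"]
    by (simp add: successively_conv_sorted_wrt)
  then show ?thesis using assms(2) by simp
qed

definition up_closed :: "(nat \<times> nat) set \<Rightarrow> bool" where
  "up_closed u \<longleftrightarrow> (\<forall>c\<in>u. \<forall>d. gap_le (0, 0) c d \<longrightarrow> d \<in> u)"

lemma up_closedD:
  assumes "up_closed u" "c \<in> u" "fst c \<le> fst d" "snd c \<le> snd d"
  shows "d \<in> u"
proof -
  have "gap_le (0, 0) c d" using assms by (simp add: gap_le_def)
  then show ?thesis using assms unfolding up_closed_def by blast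
qed

lemma up_closed_next_region: "up_closed (next_region g X a)"
  unfolding up_closed_def
proof (intro ballI allI impI)
  fix c d assume c: "c \<in> next_region g X a" and d: "gap_le (0, 0) c d"
  obtain c' where c': "c' \<in> X \<inter> a" "gap_le g c' c" using c unfolding next_region_def by blast
  have "gap_le g c' d" using c'(2) d unfolding gap_le_def by simp
  then show "d \<in> next_region g X a" using c'(1) unfolding next_region_def by blast
qed

lemma has_chain_Int_up_closed:
  assumes "up_closed u"
  shows "has_chain g (X \<inter> u) u k \<longleftrightarrow> has_chain g X u k"
proof
  assume "has_chain g X u k"
  then obtain cs where cs: "length cs = k" "set cs \<subseteq> X" "successively (gap_le g) cs" "cs \<noteq> [] \<longrightarrow> hd cs \<in> u"
    by (auto simp: has_chain_def)
  have "set cs \<subseteq> u"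
  proof (cases cs)
    case (Cons c ds)
    have "d \<in> u" if "d \<in> set ds" for d
    proof (rule up_closedD[OF assms])
      have "gap_le g c d" using gap_chain_sorted[of g c ds d] that cs(3) Cons by simp
      then show "fst c \<le> fst d" "snd c \<le> snd d" by (simp_all add: gap_le_def)
      show "c \<in> u" using cs(4) Cons by simp
    qed
    then show ?thesis using Cons cs by auto
  qed simp
  then show "has_chain g (X \<inter> u) u k" unfolding has_chain_def using cs by blast
qed (auto intro: has_chain_mono)

text \<open>
  A point of \<open>X\<close> inside the region lies above an earlier point, whose cone contains its own. So the
  minimal generators of the region lie outside of it, and the event that the region equals \<open>u\<close> can
  be decided by inspecting \<open>X\<close> outside of \<open>u\<close> alone. This makes the region a stopping set.
\<close>

lemma next_region_stopping:
  assumes g: "0 < fst g"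
  shows "next_region g X a = u \<longleftrightarrow> next_region g (X - u) a = u"
proof
  assume u: "next_region g X a = u"
  have "gap_le g c d \<Longrightarrow> d \<in> next_region g (X - u) a" if "c \<in> X \<inter> a" for c d
    using that
  proof (induction "fst c" arbitrary: c rule: less_induct)
    case less
    show ?case
    proof (cases "c \<in> u")
      case True
      then obtain c' where c': "c' \<in> X \<inter> a" "gap_le g c' c" using u by (auto simp: next_region_def)
      then have "fst c' < fst c" "gap_le g c' d" using g less.prems by (auto simp: gap_le_def)
      then show ?thesis using less.hyps c' by blast
    next
      case False
      then show ?thesis using less.prems by (auto simp: next_region_def)
    qed
  qed
  then show "next_region g (X - u) a = u"
    using u by (auto simp: next_region_def)
next
  assume u: "next_region g (X - u) a = u"
  have "d \<in> u" if "c \<in> X \<inter> a" "gap_le g c d" for c d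
  proof (cases "c \<in> u")
    case True
    then show ?thesis using up_closedD[OF up_closed_next_region[of g "X - u" a], of c d] that(2)
      unfolding u by (simp add: gap_le_def)
  next
    case False
    then show ?thesis using that u by (auto simp: next_region_def)
  qed
  then show "next_region g X a = u"
    using u by (auto simp: next_region_def)
qed

text \<open>
  Once the region is known, the part of \<open>X\<close> inside of it has not been inspected and may be replaced
  by the corresponding part of an independent copy \<open>Y\<close>.
\<close>

lemma bernoulli_strong_markov:
  fixes p :: real
  assumes A: "finite A" and g: "0 < fst g"
  defines "\<mu> \<equiv> bernoulli_set A p"
  shows "map_pmf (\<lambda>X. (next_region g X a, X \<inter> next_region g X a)) \<mu> =
    bind_pmf \<mu> (\<lambda>X. map_pmf (\<lambda>Y. (next_region g X a, Y \<inter> next_region g X a)) \<mu>)"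
proof (rule pmf_eqI, clarify)
  fix u w
  let ?P = "\<lambda>X. next_region g X a = u" and ?q = "measure_pmf.prob \<mu> {Y. Y \<inter> u = w}"
  have "pmf (map_pmf (\<lambda>X. (next_region g X a, X \<inter> next_region g X a)) \<mu>) (u, w)
      = measure_pmf.prob \<mu> {X. ?P (X - u) \<and> X \<inter> u = w}"
    unfolding pmf_map by (rule arg_cong[of _ _ "measure_pmf.prob \<mu>"])
      (use next_region_stopping[OF g, of _ a u] in auto)
  also have "\<dots> = measure_pmf.prob \<mu> {X. ?P (X - u)} * ?q"
    unfolding \<mu>_def by (rule bernoulli_set_indep[OF A, of p ?P u "\<lambda>Y. Y = w"])
  also have "{X. ?P (X - u)} = {X. ?P X}" using next_region_stopping[OF g, of _ a u] by auto
  finally have L: "pmf (map_pmf (\<lambda>X. (next_region g X a, X \<inter> next_region g X a)) \<mu>) (u, w)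
      = measure_pmf.prob \<mu> {X. ?P X} * ?q" .
  have "pmf (map_pmf (\<lambda>Y. (next_region g X a, Y \<inter> next_region g X a)) \<mu>) (u, w)
      = indicator {X. ?P X} X * ?q" for X
    unfolding pmf_map by (cases "?P X") (auto simp: vimage_def)
  then show "pmf (map_pmf (\<lambda>X. (next_region g X a, X \<inter> next_region g X a)) \<mu>) (u, w) =
     pmf (bind_pmf \<mu> (\<lambda>X. map_pmf (\<lambda>Y. (next_region g X a, Y \<inter> next_region g X a)) \<mu>)) (u, w)"
    unfolding L pmf_bind by simp
qed

lemma prob_bind_pmf:
  "measure_pmf.prob (bind_pmf p f) A = measure_pmf.expectation p (\<lambda>x. measure_pmf.prob (f x) A)"
proof -
  have "ennreal (measure_pmf.prob (bind_pmf p f) A) = (\<integral>\<^sup>+x. ennreal (measure_pmf.prob (f x) A) \<partial>p)"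
    by (simp add: measure_pmf.emeasure_eq_measure[symmetric])
  also have "\<dots> = ennreal (measure_pmf.expectation p (\<lambda>x. measure_pmf.prob (f x) A))"
    by (intro nn_integral_eq_integral measure_pmf.integrable_const_bound[where B = 1]) auto
  finally show ?thesis by (simp add: integral_nonneg_AE)
qed

lemma first_layer:
  fixes p :: real
  assumes A: "finite A" and g: "0 < fst g"
  defines "\<mu> \<equiv> bernoulli_set A p"
  shows "measure_pmf.prob \<mu> {X. has_chain g X a (Suc (Suc k))} =
    measure_pmf.expectation \<mu> (\<lambda>X. measure_pmf.prob \<mu> {Y. has_chain g Y (next_region g X a) (Suc k)})"
proof -
  let ?H = "{(u, W). has_chain g W u (Suc k)}"
  have e: "has_chain g (Y \<inter> next_region g X a) (next_region g X a) (Suc k) \<longleftrightarrow>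
      has_chain g Y (next_region g X a) (Suc k)" for X Y
    by (rule has_chain_Int_up_closed[OF up_closed_next_region])
  have "measure_pmf.prob \<mu> {X. has_chain g X a (Suc (Suc k))} =
      measure_pmf.prob (map_pmf (\<lambda>X. (next_region g X a, X \<inter> next_region g X a)) \<mu>) ?H"
    by (simp add: vimage_def e has_chain_Suc_Suc)
  also have "\<dots> = measure_pmf.expectation \<mu> (\<lambda>X. measure_pmf.prob \<mu> {Y. has_chain g Y (next_region g X a) (Suc k)})"
    unfolding \<mu>_def bernoulli_strong_markov[OF A g] prob_bind_pmf by (simp add: vimage_def e)
  finally show ?thesis .
qed

definition grid :: "nat \<Rightarrow> nat \<Rightarrow> (nat \<times> nat) set" where
  "grid m n = {..<m} \<times> {..<n}"

lemma finite_grid [simp]: "finite (grid m n)"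
  by (simp add: grid_def)

definition translate :: "nat \<times> nat \<Rightarrow> nat \<times> nat \<Rightarrow> nat \<times> nat" where
  "translate d c = (fst c + fst d, snd c + snd d)"

lemma inj_translate: "inj_on (translate d) A"
  by (auto simp: inj_on_def translate_def prod_eq_iff)

lemma gap_le_translate: "gap_le g (translate d c) (translate d c') = gap_le g c c'"
  by (auto simp: gap_le_def translate_def)

lemma has_chain_translate:
  "has_chain g (translate d ` X) (translate d ` a) k \<longleftrightarrow> has_chain g X a k"
proof
  assume "has_chain g X a k"
  then obtain cs where cs: "length cs = k" "set cs \<subseteq> X" "successively (gap_le g) cs" "cs \<noteq> [] \<longrightarrow> hd cs \<in> a"
    by (auto simp: has_chain_def)
  then show "has_chain g (translate d ` X) (translate d ` a) k"
    unfolding has_chain_def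
    by (intro exI[of _ "map (translate d) cs"]) (auto simp add: successively_map gap_le_translate hd_map)
next
  assume "has_chain g (translate d ` X) (translate d ` a) k"
  then obtain ds where ds: "length ds = k" "set ds \<subseteq> translate d ` X" "successively (gap_le g) ds"
      "ds \<noteq> [] \<longrightarrow> hd ds \<in> translate d ` a"
    by (auto simp: has_chain_def)
  have "\<exists>cs. ds = map (translate d) cs" unfolding ex_map_conv using ds(2) by blast
  then obtain cs where cs: "ds = map (translate d) cs" by blast
  have "set cs \<subseteq> X"
    using ds(2) unfolding cs by (simp add: inj_image_subset_iff[OF inj_translate])
  then show "has_chain g X a k"
    unfolding has_chain_def using ds unfolding cs
    by (intro exI[of _ cs]) (simp add: successively_map gap_le_translate hd_map inj_image_mem_iff[OF inj_translate])
qed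

lemma next_region_translate:
  "next_region (Suc (fst d), Suc (snd d)) X a = translate d ` next_region (1, 1) X a"
proof (intro set_eqI iffI)
  fix e assume "e \<in> next_region (Suc (fst d), Suc (snd d)) X a"
  then obtain c where "c \<in> X \<inter> a" "gap_le (Suc (fst d), Suc (snd d)) c e" by (auto simp: next_region_def)
  then show "e \<in> translate d ` next_region (1, 1) X a"
    by (intro image_eqI[of _ _ "(fst e - fst d, snd e - snd d)"])
       (auto simp: next_region_def gap_le_def translate_def prod_eq_iff intro!: bexI[of _ c])
qed (force simp: next_region_def gap_le_def translate_def)

text \<open>
  A chain that starts in a translated up-closed set stays in it, so it sees only the translated
  part of the larger grid.
\<close>

lemma prob_has_chain_translate:
  assumes "up_closed u"
  shows "measure_pmf.prob (bernoulli_set (grid (m + fst d) (n + snd d)) p) {Y. has_chain g Y (translate d ` u) k} =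
     measure_pmf.prob (bernoulli_set (grid m n) p) {Y. has_chain g Y u k}"
proof -
  let ?B = "grid (m + fst d) (n + snd d)"
  have u: "up_closed (translate d ` u)"
    unfolding up_closed_def
  proof (intro ballI allI impI)
    fix c e assume "c \<in> translate d ` u" "gap_le (0, 0) c e"
    then obtain c' where "c' \<in> u" "c = translate d c'" by auto
    then have le: "fst c' + fst d \<le> fst e" "snd c' + snd d \<le> snd e"
      using \<open>gap_le (0, 0) c e\<close> by (simp_all add: gap_le_def translate_def)
    have "(fst e - fst d, snd e - snd d) \<in> u"
      using up_closedD[OF assms \<open>c' \<in> u\<close>] le by simp
    moreover have "e = translate d (fst e - fst d, snd e - snd d)"
      using le by (simp add: translate_def prod_eq_iff)
    ultimately show "e \<in> translate d ` u" by blast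
  qed
  have img: "translate d ` grid m n = ?B \<inter> range (translate d)"
  proof (intro set_eqI iffI)
    fix e assume "e \<in> ?B \<inter> range (translate d)"
    then show "e \<in> translate d ` grid m n"
      by (intro image_eqI[of _ _ "(fst e - fst d, snd e - snd d)"]) (auto simp: grid_def translate_def)
  qed (auto simp: grid_def translate_def)
  have "measure_pmf.prob (bernoulli_set (grid m n) p) {Y. has_chain g Y u k}
      = measure_pmf.prob (bernoulli_set (translate d ` grid m n) p) {Y. has_chain g Y (translate d ` u) k}"
    unfolding bernoulli_set_image[OF finite_grid inj_translate, symmetric]
    by (simp add: vimage_def has_chain_translate)
  also have "\<dots> = measure_pmf.prob (bernoulli_set ?B p) {Y. has_chain g (Y \<inter> translate d ` grid m n) (translate d ` u) k}"
    unfolding bernoulli_set_restrict[OF finite_grid, of "translate d ` grid m n" "m + fst d" "n + snd d", symmetric, OF Int_lower1[THEN ord_eq_le_trans[OF img]]]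
    by (simp add: vimage_def)
  also have "\<dots> = measure_pmf.prob (bernoulli_set ?B p) {Y. has_chain g Y (translate d ` u) k}"
  proof (intro measure_pmf.finite_measure_eq_AE)
    have "has_chain g (Y \<inter> translate d ` grid m n) (translate d ` u) k \<longleftrightarrow> has_chain g Y (translate d ` u) k"
      if "Y \<in> set_pmf (bernoulli_set ?B p)" for Y
    proof -
      have "Y \<inter> translate d ` grid m n \<inter> translate d ` u = Y \<inter> translate d ` u"
        using bernoulli_set_subset[OF finite_grid that] unfolding img by auto
      then show ?thesis
        using has_chain_Int_up_closed[OF u, of g "Y \<inter> translate d ` grid m n" k]
          has_chain_Int_up_closed[OF u, of g Y k] by simp
    qed
    then show "AE Y in bernoulli_set ?B p. Y \<in> {Y. has_chain g (Y \<inter> translate d ` grid m n) (translate d ` u) k} \<longleftrightarrow>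
        Y \<in> {Y. has_chain g Y (translate d ` u) k}"
      by (auto simp: AE_measure_pmf_iff)
  qed auto
  finally show ?thesis by simp
qed

text \<open>
  The induction peels off the first point. Conditionally on it, the rest of the chain is a chain in a
  fresh set that starts in \<open>next_region (Suc d1, Suc d2) X a = translate d ` next_region (1, 1) X a\<close>.
  The hypothesis removes the enlarged gaps from the rest, and the translation is undone by moving
  the grid. A chain of \<open>k + 1\<close> points has \<open>k\<close> gaps, which together cost \<open>k * d\<close>.
\<close>

lemma prob_has_chain_gap_from:
  "measure_pmf.prob (bernoulli_set (grid (m + k * fst d) (n + k * snd d)) p)
     {X. has_chain (Suc (fst d), Suc (snd d)) X a (Suc k)} =
   measure_pmf.prob (bernoulli_set (grid m n) p) {X. has_chain (1, 1) X a (Suc k)}"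
proof (induction k arbitrary: m n a)
  case 0
  then show ?case by (simp add: has_chain_Suc_0)
next
  case (Suc k)
  let ?B' = "grid (m + Suc k * fst d) (n + Suc k * snd d)" and ?B = "grid m n"
  let ?g = "(Suc (fst d), Suc (snd d))"
  let ?F = "\<lambda>u. measure_pmf.prob (bernoulli_set ?B p) {Y. has_chain (1, 1) Y u (Suc k)}"
  have "measure_pmf.prob (bernoulli_set ?B' p) {X. has_chain ?g X a (Suc (Suc k))}
      = measure_pmf.expectation (bernoulli_set ?B' p)
          (\<lambda>X. measure_pmf.prob (bernoulli_set ?B' p) {Y. has_chain ?g Y (next_region ?g X a) (Suc k)})"
    by (rule first_layer) auto
  also have "\<dots> = measure_pmf.expectation (bernoulli_set ?B' p) (\<lambda>X. ?F (next_region (1, 1) X a))"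
  proof (rule Bochner_Integration.integral_cong[OF refl])
    fix X
    have "measure_pmf.prob (bernoulli_set ?B' p) {Y. has_chain ?g Y (next_region ?g X a) (Suc k)}
      = measure_pmf.prob (bernoulli_set (grid (m + fst d) (n + snd d)) p)
          {Y. has_chain (1, 1) Y (translate d ` next_region (1, 1) X a) (Suc k)}"
      using Suc.IH[of "m + fst d" "n + snd d"] by (simp add: next_region_translate algebra_simps)
    then show "measure_pmf.prob (bernoulli_set ?B' p) {Y. has_chain ?g Y (next_region ?g X a) (Suc k)}
        = ?F (next_region (1, 1) X a)"
      by (simp add: prob_has_chain_translate up_closed_next_region)
  qed
  also have "\<dots> = measure_pmf.expectation (bernoulli_set ?B' p) (\<lambda>X. ?F (next_region (1, 1) (X \<inter> ?B) a))"
  proof (rule Bochner_Integration.integral_cong[OF refl])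
    fix X
    have "has_chain (1, 1) Y (next_region (1, 1) X a) (Suc k) \<longleftrightarrow>
        has_chain (1, 1) Y (next_region (1, 1) (X \<inter> ?B) a) (Suc k)"
      if "Y \<in> set_pmf (bernoulli_set ?B p)" for Y
      by (rule has_chain_cong)
        (use bernoulli_set_subset[OF finite_grid that] in \<open>force simp: next_region_def gap_le_def grid_def\<close>)
    then show "?F (next_region (1, 1) X a) = ?F (next_region (1, 1) (X \<inter> ?B) a)"
      by (intro measure_pmf.finite_measure_eq_AE) (auto simp: AE_measure_pmf_iff)
  qed
  also have "\<dots> = measure_pmf.expectation (map_pmf (\<lambda>X. X \<inter> ?B) (bernoulli_set ?B' p)) (\<lambda>X. ?F (next_region (1, 1) X a))"
    by simp
  also have "\<dots> = measure_pmf.expectation (bernoulli_set ?B p) (\<lambda>X. ?F (next_region (1, 1) X a))"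
    by (subst bernoulli_set_restrict) (auto simp: grid_def)
  also have "\<dots> = measure_pmf.prob (bernoulli_set ?B p) {X. has_chain (1, 1) X a (Suc (Suc k))}"
    by (rule first_layer[symmetric]) auto
  finally show ?case .
qed

lemma has_chain_extent:
  fixes \<pi> :: "nat \<times> nat \<Rightarrow> nat"
  assumes "has_chain g X a (Suc k)"
    and X: "\<And>c. c \<in> X \<Longrightarrow> \<pi> c < m" and gap: "\<And>c c'. gap_le g c c' \<Longrightarrow> \<pi> c + d \<le> \<pi> c'"
  shows "k * d < m"
proof -
  obtain cs where cs: "length cs = Suc k" "set cs \<subseteq> X" "successively (gap_le g) cs"
    using assms(1) by (auto simp: has_chain_def)
  have "j * d \<le> \<pi> (cs ! j)" if "j \<le> k" for j
    using that
  proof (induction j)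
    case (Suc j)
    have "gap_le g (cs ! j) (cs ! Suc j)"
      using cs Suc.prems by (auto simp: successively_conv_nth)
    then have "\<pi> (cs ! j) + d \<le> \<pi> (cs ! Suc j)" by (rule gap)
    then show ?case using Suc by simp
  qed simp
  moreover have "cs ! k \<in> X" using cs(1,2) nth_mem[of k cs] by auto
  ultimately show ?thesis using X by (meson le_refl le_less_trans)
qed

text \<open>
  The gap \<open>(1, 1)\<close> means strict increase of both coordinates. The truncated subtraction is harmless:
  if the gaps use up one side of the grid, then both probabilities vanish.
\<close>

lemma prob_has_chain_gap:
  "measure_pmf.prob (bernoulli_set (grid m n) p) {X. has_chain (Suc d1, Suc d2) X UNIV (Suc k)} =
   measure_pmf.prob (bernoulli_set (grid (m - k * d1) (n - k * d2)) p) {X. has_chain (1, 1) X UNIV (Suc k)}"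
proof (cases "k * d1 \<le> m \<and> k * d2 \<le> n")
  case True
  then show ?thesis
    using prob_has_chain_gap_from[of "m - k * d1" k "(d1, d2)" "n - k * d2"] by simp
next
  case False
  have "\<not> has_chain (Suc d1, Suc d2) X UNIV (Suc k)" if "X \<in> set_pmf (bernoulli_set (grid m n) p)" for X
  proof
    assume chain: "has_chain (Suc d1, Suc d2) X UNIV (Suc k)"
    have X: "X \<subseteq> grid m n" by (rule bernoulli_set_subset[OF finite_grid that])
    have "k * d1 < m" by (rule has_chain_extent[OF chain, of fst]) (use X in \<open>auto simp: grid_def gap_le_def\<close>)
    moreover have "k * d2 < n" by (rule has_chain_extent[OF chain, of snd]) (use X in \<open>auto simp: grid_def gap_le_def\<close>)
    ultimately show False using False by simp
  qed
  then have "measure_pmf.prob (bernoulli_set (grid m n) p) {X. has_chain (Suc d1, Suc d2) X UNIV (Suc k)} = 0"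
    by (subst measure_pmf_zero_iff) auto
  moreover have "grid (m - k * d1) (n - k * d2) = {}"
    using False by (auto simp: grid_def)
  then have "\<not> has_chain (1, 1) X UNIV (Suc k)"
    if "X \<in> set_pmf (bernoulli_set (grid (m - k * d1) (n - k * d2)) p)" for X
    using bernoulli_set_subset[OF finite_grid that] by (auto simp: has_chain_def)
  then have "measure_pmf.prob (bernoulli_set (grid (m - k * d1) (n - k * d2)) p)
      {X. has_chain (1, 1) X UNIV (Suc k)} = 0"
    by (subst measure_pmf_zero_iff) auto
  ultimately show ?thesis by simp
qed

section \<open>Stationary increments\<close>

text \<open>
  How the increments of a last passage time change across one cell: \<open>I\<close> and \<open>J\<close> are the increments
  along its bottom and left side, \<open>w\<close> tells whether the cell carries a point, and the result
  consists of the increments along the top and right side.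
\<close>

definition corner :: "bool \<Rightarrow> bool \<Rightarrow> bool \<Rightarrow> bool \<times> bool" where
  "corner I J w = (if I = J then (\<not> I \<and> w, \<not> I \<and> w) else (I, J))"

text \<open>
  The map fixes unequal increments. It moves the pair (0, 0) to (1, 1) with probability \<open>p\<close> and always
  moves (1, 1) to (0, 0); the relation between the rates says that these two flows balance.
\<close>

lemma corner_stationary:
  assumes "0 \<le> \<alpha>" "\<alpha> \<le> 1" "0 \<le> \<beta>" "\<beta> \<le> 1" "0 \<le> p" "p \<le> 1" "\<alpha> * \<beta> = p * ((1 - \<alpha>) * (1 - \<beta>))"
  shows "do {I \<leftarrow> bernoulli_pmf \<alpha>; J \<leftarrow> bernoulli_pmf \<beta>; w \<leftarrow> bernoulli_pmf p; return_pmf (corner I J w)}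
       = do {I \<leftarrow> bernoulli_pmf \<alpha>; J \<leftarrow> bernoulli_pmf \<beta>; return_pmf (I, J)}"
proof (rule pmf_eqI, clarify)
  fix I J :: bool
  define X where "X = (1 - \<alpha>) * (1 - \<beta>)"
  have X: "\<alpha> * \<beta> = p * X" "(1 - \<alpha>) * (1 - \<beta>) = X" by (simp_all add: X_def assms(7))
  have Y: "(1 - \<alpha>) * \<beta> = (1 - \<alpha>) - X" "\<alpha> * (1 - \<beta>) = \<alpha> - p * X"
    using X(1) by (simp_all add: X_def algebra_simps)
  have bind: "pmf (do {I \<leftarrow> bernoulli_pmf \<alpha>; J \<leftarrow> bernoulli_pmf \<beta>; f I J}) (I, J) =
      \<alpha> * \<beta> * pmf (f True True) (I, J) + \<alpha> * (1 - \<beta>) * pmf (f True False) (I, J)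
    + (1 - \<alpha>) * \<beta> * pmf (f False True) (I, J) + (1 - \<alpha>) * (1 - \<beta>) * pmf (f False False) (I, J)" for f
    using assms(1-4) by (simp add: pmf_bind distrib_left mult.assoc mult.commute mult.left_commute)
  have bind_w: "pmf (do {w \<leftarrow> bernoulli_pmf p; return_pmf (corner I' J' w)}) (I, J) =
      p * pmf (return_pmf (corner I' J' True)) (I, J) + (1 - p) * pmf (return_pmf (corner I' J' False)) (I, J)" for I' J'
    using assms(5,6) by (simp add: pmf_bind mult.commute)
  show "pmf (do {I \<leftarrow> bernoulli_pmf \<alpha>; J \<leftarrow> bernoulli_pmf \<beta>; w \<leftarrow> bernoulli_pmf p; return_pmf (corner I J w)}) (I, J)
     = pmf (do {I \<leftarrow> bernoulli_pmf \<alpha>; J \<leftarrow> bernoulli_pmf \<beta>; return_pmf (I, J)}) (I, J)"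
    unfolding bind bind_w X(1,2) Y
    by (cases I; cases J) (simp_all add: corner_def algebra_simps)
qed

text \<open>
  Sweeps one column of cells from bottom to top. The first argument is the increment along the bottom
  of the column, and the result holds the increments along the right sides and the top.
\<close>

fun column :: "bool \<Rightarrow> bool list \<Rightarrow> bool list \<Rightarrow> bool list \<times> bool" where
  "column I (J # Js) (w # ws) =
     (let (I', J') = corner I J w; (Js', I'') = column I' Js ws in (J' # Js', I''))"
| "column I _ _ = ([], I)"

text \<open>
  The points are given as one flat list, column by column, so that they can be drawn as a single
  sequence of independent trials.
\<close>

fun columns :: "nat \<Rightarrow> bool list \<Rightarrow> bool list \<Rightarrow> bool list \<Rightarrow> bool list" where
  "columns n [] Js ws = Js"
| "columns n (I # Is) Js ws = columns n Is (fst (column I Js (take n ws))) (drop n ws)"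

context
  fixes \<alpha> \<beta> p :: real
  assumes rates: "0 \<le> \<alpha>" "\<alpha> \<le> 1" "0 \<le> \<beta>" "\<beta> \<le> 1" "0 \<le> p" "p \<le> 1"
    "\<alpha> * \<beta> = p * ((1 - \<alpha>) * (1 - \<beta>))"
begin

lemma column_stationary:
  "do {I \<leftarrow> bernoulli_pmf \<alpha>; Js \<leftarrow> replicate_pmf n (bernoulli_pmf \<beta>); ws \<leftarrow> replicate_pmf n (bernoulli_pmf p); return_pmf (column I Js ws)}
   = do {I \<leftarrow> bernoulli_pmf \<alpha>; Js \<leftarrow> replicate_pmf n (bernoulli_pmf \<beta>); return_pmf (Js, I)}"
proof (induction n)
  case 0
  then show ?case by (simp add: bind_return_pmf)
next
  case (Suc n)
  let ?s = "bernoulli_pmf \<alpha>" and ?r = "bernoulli_pmf \<beta>" and ?p = "bernoulli_pmf p"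
  let ?Js = "replicate_pmf n (bernoulli_pmf \<beta>)" and ?ws = "replicate_pmf n (bernoulli_pmf p)"
  let ?f = "\<lambda>I' J' Js ws. return_pmf (J' # fst (column I' Js ws), snd (column I' Js ws))"
  have "do {I \<leftarrow> ?s; Js \<leftarrow> replicate_pmf (Suc n) ?r; ws \<leftarrow> replicate_pmf (Suc n) ?p; return_pmf (column I Js ws)}
    = do {I \<leftarrow> ?s; J \<leftarrow> ?r; Js \<leftarrow> ?Js; w \<leftarrow> ?p; ws \<leftarrow> ?ws;
          ?f (fst (corner I J w)) (snd (corner I J w)) Js ws}"
    by (simp add: bind_assoc_pmf bind_return_pmf case_prod_unfold Let_def)
  also have "\<dots> = do {I \<leftarrow> ?s; J \<leftarrow> ?r; w \<leftarrow> ?p; Js \<leftarrow> ?Js; ws \<leftarrow> ?ws;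
          ?f (fst (corner I J w)) (snd (corner I J w)) Js ws}"
    by (subst bind_commute_pmf[of ?Js ?p]) (rule refl)
  also have "\<dots> = do {IJ \<leftarrow> do {I \<leftarrow> ?s; J \<leftarrow> ?r; w \<leftarrow> ?p; return_pmf (corner I J w)};
          Js \<leftarrow> ?Js; ws \<leftarrow> ?ws; ?f (fst IJ) (snd IJ) Js ws}"
    by (simp add: bind_assoc_pmf bind_return_pmf)
  also have "\<dots> = do {I \<leftarrow> ?s; J \<leftarrow> ?r; Js \<leftarrow> ?Js; ws \<leftarrow> ?ws; ?f I J Js ws}"
    unfolding corner_stationary[OF rates] by (simp add: bind_assoc_pmf bind_return_pmf)
  also have "\<dots> = do {J \<leftarrow> ?r; I \<leftarrow> ?s; Js \<leftarrow> ?Js; ws \<leftarrow> ?ws; ?f I J Js ws}"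
    by (rule bind_commute_pmf)
  also have "\<dots> = do {J \<leftarrow> ?r;
       JI \<leftarrow> do {I \<leftarrow> ?s; Js \<leftarrow> ?Js; ws \<leftarrow> ?ws; return_pmf (column I Js ws)};
       return_pmf (J # fst JI, snd JI)}"
    by (simp add: bind_assoc_pmf bind_return_pmf)
  also have "\<dots> = do {J \<leftarrow> ?r; I \<leftarrow> ?s; Js \<leftarrow> ?Js; return_pmf (J # Js, I)}"
    unfolding Suc.IH by (simp add: bind_assoc_pmf bind_return_pmf)
  also have "\<dots> = do {I \<leftarrow> ?s; J \<leftarrow> ?r; Js \<leftarrow> ?Js; return_pmf (J # Js, I)}"
    by (rule bind_commute_pmf)
  also have "\<dots> = do {I \<leftarrow> ?s; Js \<leftarrow> replicate_pmf (Suc n) ?r; return_pmf (Js, I)}"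
    by (simp add: bind_assoc_pmf bind_return_pmf)
  finally show ?case .
qed

text \<open>
  Only the top increment of each column is forgotten, and the right sides of a column are the left
  sides of the next one.
\<close>

lemma columns_stationary:
  "do {Is \<leftarrow> replicate_pmf m (bernoulli_pmf \<alpha>); Js \<leftarrow> replicate_pmf n (bernoulli_pmf \<beta>); ws \<leftarrow> replicate_pmf (m * n) (bernoulli_pmf p);
       return_pmf (columns n Is Js ws)} = replicate_pmf n (bernoulli_pmf \<beta>)"
proof (induction m)
  case 0
  then show ?case by (simp add: bind_return_pmf bind_return_pmf')
next
  case (Suc m)
  let ?s = "bernoulli_pmf \<alpha>" and ?Is = "replicate_pmf m (bernoulli_pmf \<alpha>)" and ?Js = "replicate_pmf n (bernoulli_pmf \<beta>)"
  let ?w = "replicate_pmf n (bernoulli_pmf p)" and ?ws = "replicate_pmf (m * n) (bernoulli_pmf p)"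
  have "do {Is \<leftarrow> replicate_pmf (Suc m) (bernoulli_pmf \<alpha>); Js \<leftarrow> ?Js; ws \<leftarrow> replicate_pmf (Suc m * n) (bernoulli_pmf p);
       return_pmf (columns n Is Js ws)}
    = do {I \<leftarrow> ?s; Is \<leftarrow> ?Is; Js \<leftarrow> ?Js;
          w \<leftarrow> ?w; ws \<leftarrow> ?ws;
          return_pmf (columns n Is (fst (column I Js (take n (w @ ws)))) (drop n (w @ ws)))}"
    by (simp add: bind_assoc_pmf bind_return_pmf replicate_pmf_distrib)
  also have "\<dots> = do {I \<leftarrow> ?s; Is \<leftarrow> ?Is; Js \<leftarrow> ?Js;
          w \<leftarrow> ?w; ws \<leftarrow> ?ws;
          return_pmf (columns n Is (fst (column I Js w)) ws)}"
    by (intro bind_pmf_cong refl) (auto simp: set_replicate_pmf)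
  also have "\<dots> = do {I \<leftarrow> ?s; Is \<leftarrow> ?Is;
          J \<leftarrow> do {Js \<leftarrow> ?Js; w \<leftarrow> ?w; return_pmf (column I Js w)};
          ws \<leftarrow> ?ws;
          return_pmf (columns n Is (fst J) ws)}"
    by (simp add: bind_assoc_pmf bind_return_pmf)
  also have "\<dots> = do {Is \<leftarrow> ?Is; I \<leftarrow> ?s;
          J \<leftarrow> do {Js \<leftarrow> ?Js; w \<leftarrow> ?w; return_pmf (column I Js w)};
          ws \<leftarrow> ?ws;
          return_pmf (columns n Is (fst J) ws)}"
    by (rule bind_commute_pmf)
  also have "\<dots> = do {Is \<leftarrow> ?Is;
          J \<leftarrow> do {I \<leftarrow> ?s; Js \<leftarrow> ?Js; w \<leftarrow> ?w; return_pmf (column I Js w)};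
          ws \<leftarrow> ?ws;
          return_pmf (columns n Is (fst J) ws)}"
    by (simp add: bind_assoc_pmf bind_return_pmf)
  also have "\<dots> = do {Is \<leftarrow> ?Is; Js \<leftarrow> ?Js;
          ws \<leftarrow> ?ws; return_pmf (columns n Is Js ws)}"
    unfolding column_stationary by (simp add: bind_assoc_pmf bind_return_pmf bind_pmf_const)
  finally show ?case using Suc.IH by simp
qed

end

section \<open>Chernoff bounds for Bernoulli sequences\<close>

definition trues :: "bool list \<Rightarrow> nat" where
  "trues bs = length (filter id bs)"

lemma nn_integral_exp_trues:
  assumes "0 \<le> q" "q \<le> 1"
  shows "(\<integral>\<^sup>+bs. ennreal (exp (\<theta> * real (trues bs))) \<partial>replicate_pmf n (bernoulli_pmf q)) =
         ennreal ((1 + q * (exp \<theta> - 1)) ^ n)"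
proof (induction n)
  case 0
  then show ?case by (simp add: trues_def)
next
  case (Suc n)
  have e: "ennreal (exp (\<theta> * real (trues (b # bs)))) =
      ennreal (if b then exp \<theta> else 1) * ennreal (exp (\<theta> * real (trues bs)))" for b bs
    by (simp add: trues_def distrib_left exp_add ennreal_mult)
  have nn: "0 \<le> 1 + q * (exp \<theta> - 1)"
    using assms mult_left_mono[of "-1" "exp \<theta> - 1" q] by simp
  have "(\<integral>\<^sup>+bs. ennreal (exp (\<theta> * real (trues bs))) \<partial>replicate_pmf (Suc n) (bernoulli_pmf q)) =
    (\<integral>\<^sup>+b. ennreal (if b then exp \<theta> else 1) * ennreal ((1 + q * (exp \<theta> - 1)) ^ n) \<partial>bernoulli_pmf q)"
    by (simp add: nn_integral_bind_pmf e nn_integral_cmult Suc.IH)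
  also have "\<dots> = ennreal (1 + q * (exp \<theta> - 1)) * ennreal ((1 + q * (exp \<theta> - 1)) ^ n)"
    using assms by (simp add: nn_integral_multc ennreal_mult[symmetric] ennreal_plus[symmetric] algebra_simps del: ennreal_plus)
  finally show ?case using nn by (simp add: ennreal_mult)
qed

lemma one_plus_power_le_exp:
  fixes z :: real
  assumes "0 \<le> 1 + z"
  shows "(1 + z) ^ n \<le> exp (real n * z)"
  using power_mono[OF exp_ge_add_one_self[of z] assms, of n] by (simp add: exp_of_nat_mult)

text \<open>
  Negative \<open>\<theta>\<close> are admitted; they give bounds for the lower tail.
\<close>

lemma trues_chernoff:
  assumes "0 \<le> q" "q \<le> 1"
    and "\<And>bs. P bs \<Longrightarrow> c \<le> \<theta> * real (trues bs)"
  shows "measure_pmf.prob (replicate_pmf n (bernoulli_pmf q)) {bs. P bs}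
     \<le> exp (real n * q * (exp \<theta> - 1) - c)"
proof -
  let ?\<mu> = "replicate_pmf n (bernoulli_pmf q)"
  have nn: "0 \<le> 1 + q * (exp \<theta> - 1)"
    using assms mult_left_mono[of "-1" "exp \<theta> - 1" q] by simp
  have "emeasure ?\<mu> {bs. P bs} = (\<integral>\<^sup>+bs. indicator {bs. P bs} bs \<partial>?\<mu>)" by simp
  also have "\<dots> \<le> (\<integral>\<^sup>+bs. ennreal (exp (- c)) * ennreal (exp (\<theta> * real (trues bs))) \<partial>?\<mu>)"
    using assms(3) by (intro nn_integral_mono)
      (auto simp: indicator_def ennreal_mult[symmetric] exp_add[symmetric])
  also have "\<dots> = ennreal (exp (- c) * (1 + q * (exp \<theta> - 1)) ^ n)"
    using nn by (simp add: nn_integral_cmult nn_integral_exp_trues[OF assms(1,2)] ennreal_mult)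
  also have "\<dots> \<le> ennreal (exp (- c) * exp (real n * (q * (exp \<theta> - 1))))"
    by (intro ennreal_leI mult_left_mono one_plus_power_le_exp nn) auto
  also have "\<dots> = ennreal (exp (real n * q * (exp \<theta> - 1) - c))"
    by (simp add: exp_add[symmetric] algebra_simps)
  finally show ?thesis by (simp add: measure_pmf.emeasure_eq_measure)
qed

lemma exp_minus_le_quadratic:
  fixes \<theta> :: real
  assumes "0 \<le> \<theta>"
  shows "exp (- \<theta>) \<le> 1 - \<theta> + \<theta>\<^sup>2"
proof -
  have "1 \<le> (1 - \<theta> + \<theta>\<^sup>2) * (1 + \<theta>)"
    using assms by (simp add: algebra_simps power2_eq_square)
  moreover have "0 \<le> 1 - \<theta> + \<theta>\<^sup>2"
    using zero_le_power2[of "\<theta> - 1/2"] by (simp add: power2_eq_square algebra_simps)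
  ultimately have "1 \<le> (1 - \<theta> + \<theta>\<^sup>2) * exp \<theta>"
    using mult_left_mono[OF exp_ge_add_one_self[of \<theta>], of "1 - \<theta> + \<theta>\<^sup>2"] by linarith
  then show ?thesis by (simp add: exp_minus field_simps)
qed

text \<open>
  Deviations are measured in units of \<open>s\<close>, which only has to dominate the mean. So one scale serves
  for initial segments of different lengths. The exponent comes from \<open>\<theta> = e / 2\<close>.
\<close>

lemma trues_upper_tail:
  assumes "0 \<le> q" "q \<le> 1" "real n * q \<le> \<mu>" "\<mu> \<le> s" "0 \<le> e" "e \<le> 2"
  shows "measure_pmf.prob (replicate_pmf n (bernoulli_pmf q)) {bs. \<mu> + e * s \<le> real (trues bs)}
     \<le> exp (- (e\<^sup>2 / 4) * s)"
proof -
  let ?\<theta> = "e / 2"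
  have "measure_pmf.prob (replicate_pmf n (bernoulli_pmf q)) {bs. \<mu> + e * s \<le> real (trues bs)}
     \<le> exp (real n * q * (exp ?\<theta> - 1) - ?\<theta> * (\<mu> + e * s))"
    using assms by (intro trues_chernoff mult_left_mono) auto
  also have "\<dots> \<le> exp (- (e\<^sup>2 / 4) * s)"
  proof -
    have nq: "0 \<le> real n * q" using assms by simp
    have "exp ?\<theta> - 1 \<le> ?\<theta> + ?\<theta>\<^sup>2" using exp_bound[of ?\<theta>] assms by simp
    then have "real n * q * (exp ?\<theta> - 1) \<le> real n * q * (?\<theta> + ?\<theta>\<^sup>2)"
      by (rule mult_left_mono) (use nq in simp)
    also have "\<dots> \<le> \<mu> * (?\<theta> + ?\<theta>\<^sup>2)"
      using assms by (intro mult_right_mono) auto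
    also have "\<dots> \<le> \<mu> * ?\<theta> + s * ?\<theta>\<^sup>2"
      using assms mult_right_mono[of \<mu> s "?\<theta>\<^sup>2"] by (simp add: distrib_left)
    finally have "real n * q * (exp ?\<theta> - 1) - ?\<theta> * (\<mu> + e * s) \<le> \<mu> * ?\<theta> + s * ?\<theta>\<^sup>2 - ?\<theta> * (\<mu> + e * s)"
      by simp
    also have "\<dots> = - (e\<^sup>2 / 4) * s" by (simp add: power2_eq_square field_simps)
    finally show ?thesis by simp
  qed
  finally show ?thesis .
qed

lemma trues_lower_tail:
  assumes "0 \<le> q" "q \<le> 1" "real n * q \<le> s" "0 \<le> e"
  shows "measure_pmf.prob (replicate_pmf n (bernoulli_pmf q)) {bs. real (trues bs) \<le> real n * q - e * s}
     \<le> exp (- (e\<^sup>2 / 4) * s)"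
proof -
  let ?\<theta> = "e / 2"
  have "measure_pmf.prob (replicate_pmf n (bernoulli_pmf q)) {bs. real (trues bs) \<le> real n * q - e * s}
     \<le> exp (real n * q * (exp (- ?\<theta>) - 1) - (- ?\<theta> * (real n * q - e * s)))"
    using assms by (intro trues_chernoff mult_left_mono_neg) auto
  also have "\<dots> \<le> exp (- (e\<^sup>2 / 4) * s)"
  proof -
    have nq: "0 \<le> real n * q" using assms by simp
    have "real n * q * (exp (- ?\<theta>) - 1) \<le> real n * q * (- ?\<theta> + ?\<theta>\<^sup>2)"
      using exp_minus_le_quadratic[of ?\<theta>] assms by (intro mult_left_mono nq) auto
    also have "\<dots> \<le> - (real n * q) * ?\<theta> + s * ?\<theta>\<^sup>2"
      using mult_right_mono[OF assms(3), of "?\<theta>\<^sup>2"] by (simp add: right_diff_distrib)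
    finally have "real n * q * (exp (- ?\<theta>) - 1) - (- ?\<theta> * (real n * q - e * s)) \<le>
        - (real n * q) * ?\<theta> + s * ?\<theta>\<^sup>2 - (- ?\<theta> * (real n * q - e * s))"
      by simp
    also have "\<dots> = - (e\<^sup>2 / 4) * s" by (simp add: power2_eq_square field_simps)
    finally show ?thesis by simp
  qed
  finally show ?thesis .
qed

section \<open>Last passage times with sources and sinks\<close>

text \<open>
  A path collects the sources \<open>s\<close> along the bottom side or the sinks \<open>r\<close> along the left side, and then
  points of \<open>X\<close> with both coordinates strictly increasing.
\<close>

fun last_passage :: "(nat \<Rightarrow> bool) \<Rightarrow> (nat \<Rightarrow> bool) \<Rightarrow> (nat \<times> nat) set \<Rightarrow> nat \<Rightarrow> nat \<Rightarrow> nat" where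
  "last_passage s r X 0 0 = 0"
| "last_passage s r X (Suc i) 0 = last_passage s r X i 0 + of_bool (s i)"
| "last_passage s r X 0 (Suc j) = last_passage s r X 0 j + of_bool (r j)"
| "last_passage s r X (Suc i) (Suc j) =
     max (max (last_passage s r X i (Suc j)) (last_passage s r X (Suc i) j))
         (last_passage s r X i j + of_bool ((i, j) \<in> X))"

context
  fixes s r :: "nat \<Rightarrow> bool" and X :: "(nat \<times> nat) set"
begin

abbreviation "lp \<equiv> last_passage s r X"

lemma last_passage_incr:
  "lp i j \<le> lp (Suc i) j \<and> lp (Suc i) j \<le> Suc (lp i j) \<and> lp i j \<le> lp i (Suc j) \<and> lp i (Suc j) \<le> Suc (lp i j)"
proof (induction "i + j" arbitrary: i j rule: less_induct)
  case less
  have a: "lp i j \<le> lp (Suc i) j \<and> lp (Suc i) j \<le> Suc (lp i j)"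
  proof (cases j)
    case (Suc j')
    then show ?thesis using less[of i j'] by (auto simp: of_bool_def split: if_splits)
  qed simp
  have b: "lp i j \<le> lp i (Suc j) \<and> lp i (Suc j) \<le> Suc (lp i j)"
  proof (cases i)
    case (Suc i')
    then show ?thesis using less[of i' j] by (auto simp: of_bool_def split: if_splits)
  qed simp
  show ?case using a b by simp
qed

lemma last_passage_mono: "i \<le> i' \<Longrightarrow> j \<le> j' \<Longrightarrow> lp i j \<le> lp i' j'"
  by (rule order_trans[OF lift_Suc_mono_le[of "\<lambda>i. lp i j"] lift_Suc_mono_le[of "\<lambda>j. lp i' j"]])
    (use last_passage_incr in auto)

definition horizontal_incr where "horizontal_incr i j \<longleftrightarrow> lp i j < lp (Suc i) j"
definition vertical_incr where "vertical_incr i j \<longleftrightarrow> lp i j < lp i (Suc j)"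

lemma corner_last_passage:
  "corner (horizontal_incr i j) (vertical_incr i j) ((i, j) \<in> X) = (horizontal_incr i (Suc j), vertical_incr (Suc i) j)"
  using last_passage_incr[of i j] last_passage_incr[of "Suc i" j] last_passage_incr[of i "Suc j"]
  by (auto simp: corner_def horizontal_incr_def vertical_incr_def of_bool_def split: if_splits)

lemma column_last_passage:
  assumes "k \<le> n"
  shows "column (horizontal_incr i k) (map (vertical_incr i) [k..<n]) (map (\<lambda>j. (i, j) \<in> X) [k..<n]) =
         (map (vertical_incr (Suc i)) [k..<n], horizontal_incr i n)"
  using assms
proof (induction "n - k" arbitrary: k)
  case (Suc d)
  then have k: "[k..<n] = k # [Suc k..<n]" by (simp add: upt_conv_Cons)
  show ?case
    using Suc.hyps(1)[of "Suc k"] Suc.hyps(2) Suc.prems by (simp add: k corner_last_passage)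
qed simp

lemma columns_last_passage:
  assumes "k \<le> m"
  shows "columns n (map s [k..<m]) (map (vertical_incr k) [0..<n])
     (map (\<lambda>c. c \<in> X) (concat (map (\<lambda>i. map (Pair i) [0..<n]) [k..<m]))) = map (vertical_incr m) [0..<n]"
  using assms
proof (induction "m - k" arbitrary: k)
  case (Suc d)
  then have k: "[k..<m] = k # [Suc k..<m]" by (simp add: upt_conv_Cons)
  have "horizontal_incr k 0 = s k" by (simp add: horizontal_incr_def)
  then show ?case
    using Suc.hyps(1)[of "Suc k"] Suc.hyps(2) Suc.prems column_last_passage[of 0 n k]
    by (simp add: k comp_def)
qed simp

text \<open>
  Together with \<open>last_passage_bottom\<close> this reads off the value along the bottom and the right side.
  In the stationary model both contributions are sums of independent variables.
\<close>

lemma last_passage_right: "lp m n = lp m 0 + trues (map (vertical_incr m) [0..<n])"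
proof (induction n)
  case (Suc n)
  then show ?case using last_passage_incr[of m n] by (auto simp: trues_def vertical_incr_def)
qed (simp add: trues_def)

lemma last_passage_bottom: "lp m 0 = trues (map s [0..<m])"
  by (induction m) (auto simp: trues_def)

lemma last_passage_left: "lp 0 n = trues (map r [0..<n])"
  by (induction n) (auto simp: trues_def)

lemma vertical_incr_0: "vertical_incr 0 = r"
  by (auto simp: vertical_incr_def fun_eq_iff)

text \<open>
  A chain is a path that collects neither sources nor sinks.
\<close>

lemma chain_le_last_passage:
  assumes "has_chain (1, 1) X UNIV k" "X \<subseteq> grid m n"
  shows "k \<le> lp m n"
proof -
  obtain cs where cs: "length cs = k" "set cs \<subseteq> X" "successively (gap_le (1, 1)) cs"
    using assms(1) unfolding has_chain_def by blast
  have "cs \<noteq> [] \<longrightarrow> length cs \<le> lp (Suc (fst (last cs))) (Suc (snd (last cs)))"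
    using cs(2,3)
  proof (induction cs rule: rev_induct)
    case (snoc c cs)
    have "length cs \<le> lp (fst c) (snd c)"
    proof (cases "cs = []")
      case False
      then have "gap_le (1, 1) (last cs) c" using snoc.prems by (simp add: successively_append_iff)
      then have "lp (Suc (fst (last cs))) (Suc (snd (last cs))) \<le> lp (fst c) (snd c)"
        by (intro last_passage_mono) (auto simp: gap_le_def)
      then show ?thesis using snoc False by (auto simp: successively_append_iff)
    qed simp
    then show ?case using snoc.prems by (cases c) (auto simp: le_max_iff_disj)
  qed simp
  moreover have "lp (Suc (fst (last cs))) (Suc (snd (last cs))) \<le> lp m n" if "cs \<noteq> []"
  proof -
    have "last cs \<in> grid m n" using that cs(2) assms(2) last_in_set by blast
    then show ?thesis by (intro last_passage_mono) (auto simp: grid_def)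
  qed
  ultimately show ?thesis using cs(1) by (cases "cs = []") auto
qed

definition subgrid :: "nat \<Rightarrow> nat \<Rightarrow> nat \<Rightarrow> nat \<Rightarrow> (nat \<times> nat) set" where
  "subgrid i j m n = {i..<m} \<times> {j..<n}"

lemma has_chain_snoc:
  assumes "has_chain (1, 1) (Y \<inter> subgrid i0 j0 i j) UNIV k" "(i, j) \<in> Y" "i0 \<le> i" "j0 \<le> j"
  shows "has_chain (1, 1) (Y \<inter> subgrid i0 j0 (Suc i) (Suc j)) UNIV (Suc k)"
proof -
  obtain cs where cs: "length cs = k" "set cs \<subseteq> Y \<inter> subgrid i0 j0 i j" "successively (gap_le (1, 1)) cs"
    using assms(1) unfolding has_chain_def by blast
  have "gap_le (1, 1) (last cs) (i, j)" if "cs \<noteq> []"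
  proof -
    have "last cs \<in> subgrid i0 j0 i j" using that cs(2) last_in_set by blast
    then show ?thesis by (auto simp: subgrid_def gap_le_def)
  qed
  then have "successively (gap_le (1, 1)) (cs @ [(i, j)])"
    using cs(3) by (auto simp: successively_append_iff)
  moreover have "set (cs @ [(i, j)]) \<subseteq> Y \<inter> subgrid i0 j0 (Suc i) (Suc j)"
    using cs(2) assms(2-4) unfolding subgrid_def by auto
  ultimately show ?thesis unfolding has_chain_def using cs(1) by (intro exI[of _ "cs @ [(i, j)]"]) simp
qed

lemma subgrid_mono: "m \<le> m' \<Longrightarrow> n \<le> n' \<Longrightarrow> subgrid i j m n \<subseteq> subgrid i j m' n'"
  by (auto simp: subgrid_def)

text \<open>
  An optimal path stays on one of the two sides until it leaves at an exit point; from there on it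
  is a strict chain in the remaining rectangle.
\<close>

lemma last_passage_exit:
  "(\<exists>i\<le>m. \<exists>k. has_chain (1, 1) (X \<inter> subgrid i 0 m n) UNIV k \<and> lp m n = lp i 0 + k) \<or>
   (\<exists>j\<le>n. \<exists>k. has_chain (1, 1) (X \<inter> subgrid 0 j m n) UNIV k \<and> lp m n = lp 0 j + k)"
  (is "?A m n \<or> ?B m n")
proof (induction "m + n" arbitrary: m n rule: less_induct)
  case less
  have triv: "has_chain (1, 1) Y UNIV 0" for Y by (auto simp: has_chain_def)
  have mono: "?A m n \<or> ?B m n"
    if "?A m' n' \<or> ?B m' n'" "m' \<le> m" "n' \<le> n" "lp m n = lp m' n'" for m' n'
    using that(1)
  proof
    assume "?A m' n'"
    then obtain i k where "i \<le> m'" "has_chain (1, 1) (X \<inter> subgrid i 0 m' n') UNIV k" "lp m' n' = lp i 0 + k"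
      by blast
    then have "i \<le> m \<and> has_chain (1, 1) (X \<inter> subgrid i 0 m n) UNIV k \<and> lp m n = lp i 0 + k"
      using that has_chain_mono[OF _ Int_mono[OF order_refl subgrid_mono]] by simp
    then show ?thesis by blast
  next
    assume "?B m' n'"
    then obtain j k where "j \<le> n'" "has_chain (1, 1) (X \<inter> subgrid 0 j m' n') UNIV k" "lp m' n' = lp 0 j + k"
      by blast
    then have "j \<le> n \<and> has_chain (1, 1) (X \<inter> subgrid 0 j m n) UNIV k \<and> lp m n = lp 0 j + k"
      using that has_chain_mono[OF _ Int_mono[OF order_refl subgrid_mono]] by simp
    then show ?thesis by blast
  qed
  show ?case
  proof (cases "m = 0 \<or> n = 0")
    case True
    then show ?thesis
    proof
      assume "m = 0"
      then show ?thesis using triv by (intro disjI2 exI[of _ n] conjI exI[of _ 0]) auto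
    next
      assume "n = 0"
      then show ?thesis using triv by (intro disjI1 exI[of _ m] conjI exI[of _ 0]) auto
    qed
  next
    case False
    then obtain i j where ij: "m = Suc i" "n = Suc j" by (metis not0_implies_Suc)
    have "lp m n = lp i n \<or> lp m n = lp m j \<or> ((i, j) \<in> X \<and> lp m n = Suc (lp i j))"
      using last_passage_incr[of i j] unfolding ij last_passage.simps(4)
      by (cases "(i, j) \<in> X") (simp_all del: last_passage.simps, linarith+)
    then consider "lp m n = lp i n" | "lp m n = lp m j" | "(i, j) \<in> X" "lp m n = Suc (lp i j)"
      by blast
    then show ?thesis
    proof cases
      case 1 then show ?thesis using less[of i n] ij by (intro mono[of i n]) auto
    next
      case 2 then show ?thesis using less[of m j] ij by (intro mono[of m j]) auto
    next
      case 3
      from less[of i j] ij have "?A i j \<or> ?B i j" by simp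
      then show ?thesis
      proof
        assume "?A i j"
        then obtain i0 k where "i0 \<le> i" "has_chain (1, 1) (X \<inter> subgrid i0 0 i j) UNIV k" "lp i j = lp i0 0 + k"
          by blast
        then have "has_chain (1, 1) (X \<inter> subgrid i0 0 m n) UNIV (Suc k) \<and> lp m n = lp i0 0 + Suc k \<and> i0 \<le> m"
          using has_chain_snoc[of X i0 0 i j k] 3 ij by simp
        then show ?thesis by blast
      next
        assume "?B i j"
        then obtain j0 k where "j0 \<le> j" "has_chain (1, 1) (X \<inter> subgrid 0 j0 i j) UNIV k" "lp i j = lp 0 j0 + k"
          by blast
        then have "has_chain (1, 1) (X \<inter> subgrid 0 j0 m n) UNIV (Suc k) \<and> lp m n = lp 0 j0 + Suc k \<and> j0 \<le> n"
          using has_chain_snoc[of X 0 j0 i j k] 3 ij by simp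
        then show ?thesis by blast
      qed
    qed
  qed
qed

end

section \<open>Exponential tails for strict chains\<close>

lemma bernoulli_set_to_list:
  assumes "distinct idx"
  shows "map_pmf (\<lambda>X. map (\<lambda>c. c \<in> X) idx) (bernoulli_set (set idx) p) =
         replicate_pmf (length idx) (bernoulli_pmf p)"
proof -
  have "map_pmf (\<lambda>f. map f idx) (Pi_pmf (set idx) False (\<lambda>_. bernoulli_pmf p)) =
         replicate_pmf (length idx) (bernoulli_pmf p)"
    using assms
  proof (induction idx)
    case (Cons c idx)
    have e: "map (f(c := y)) idx = map f idx" for f :: "'a \<Rightarrow> bool" and y
      using Cons.prems by auto
    have "map_pmf (\<lambda>f. map f (c # idx)) (Pi_pmf (set (c # idx)) False (\<lambda>_. bernoulli_pmf p))
      = do {y \<leftarrow> bernoulli_pmf p; bs \<leftarrow> map_pmf (\<lambda>f. map f idx) (Pi_pmf (set idx) False (\<lambda>_. bernoulli_pmf p));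
            return_pmf (y # bs)}"
      using Cons.prems by (simp add: Pi_pmf_insert' map_bind_pmf bind_map_pmf e)
    then show ?case using Cons by simp
  qed simp
  then show ?thesis by (simp add: bernoulli_set_def map_pmf_comp)
qed

definition boundary_law :: "nat \<Rightarrow> nat \<Rightarrow> real \<Rightarrow> real \<Rightarrow> real \<Rightarrow> (bool list \<times> bool list \<times> (nat \<times> nat) set) pmf" where
  "boundary_law m n \<alpha> \<beta> p = do {Is \<leftarrow> replicate_pmf m (bernoulli_pmf \<alpha>); Js \<leftarrow> replicate_pmf n (bernoulli_pmf \<beta>);
     X \<leftarrow> bernoulli_set (grid m n) p; return_pmf (Is, Js, X)}"

lemma boundary_law_marginals:
  shows boundary_law_sources: "map_pmf (\<lambda>(Is, Js, X). Is) (boundary_law m n \<alpha> \<beta> p) = replicate_pmf m (bernoulli_pmf \<alpha>)"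
    and boundary_law_sinks: "map_pmf (\<lambda>(Is, Js, X). Js) (boundary_law m n \<alpha> \<beta> p) = replicate_pmf n (bernoulli_pmf \<beta>)"
    and boundary_law_points: "map_pmf (\<lambda>(Is, Js, X). X) (boundary_law m n \<alpha> \<beta> p) = bernoulli_set (grid m n) p"
  by (simp_all add: boundary_law_def map_bind_pmf bind_return_pmf')

definition right_increments :: "nat \<Rightarrow> nat \<Rightarrow> bool list \<times> bool list \<times> (nat \<times> nat) set \<Rightarrow> bool list" where
  "right_increments m n = (\<lambda>(Is, Js, X). map (vertical_incr (nth Is) (nth Js) X m) [0..<n])"

text \<open>
  The Burke property: seen from the right side, the rectangle with its sources and points is
  indistinguishable from the sinks on the left side.
\<close>

lemma right_increments_law:
  assumes "0 \<le> \<alpha>" "\<alpha> \<le> 1" "0 \<le> \<beta>" "\<beta> \<le> 1" "0 \<le> p" "p \<le> 1" "\<alpha> * \<beta> = p * ((1 - \<alpha>) * (1 - \<beta>))"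
  shows "map_pmf (right_increments m n) (boundary_law m n \<alpha> \<beta> p) = replicate_pmf n (bernoulli_pmf \<beta>)"
proof -
  let ?idx = "concat (map (\<lambda>i. map (Pair i) [0..<n]) [0..<m])"
  have set: "set ?idx = grid m n" by (auto simp: grid_def)
  have len: "length ?idx = m * n" by (simp add: length_concat comp_def sum_list_triv)
  have dist: "distinct ?idx"
    by (induction m) (auto simp: distinct_map inj_on_def)
  have "map_pmf (right_increments m n) (boundary_law m n \<alpha> \<beta> p) =
     do {Is \<leftarrow> replicate_pmf m (bernoulli_pmf \<alpha>); Js \<leftarrow> replicate_pmf n (bernoulli_pmf \<beta>);
       X \<leftarrow> bernoulli_set (grid m n) p; return_pmf (right_increments m n (Is, Js, X))}"
    by (simp add: boundary_law_def map_bind_pmf)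
  also have "\<dots> = do {Is \<leftarrow> replicate_pmf m (bernoulli_pmf \<alpha>); Js \<leftarrow> replicate_pmf n (bernoulli_pmf \<beta>);
       X \<leftarrow> bernoulli_set (grid m n) p; return_pmf (columns n Is Js (map (\<lambda>c. c \<in> X) ?idx))}"
  proof (intro bind_pmf_cong refl)
    fix Is Js X
    assume "Is \<in> set_pmf (replicate_pmf m (bernoulli_pmf \<alpha>))" "Js \<in> set_pmf (replicate_pmf n (bernoulli_pmf \<beta>))"
    then have "length Is = m" "length Js = n" by (auto simp: set_replicate_pmf)
    then have "map (nth Is) [0..<m] = Is" "map (nth Js) [0..<n] = Js" by (auto simp: map_nth)
    then have "right_increments m n (Is, Js, X) = columns n Is Js (map (\<lambda>c. c \<in> X) ?idx)"
      using columns_last_passage[of 0 m n "nth Is" "nth Js" X] by (simp add: right_increments_def vertical_incr_0)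
    then show "return_pmf (right_increments m n (Is, Js, X)) = return_pmf (columns n Is Js (map (\<lambda>c. c \<in> X) ?idx))"
      by simp
  qed
  also have "\<dots> = do {Is \<leftarrow> replicate_pmf m (bernoulli_pmf \<alpha>); Js \<leftarrow> replicate_pmf n (bernoulli_pmf \<beta>);
       ws \<leftarrow> map_pmf (\<lambda>X. map (\<lambda>c. c \<in> X) ?idx) (bernoulli_set (set ?idx) p); return_pmf (columns n Is Js ws)}"
    unfolding set by (simp only: bind_map_pmf)
  also have "\<dots> = replicate_pmf n (bernoulli_pmf \<beta>)"
    unfolding bernoulli_set_to_list[OF dist] len by (rule columns_stationary[OF assms])
  finally show ?thesis .
qed

lemma prob_map_le:
  assumes "map_pmf f \<nu> = \<mu>" "measure_pmf.prob \<mu> {y. Q y} \<le> c" "\<And>x. x \<in> set_pmf \<nu> \<Longrightarrow> P x \<Longrightarrow> Q (f x)"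
  shows "measure_pmf.prob \<nu> {x. P x} \<le> c"
proof -
  have "measure_pmf.prob \<nu> {x. P x} \<le> measure_pmf.prob \<nu> (f -` {y. Q y})"
    using assms(3) by (intro measure_pmf.finite_measure_mono_AE) (auto simp: AE_measure_pmf_iff)
  then show ?thesis using assms(1,2) by (metis measure_map_pmf order_trans)
qed

lemma prob_union_le:
  assumes "\<And>x. x \<in> set_pmf \<mu> \<Longrightarrow> P x \<Longrightarrow> Q x \<or> R x"
    "measure_pmf.prob \<mu> {x. Q x} \<le> c" "measure_pmf.prob \<mu> {x. R x} \<le> d"
  shows "measure_pmf.prob \<mu> {x. P x} \<le> c + d"
proof -
  have "measure_pmf.prob \<mu> {x. P x} \<le> measure_pmf.prob \<mu> ({x. Q x} \<union> {x. R x})"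
    using assms(1) by (intro measure_pmf.finite_measure_mono_AE) (auto simp: AE_measure_pmf_iff)
  also have "\<dots> \<le> measure_pmf.prob \<mu> {x. Q x} + measure_pmf.prob \<mu> {x. R x}"
    by (rule measure_Un_le) auto
  finally show ?thesis using assms(2,3) by linarith
qed

lemma prob_ex_less_le:
  assumes "\<And>l. l < (K::nat) \<Longrightarrow> measure_pmf.prob \<mu> {x. P l x} \<le> c"
  shows "measure_pmf.prob \<mu> {x. \<exists>l<K. P l x} \<le> real K * c"
proof -
  have "measure_pmf.prob \<mu> (\<Union>l<K. {x. P l x}) \<le> (\<Sum>l<K. measure_pmf.prob \<mu> {x. P l x})"
    by (rule measure_UNION_le) auto
  also have "\<dots> \<le> (\<Sum>l<K. c)" using assms by (intro sum_mono) auto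
  also have "(\<Union>l<K. {x. P l x}) = {x. \<exists>l<K. P l x}" by auto
  finally show ?thesis by simp
qed

lemma boundary_law_support:
  "z \<in> set_pmf (boundary_law m n \<alpha> \<beta> p) \<Longrightarrow>
     length (fst z) = m \<and> length (fst (snd z)) = n \<and> snd (snd z) \<subseteq> grid m n"
proof -
  assume "z \<in> set_pmf (boundary_law m n \<alpha> \<beta> p)"
  then obtain Is Js X where z: "z = (Is, Js, X)" "length Is = m" "length Js = n"
      "X \<in> set_pmf (bernoulli_set (grid m n) p)"
    by (auto simp: boundary_law_def set_replicate_pmf)
  from bernoulli_set_subset[OF finite_grid z(4)] z(1-3) show ?thesis by simp
qed

lemma last_passage_corner:
  assumes "length Is = m"
  shows "last_passage (nth Is) (nth Js) X m n = trues Is + trues (right_increments m n (Is, Js, X))"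
  using assms last_passage_right[of "nth Is" "nth Js" X m n] last_passage_bottom[of "nth Is" "nth Js" X m]
  by (auto simp: right_increments_def map_nth)

text \<open>
  In terms of the odds \<open>A\<close> and \<open>B\<close> of sources and sinks, stationarity means that the points have
  density \<open>A * B\<close>.
\<close>

lemma odds_rates:
  fixes A B :: real
  assumes "0 < A" "0 < B" "A * B \<le> 1"
  defines "\<alpha> \<equiv> A / (1 + A)" and "\<beta> \<equiv> B / (1 + B)"
  shows "0 \<le> \<alpha>" "\<alpha> \<le> 1" "0 \<le> \<beta>" "\<beta> \<le> 1" "0 \<le> A * B" "A * B \<le> 1"
    "\<alpha> * \<beta> = A * B * ((1 - \<alpha>) * (1 - \<beta>))" "\<alpha> \<le> A" "\<beta> \<le> B"
proof -
  have "1 - \<alpha> = 1 / (1 + A)" "1 - \<beta> = 1 / (1 + B)" using assms by (simp_all add: field_simps)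
  then show "\<alpha> * \<beta> = A * B * ((1 - \<alpha>) * (1 - \<beta>))" by (simp add: \<alpha>_def \<beta>_def)
  show "\<alpha> \<le> A" "\<beta> \<le> B" using assms by (simp_all add: field_simps)
qed (use assms in \<open>simp_all add: field_simps\<close>)

text \<open>
  The chain is dominated by the stationary last passage time, the sum of a bottom part and a right
  part with means at most \<open>\<mu>\<close> and \<open>\<mu>'\<close>. Both parts are allowed to exceed these by \<open>e * s\<close>.
\<close>

lemma strict_chain_upper_tail:
  fixes A B s e \<mu> \<mu>' x :: real
  assumes AB: "0 < A" "0 < B" "A * B \<le> 1"
    and m: "real m * A \<le> \<mu>" "\<mu> \<le> s" and n: "real n * B \<le> \<mu>'" "\<mu>' \<le> s"
    and e: "0 \<le> e" "e \<le> 2" and x: "\<mu> + \<mu>' + 2 * e * s \<le> x"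
  shows "measure_pmf.prob (bernoulli_set (grid m n) (A * B)) {X. \<exists>k. has_chain (1, 1) X UNIV k \<and> x \<le> real k}
     \<le> 2 * exp (- (e\<^sup>2 / 4) * s)"
proof -
  define \<alpha> \<beta> where "\<alpha> = A / (1 + A)" and "\<beta> = B / (1 + B)"
  note r = odds_rates[OF AB, folded \<alpha>_def \<beta>_def]
  let ?\<nu> = "boundary_law m n \<alpha> \<beta> (A * B)"
  have "real m * \<alpha> \<le> \<mu>" "real n * \<beta> \<le> \<mu>'"
    using m n r(8,9) by (meson mult_left_mono of_nat_0_le_iff order_trans)+
  note tails = trues_upper_tail[OF r(1,2) this(1) m(2) e] trues_upper_tail[OF r(3,4) this(2) n(2) e]
  have b: "measure_pmf.prob ?\<nu> {z. \<mu> + e * s \<le> real (trues (fst z))} \<le> exp (- (e\<^sup>2 / 4) * s)"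
    by (rule prob_map_le[OF boundary_law_sources tails(1)]) auto
  have c: "measure_pmf.prob ?\<nu> {z. \<mu>' + e * s \<le> real (trues (right_increments m n z))} \<le> exp (- (e\<^sup>2 / 4) * s)"
    by (rule prob_map_le[OF right_increments_law[OF r(1-7)] tails(2)]) auto
  have "measure_pmf.prob ?\<nu> {z. \<exists>k. has_chain (1, 1) (snd (snd z)) UNIV k \<and> x \<le> real k}
      \<le> exp (- (e\<^sup>2 / 4) * s) + exp (- (e\<^sup>2 / 4) * s)"
  proof (rule prob_union_le[OF _ b c])
    fix z assume z: "z \<in> set_pmf ?\<nu>" and "\<exists>k. has_chain (1, 1) (snd (snd z)) UNIV k \<and> x \<le> real k"
    then obtain k where k: "has_chain (1, 1) (snd (snd z)) UNIV k" "x \<le> real k" by blast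
    have "k \<le> trues (fst z) + trues (right_increments m n z)"
      using chain_le_last_passage[OF k(1), of m n "nth (fst z)" "nth (fst (snd z))"]
        boundary_law_support[OF z] last_passage_corner[of "fst z" m "fst (snd z)" "snd (snd z)" n] by simp
    then show "\<mu> + e * s \<le> real (trues (fst z)) \<or> \<mu>' + e * s \<le> real (trues (right_increments m n z))"
      using k(2) x by linarith
  qed
  moreover have "measure_pmf.prob (bernoulli_set (grid m n) (A * B)) {X. \<exists>k. has_chain (1, 1) X UNIV k \<and> x \<le> real k}
    = measure_pmf.prob ?\<nu> {z. \<exists>k. has_chain (1, 1) (snd (snd z)) UNIV k \<and> x \<le> real k}"
    unfolding boundary_law_points[of m n \<alpha> \<beta> "A * B", symmetric] by (simp add: vimage_def case_prod_unfold)
  ultimately show ?thesis by simp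
qed

lemma prob_has_chain_subgrid:
  "measure_pmf.prob (bernoulli_set (grid m n) p) {X. P (\<lambda>k. has_chain (1, 1) (X \<inter> subgrid i j m n) UNIV k)} =
   measure_pmf.prob (bernoulli_set (grid (m - i) (n - j)) p) {X. P (\<lambda>k. has_chain (1, 1) X UNIV k)}"
proof -
  have sub: "subgrid i j m n \<subseteq> grid m n" by (auto simp: subgrid_def grid_def)
  have img: "subgrid i j m n = translate (i, j) ` grid (m - i) (n - j)"
  proof (intro set_eqI iffI)
    fix e assume "e \<in> subgrid i j m n"
    then show "e \<in> translate (i, j) ` grid (m - i) (n - j)"
      by (intro image_eqI[of _ _ "(fst e - i, snd e - j)"]) (auto simp: subgrid_def grid_def translate_def)
  qed (auto simp: subgrid_def grid_def translate_def)
  have "has_chain (1, 1) (translate (i, j) ` X) UNIV k = has_chain (1, 1) X UNIV k" for X k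
  proof -
    have "has_chain (1, 1) (translate (i, j) ` X) UNIV k =
        has_chain (1, 1) (translate (i, j) ` X) (range (translate (i, j))) k"
      by (rule has_chain_cong) blast
    then show ?thesis by (simp only: has_chain_translate)
  qed
  then have sh: "has_chain (1, 1) (translate (i, j) ` X) UNIV = has_chain (1, 1) X UNIV" for X by blast
  have "measure_pmf.prob (bernoulli_set (grid m n) p) {X. P (\<lambda>k. has_chain (1, 1) (X \<inter> subgrid i j m n) UNIV k)}
    = measure_pmf.prob (bernoulli_set (subgrid i j m n) p) {X. P (\<lambda>k. has_chain (1, 1) X UNIV k)}"
    unfolding bernoulli_set_restrict[OF finite_grid sub, symmetric] by (simp add: vimage_def)
  also have "\<dots> = measure_pmf.prob (bernoulli_set (grid (m - i) (n - j)) p) {X. P (\<lambda>k. has_chain (1, 1) X UNIV k)}"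
    unfolding img bernoulli_set_image[OF finite_grid inj_translate, symmetric]
    by (simp only: measure_map_pmf vimage_Collect_eq sh)
  finally show ?thesis .
qed

lemma replicate_pmf_take:
  assumes "a \<le> m"
  shows "map_pmf (take a) (replicate_pmf m q) = replicate_pmf a q"
proof -
  have "map_pmf (take a) (replicate_pmf (a + (m - a)) q) =
      do {xs \<leftarrow> replicate_pmf a q; ys \<leftarrow> replicate_pmf (m - a) q; return_pmf (take a (xs @ ys))}"
    unfolding replicate_pmf_distrib by (simp add: map_bind_pmf)
  also have "\<dots> = do {xs \<leftarrow> replicate_pmf a q; ys \<leftarrow> replicate_pmf (m - a) q; return_pmf xs}"
    by (intro bind_pmf_cong refl) (auto simp: set_replicate_pmf)
  finally show ?thesis using assms by (simp add: bind_return_pmf')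
qed

lemma trues_take_mono: "a \<le> b \<Longrightarrow> trues (take a bs) \<le> trues (take b bs)"
proof -
  assume "a \<le> b"
  then have "take b bs = take a bs @ take (b - a) (drop a bs)" by (metis le_add_diff_inverse take_add)
  then show ?thesis by (simp add: trues_def)
qed

lemma last_passage_boundary:
  "i \<le> length Is \<Longrightarrow> last_passage (nth Is) r X i 0 = trues (take i Is)"
  "j \<le> length Js \<Longrightarrow> last_passage s (nth Js) X 0 j = trues (take j Js)"
proof -
  have "map (nth xs) [0..<i] = take i xs" if "i \<le> length xs" for xs :: "bool list" and i
    using that by (intro nth_equalityI) auto
  then show "i \<le> length Is \<Longrightarrow> last_passage (nth Is) r X i 0 = trues (take i Is)"
    "j \<le> length Js \<Longrightarrow> last_passage s (nth Js) X 0 j = trues (take j Js)"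
    using last_passage_bottom[of "nth Is" r X i] last_passage_left[of s "nth Js" X j] by simp_all
qed

lemma block_index:
  assumes "i \<le> K * (d::nat)" "0 < K"
  obtains l where "l < K" "l * d \<le> i" "i \<le> Suc l * d"
proof (cases "d = 0 \<or> i = K * d")
  case True
  then show ?thesis using assms that[of "K - 1"] by (cases K) auto
next
  case False
  then have "i div d < K" using assms by (simp add: less_mult_imp_div_less)
  moreover have "i div d * d \<le> i" "i \<le> Suc (i div d) * d"
    using False dividend_less_div_times[of d i] by (simp_all add: mult.commute)
  ultimately show ?thesis using that by blast
qed

text \<open>
  Here \<open>T\<close> is the stationary value, close to \<open>2 * s\<close>, while \<open>S\<close> is what a path collects on the boundary
  when it exits in block \<open>l\<close> out of \<open>K\<close>, and \<open>g\<close> is what it collects afterwards. The bound on \<open>g\<close>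
  comes from rates tilted by \<open>1 + \<eta>\<close>. At \<open>l = 0\<close> the tilt costs only order \<open>\<eta>\<^sup>2\<close>, because
  \<open>1 + \<eta> + 1 / (1 + \<eta>) \<le> 2 + \<eta>\<^sup>2\<close>, whereas it lowers the total bound by \<open>\<eta> * l / K\<close> for a later exit. So
  \<open>l / K\<close> is at most \<open>3 * \<eta>\<close>, hence \<open>S\<close> is small and \<open>g\<close> close to \<open>2 * s\<close>.
\<close>

lemma exit_near_corner:
  fixes s \<eta> e t K l S g T :: real
  assumes s: "0 < s" and \<eta>: "0 < \<eta>" "\<eta> \<le> 1" and K: "0 < K" "1 / K \<le> \<eta>\<^sup>2" and e: "e = \<eta>\<^sup>2 / 9"
    and T: "(2 - 4 * e) * s \<le> T" "T \<le> S + g"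
    and S: "S \<le> (l + 1) / K * s + e * s"
    and g: "g \<le> (1 + \<eta>) * (1 - l / K) * s + s / (1 + \<eta>) + 4 * e * s"
  shows "(2 - 5 * \<eta>) * s \<le> g"
proof -
  define y where "y = l / K"
  have "1 / (1 + \<eta>) \<le> 1 - \<eta> + \<eta>\<^sup>2"
  proof -
    have "1 \<le> (1 - \<eta> + \<eta>\<^sup>2) * (1 + \<eta>)" using \<eta> by (simp add: algebra_simps power2_eq_square)
    then show ?thesis using \<eta> by (simp only: divide_le_eq) auto
  qed
  then have inv: "s / (1 + \<eta>) \<le> (1 - \<eta> + \<eta>\<^sup>2) * s"
    using mult_right_mono[of "1 / (1 + \<eta>)" _ s] s by simp
  have S': "S \<le> (y + \<eta>\<^sup>2 + e) * s"
  proof -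
    have "(l + 1) / K = y + 1 / K" by (simp add: y_def add_divide_distrib)
    then have "(l + 1) / K * s \<le> (y + \<eta>\<^sup>2) * s" using K s by (intro mult_right_mono) auto
    then show ?thesis using S by (simp add: distrib_right)
  qed
  have "(2 - 4 * e) * s \<le> (y + \<eta>\<^sup>2 + e) * s + ((1 + \<eta>) * (1 - y) * s + (1 - \<eta> + \<eta>\<^sup>2) * s + 4 * e * s)"
    using T S' g inv unfolding y_def by linarith
  also have "\<dots> = (2 - \<eta> * y + 2 * \<eta>\<^sup>2 + 5 * e) * s" by (simp add: algebra_simps)
  finally have "2 - 4 * e \<le> 2 - \<eta> * y + 2 * \<eta>\<^sup>2 + 5 * e" using s by simp
  then have "\<eta> * y \<le> \<eta> * (3 * \<eta>)" unfolding e by (simp add: power2_eq_square)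
  then have "y \<le> 3 * \<eta>" using \<eta> by simp
  moreover have "\<eta>\<^sup>2 \<le> \<eta>" using \<eta> by (simp add: power2_eq_square mult_left_le_one_le)
  ultimately have "(2 - 5 * \<eta>) \<le> 2 - 4 * e - (y + \<eta>\<^sup>2 + e)"
    using \<eta>(1) unfolding e by linarith
  then have "(2 - 5 * \<eta>) * s \<le> (2 - 4 * e - (y + \<eta>\<^sup>2 + e)) * s" using s by (intro mult_right_mono) auto
  also have "\<dots> = (2 - 4 * e) * s - (y + \<eta>\<^sup>2 + e) * s"
    by (rule left_diff_distrib)
  also have "\<dots> \<le> g" using T S' by linarith
  finally show ?thesis .
qed

text \<open>
  Outside of an event of exponentially small probability, \<open>exit_near_corner\<close> applies to the exit
  point of an optimal path. The exit points are grouped into \<open>K\<close> blocks: a path that exits in block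
  \<open>l\<close> gains no more on the boundary than up to the end of the block, and no more in the interior
  than a chain that starts at the beginning of the block. So the number of bad events depends on
  \<open>K\<close> only, and the grid may be arbitrarily fine. The hypotheses say that sources and sinks both have
  a mean close to \<open>s\<close>.
\<close>

lemma strict_chain_lower_tail:
  fixes A B s \<eta> e :: real and K :: nat
  assumes AB: "0 < A" "0 < B" "A * B \<le> 1" and s: "0 < s"
    and \<eta>: "0 < \<eta>" "\<eta> \<le> 1" and K: "0 < K" "1 / real K \<le> \<eta>\<^sup>2" and e: "e = \<eta>\<^sup>2 / 9"
    and m: "m = K * m'" "real m * A \<le> s" "(1 - e) * s \<le> real m * (A / (1 + A))"
    and n: "n = K * n'" "real n * B \<le> s" "(1 - e) * s \<le> real n * (B / (1 + B))"
    and k: "real k \<le> (2 - 5 * \<eta>) * s"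
  shows "measure_pmf.prob (bernoulli_set (grid m n) (A * B)) {X. \<not> has_chain (1, 1) X UNIV k}
     \<le> (2 + 6 * real K) * exp (- (e\<^sup>2 / 4) * s)"
proof -
  define \<alpha> \<beta> where "\<alpha> = A / (1 + A)" and "\<beta> = B / (1 + B)"
  note r = odds_rates[OF AB, folded \<alpha>_def \<beta>_def]
  let ?\<nu> = "boundary_law m n \<alpha> \<beta> (A * B)" and ?q = "exp (- (e\<^sup>2 / 4) * s)"
  have e01: "0 \<le> e" "e \<le> 2" using \<eta> unfolding e by (auto simp: power_le_one intro: order_trans[of _ 1])
  have ma: "real m * \<alpha> \<le> s" and nb: "real n * \<beta> \<le> s"
    using m n r(8,9) by (meson mult_left_mono of_nat_0_le_iff order_trans)+
  define g where "g l = (1 + \<eta>) * (1 - real l / real K) * s + s / (1 + \<eta>) + 4 * e * s" for l :: nat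
  define S where "S l = (real l + 1) / real K * s + e * s" for l :: nat

  \<comment> \<open>The six kinds of bad events: too few sources or right increments, too many sources or sinks
    up to the end of a block, too long a chain from the start of a block of either side.\<close>
  have E1: "measure_pmf.prob ?\<nu> {z. real (trues (fst z)) \<le> real m * \<alpha> - e * s} \<le> ?q"
    by (rule prob_map_le[OF boundary_law_sources trues_lower_tail[OF r(1,2) ma e01(1)]]) auto
  have E2: "measure_pmf.prob ?\<nu> {z. real (trues (right_increments m n z)) \<le> real n * \<beta> - e * s} \<le> ?q"
    by (rule prob_map_le[OF right_increments_law[OF r(1-7)] trues_lower_tail[OF r(3,4) nb e01(1)]]) auto

  have part: "real (Suc l * d) * q \<le> (real l + 1) / real K * s \<and> (real l + 1) / real K * s \<le> s"
    if "l < K" "real (K * d) * q \<le> s" for l d q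
  proof
    have "real (Suc l * d) * q = (real l + 1) / real K * (real (K * d) * q)" using K by (simp add: field_simps)
    also have "\<dots> \<le> (real l + 1) / real K * s" using that by (intro mult_left_mono) auto
    finally show "real (Suc l * d) * q \<le> (real l + 1) / real K * s" .
    have "(real l + 1) / real K \<le> 1" using that K by (simp add: divide_le_eq)
    from mult_right_mono[OF this, of s] show "(real l + 1) / real K * s \<le> s" using s by simp
  qed
  have count: "measure_pmf.prob ?\<nu> {z. S l \<le> real (trues (take (Suc l * d) (side z)))} \<le> ?q"
    if l: "l < K" and side: "map_pmf side ?\<nu> = replicate_pmf (K * d) (bernoulli_pmf q)"
      and q: "0 \<le> q" "q \<le> 1" "real (K * d) * q \<le> s" for l d q side
  proof -
    have tail: "measure_pmf.prob (replicate_pmf (Suc l * d) (bernoulli_pmf q)) {bs. S l \<le> real (trues bs)} \<le> ?q"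
      using part[OF l q(3)] q unfolding S_def by (intro trues_upper_tail e01) auto
    have "Suc l * d \<le> K * d" using l by (intro mult_right_mono) auto
    then have "map_pmf (\<lambda>z. take (Suc l * d) (side z)) ?\<nu> = replicate_pmf (Suc l * d) (bernoulli_pmf q)"
      by (simp only: map_pmf_comp[symmetric] side replicate_pmf_take)
    then show ?thesis by (rule prob_map_le[OF _ tail])
  qed
  have E3: "measure_pmf.prob ?\<nu> {z. \<exists>l<K. S l \<le> real (trues (take (Suc l * m') (fst z)))} \<le> real K * ?q"
    using boundary_law_sources[of m n \<alpha> \<beta> "A * B"] ma m(1)
    by (intro prob_ex_less_le count) (simp_all add: case_prod_unfold r(1,2))
  have E4: "measure_pmf.prob ?\<nu> {z. \<exists>l<K. S l \<le> real (trues (take (Suc l * n') (fst (snd z))))} \<le> real K * ?q"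
    using boundary_law_sinks[of m n \<alpha> \<beta> "A * B"] nb n(1)
    by (intro prob_ex_less_le count) (simp_all add: case_prod_unfold r(3,4))

  have width: "real (K * d - l * d) * ((1 + \<eta>) * q) \<le> (1 + \<eta>) * (1 - real l / real K) * s \<and>
      (1 + \<eta>) * (1 - real l / real K) * s \<le> 2 * s"
    if "l < K" "real (K * d) * q \<le> s" for l d q
  proof
    have "l * d \<le> K * d" using that by simp
    then have "real (K * d - l * d) = (1 - real l / real K) * real (K * d)"
      using K by (simp add: of_nat_diff field_simps)
    then have "real (K * d - l * d) * ((1 + \<eta>) * q) = ((1 + \<eta>) * (1 - real l / real K)) * (real (K * d) * q)"
      by simp
    also have "\<dots> \<le> (1 + \<eta>) * (1 - real l / real K) * s"
      using that \<eta> by (intro mult_left_mono mult_nonneg_nonneg) auto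
    finally show "real (K * d - l * d) * ((1 + \<eta>) * q) \<le> (1 + \<eta>) * (1 - real l / real K) * s" .
    have "(1 + \<eta>) * (1 - real l / real K) \<le> 2 * 1"
      using \<eta> that by (intro mult_mono) auto
    then show "(1 + \<eta>) * (1 - real l / real K) * s \<le> 2 * s" using s by (intro mult_right_mono) auto
  qed
  have short: "real (K * d) * (q / (1 + \<eta>)) \<le> s / (1 + \<eta>) \<and> s / (1 + \<eta>) \<le> 2 * s"
    if "real (K * d) * q \<le> s" for d q
    using that \<eta> s by (auto simp: divide_simps)
  have odds: "((1 + \<eta>) * A) * (B / (1 + \<eta>)) = A * B" "(A / (1 + \<eta>)) * ((1 + \<eta>) * B) = A * B"
    using \<eta> by (simp_all add: field_simps)
  have q2: "2 * exp (- (e\<^sup>2 / 4) * (2 * s)) \<le> 2 * ?q" using s by simp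

  \<comment> \<open>The tilted odds have the same product. The tilt favours the side on which the path exits:
    its means are at most \<open>2 * s\<close>, which is the scale used for these chains.\<close>

  have block: "measure_pmf.prob ?\<nu> {z. \<exists>k. has_chain (1, 1) (snd (snd z) \<inter> subgrid i j m n) UNIV k \<and> g l \<le> real k}
      \<le> 2 * ?q"
    if AB': "0 < A'" "0 < B'" "A' * B' = A * B" and x: "real (m - i) * A' \<le> x" "x \<le> 2 * s"
      and y: "real (n - j) * B' \<le> y" "y \<le> 2 * s" and gl: "g l = x + y + 4 * e * s" for i j l A' B' x y
  proof (rule prob_map_le[OF boundary_law_points])
    have "measure_pmf.prob (bernoulli_set (grid (m - i) (n - j)) (A' * B')) {X. \<exists>k. has_chain (1, 1) X UNIV k \<and> g l \<le> real k}
        \<le> 2 * exp (- (e\<^sup>2 / 4) * (2 * s))"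
      using AB AB'(3) e01 gl by (intro strict_chain_upper_tail[OF AB'(1,2) _ x y]) auto
    then show "measure_pmf.prob (bernoulli_set (grid m n) (A * B))
        {X. \<exists>k. has_chain (1, 1) (X \<inter> subgrid i j m n) UNIV k \<and> g l \<le> real k} \<le> 2 * ?q"
      using q2 prob_has_chain_subgrid[of m n "A * B" "\<lambda>c. \<exists>k. c k \<and> g l \<le> real k" i j] unfolding AB'(3) by linarith
  qed auto
  have E5: "measure_pmf.prob ?\<nu> {z. \<exists>l<K. \<exists>k. has_chain (1, 1) (snd (snd z) \<inter> subgrid (l * m') 0 m n) UNIV k \<and> g l \<le> real k}
      \<le> real K * (2 * ?q)"
  proof (rule prob_ex_less_le)
    fix l assume "l < K"
    note w = width[OF this m(2)[unfolded m(1)]] and b = short[OF n(2)[unfolded n(1)]]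
    show "measure_pmf.prob ?\<nu> {z. \<exists>k. has_chain (1, 1) (snd (snd z) \<inter> subgrid (l * m') 0 m n) UNIV k \<and> g l \<le> real k} \<le> 2 * ?q"
      by (rule block[of "(1 + \<eta>) * A" "B / (1 + \<eta>)" "l * m'" "(1 + \<eta>) * (1 - real l / real K) * s" 0 "s / (1 + \<eta>)"])
        (use w b AB \<eta> odds(1) in \<open>auto simp: g_def m(1) n(1)\<close>)
  qed
  have E6: "measure_pmf.prob ?\<nu> {z. \<exists>l<K. \<exists>k. has_chain (1, 1) (snd (snd z) \<inter> subgrid 0 (l * n') m n) UNIV k \<and> g l \<le> real k}
      \<le> real K * (2 * ?q)"
  proof (rule prob_ex_less_le)
    fix l assume "l < K"
    note w = width[OF this n(2)[unfolded n(1)]] and b = short[OF m(2)[unfolded m(1)]]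
    show "measure_pmf.prob ?\<nu> {z. \<exists>k. has_chain (1, 1) (snd (snd z) \<inter> subgrid 0 (l * n') m n) UNIV k \<and> g l \<le> real k} \<le> 2 * ?q"
      by (rule block[of "A / (1 + \<eta>)" "(1 + \<eta>) * B" 0 "s / (1 + \<eta>)" "l * n'" "(1 + \<eta>) * (1 - real l / real K) * s"])
        (use w b AB \<eta> odds(2) in \<open>auto simp: g_def m(1) n(1)\<close>)
  qed

  define bad where "bad z \<longleftrightarrow>
      real (trues (fst z)) \<le> real m * \<alpha> - e * s \<or>
      real (trues (right_increments m n z)) \<le> real n * \<beta> - e * s \<or>
      (\<exists>l<K. S l \<le> real (trues (take (Suc l * m') (fst z)))) \<or>
      (\<exists>l<K. S l \<le> real (trues (take (Suc l * n') (fst (snd z))))) \<or>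
      (\<exists>l<K. \<exists>k. has_chain (1, 1) (snd (snd z) \<inter> subgrid (l * m') 0 m n) UNIV k \<and> g l \<le> real k) \<or>
      (\<exists>l<K. \<exists>k. has_chain (1, 1) (snd (snd z) \<inter> subgrid 0 (l * n') m n) UNIV k \<and> g l \<le> real k)" for z
  have bad: "measure_pmf.prob ?\<nu> {z. bad z} \<le> ?q + (?q + (real K * ?q + (real K * ?q + (real K * (2 * ?q) + real K * (2 * ?q)))))"
    unfolding bad_def
    by (intro prob_union_le[OF _ E1 prob_union_le[OF _ E2 prob_union_le[OF _ E3 prob_union_le[OF _ E4
         prob_union_le[OF _ E5 E6]]]]]) auto
  have good: "has_chain (1, 1) (snd (snd z)) UNIV k" if z: "z \<in> set_pmf ?\<nu>" and nb: "\<not> bad z" for z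
  proof -
    obtain Is Js X where zz: "z = (Is, Js, X)" by (cases z)
    have len: "length Is = m" "length Js = n" using boundary_law_support[OF z] zz by auto
    let ?L = "last_passage (nth Is) (nth Js) X"
    have T: "(2 - 4 * e) * s \<le> real (?L m n)"
    proof -
      have "real m * \<alpha> - e * s + (real n * \<beta> - e * s) \<le> real (?L m n)"
        using nb zz unfolding bad_def last_passage_corner[OF len(1)] by auto
      moreover have "(1 - e) * s + (1 - e) * s - 2 * e * s = (2 - 4 * e) * s" by (simp add: algebra_simps)
      ultimately show ?thesis using m(3) n(3) unfolding \<alpha>_def \<beta>_def by linarith
    qed
    have concl: "has_chain (1, 1) X UNIV k"
      if c: "has_chain (1, 1) (X \<inter> Y) UNIV k'" and L: "?L m n = v + k'" "real v \<le> S l" "real k' \<le> g l" for Y k' l v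
    proof -
      have "(2 - 5 * \<eta>) * s \<le> real k'"
        using L K unfolding S_def g_def
        by (intro exit_near_corner[OF s \<eta> _ _ e T, of "real K" "real v" _ "real l"]) auto
      then show ?thesis using has_chain_shorter[OF has_chain_mono[OF c Int_lower1], of k] k by linarith
    qed
    from last_passage_exit[where s = "nth Is" and r = "nth Js" and X = X and m = m and n = n]
    show ?thesis
    proof
      assume "\<exists>i\<le>m. \<exists>k. has_chain (1, 1) (X \<inter> subgrid i 0 m n) UNIV k \<and> ?L m n = ?L i 0 + k"
      then obtain i k' where i: "i \<le> m" "has_chain (1, 1) (X \<inter> subgrid i 0 m n) UNIV k'" "?L m n = ?L i 0 + k'"
        by blast
      obtain l where l: "l < K" "l * m' \<le> i" "i \<le> Suc l * m'" using block_index[of i K m'] i(1) K(1) m(1) by metis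
      have "trues (take i Is) \<le> trues (take (Suc l * m') Is)" by (rule trues_take_mono[OF l(3)])
      moreover have "real (trues (take (Suc l * m') Is)) \<le> S l" using nb l(1) unfolding bad_def zz by force
      ultimately have S': "real (?L i 0) \<le> S l"
        using last_passage_boundary(1)[of i Is "nth Js" X] i(1) len by simp
      have "X \<inter> subgrid i 0 m n \<subseteq> X \<inter> subgrid (l * m') 0 m n" using l(2) by (auto simp: subgrid_def)
      from has_chain_mono[OF i(2) this] have "real k' \<le> g l" using nb l(1) unfolding bad_def zz by force
      then show ?thesis using concl[OF i(2,3) S'] zz by simp
    next
      assume "\<exists>j\<le>n. \<exists>k. has_chain (1, 1) (X \<inter> subgrid 0 j m n) UNIV k \<and> ?L m n = ?L 0 j + k"
      then obtain j k' where j: "j \<le> n" "has_chain (1, 1) (X \<inter> subgrid 0 j m n) UNIV k'" "?L m n = ?L 0 j + k'"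
        by blast
      obtain l where l: "l < K" "l * n' \<le> j" "j \<le> Suc l * n'" using block_index[of j K n'] j(1) K(1) n(1) by metis
      have "trues (take j Js) \<le> trues (take (Suc l * n') Js)" by (rule trues_take_mono[OF l(3)])
      moreover have "real (trues (take (Suc l * n') Js)) \<le> S l" using nb l(1) unfolding bad_def zz by force
      ultimately have S': "real (?L 0 j) \<le> S l"
        using last_passage_boundary(2)[of j Js "nth Is" X] j(1) len by simp
      have "X \<inter> subgrid 0 j m n \<subseteq> X \<inter> subgrid 0 (l * n') m n" using l(2) by (auto simp: subgrid_def)
      from has_chain_mono[OF j(2) this] have "real k' \<le> g l" using nb l(1) unfolding bad_def zz by force
      then show ?thesis using concl[OF j(2,3) S'] zz by simp
    qed
  qed
  have "measure_pmf.prob (bernoulli_set (grid m n) (A * B)) {X. \<not> has_chain (1, 1) X UNIV k}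
      = measure_pmf.prob ?\<nu> {z. \<not> has_chain (1, 1) (snd (snd z)) UNIV k}"
    unfolding boundary_law_points[of m n \<alpha> \<beta> "A * B", symmetric] by (simp add: vimage_def case_prod_unfold)
  also have "\<dots> \<le> measure_pmf.prob ?\<nu> {z. bad z}"
    using good by (intro measure_pmf.finite_measure_mono_AE) (auto simp: AE_measure_pmf_iff)
  finally show ?thesis using bad by (simp add: algebra_simps)
qed

section \<open>Longest chains\<close>

lemma h_chain_prefix: "h_chain h X z (ps @ qs) \<Longrightarrow> h_chain h X z ps"
  by (auto simp: h_chain_def successively_append_iff)

lemma h_chain_length_le:
  assumes "finite (X \<inter> ({0<..<fst z} \<times> {0<..<snd z}))" "h_chain h X z ps"
  shows "length ps \<le> card (X \<inter> ({0<..<fst z} \<times> {0<..<snd z}))"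
proof -
  have "transp (\<lambda>p q :: real \<times> real. fst p < fst q)" by (auto intro: transpI)
  moreover have "successively (\<lambda>p q. fst p < fst q) ps"
    using assms(2) unfolding h_chain_def by (auto elim: successively_mono)
  ultimately have "sorted_wrt (\<lambda>p q. fst p < fst q) ps" by (simp add: successively_conv_sorted_wrt)
  then have "distinct ps" by (induction ps) auto
  then show ?thesis
    using assms card_mono[of _ "set ps"] unfolding h_chain_def by (metis distinct_card)
qed

lemma longest_chain_ge_iff:
  assumes "finite (X \<inter> ({0<..<fst z} \<times> {0<..<snd z}))"
  shows "k \<le> longest_chain h X z \<longleftrightarrow> (\<exists>ps. h_chain h X z ps \<and> length ps = k)"
proof
  let ?P = "\<lambda>n. \<exists>ps. h_chain h X z ps \<and> length ps = n"
  have "h_chain h X z []" by (simp add: h_chain_def)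
  then have 0: "?P 0" by (intro exI[of _ "[]"]) simp
  have bound: "n \<le> card (X \<inter> ({0<..<fst z} \<times> {0<..<snd z}))" if "?P n" for n
    using h_chain_length_le[OF assms] that by blast
  {
    assume k: "k \<le> longest_chain h X z"
    obtain ps where ps: "h_chain h X z ps" "length ps = longest_chain h X z"
      using GreatestI_nat[of ?P, OF 0 bound] unfolding longest_chain_def by blast
    then have "h_chain h X z (take k ps) \<and> length (take k ps) = k"
      using k h_chain_prefix[of h X z "take k ps" "drop k ps"] by simp
    then show "?P k" by blast
  }
  {
    assume "?P k"
    then show "k \<le> longest_chain h X z"
      unfolding longest_chain_def using Greatest_le_nat[of ?P k, OF _ bound] by blast
  }
qed

section \<open>Chains of points and chains of cells\<close>

text \<open>
  The cells are open on the left, so that they tile the open quadrant.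
\<close>

definition cell :: "nat \<Rightarrow> nat \<times> nat \<Rightarrow> (real \<times> real) set" where
  "cell N c = {real (fst c) / real N <.. real (Suc (fst c)) / real N} \<times>
              {real (snd c) / real N <.. real (Suc (snd c)) / real N}"

definition occupied :: "nat \<Rightarrow> nat \<Rightarrow> nat \<Rightarrow> (real \<times> real) set \<Rightarrow> (nat \<times> nat) set" where
  "occupied N m n X = {c \<in> grid m n. X \<inter> cell N c \<noteq> {}}"

text \<open>
  Points in two cells whose columns differ by \<open>g1\<close> are more than \<open>(g1 - 1) / N\<close> apart.
\<close>

lemma chain_from_cells:
  assumes N: "0 < N" and g: "real N * h1 + 1 \<le> real g1" "real N * h2 + 1 \<le> real g2"
    and h: "0 \<le> h1" "0 \<le> h2"
    and mn: "real m < real N * x" "real n < real N * y"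
    and chain: "has_chain (g1, g2) (occupied N m n X) UNIV k"
  shows "\<exists>ps. h_chain (h1, h2) X (x, y) ps \<and> length ps = k"
proof -
  obtain cs where cs: "length cs = k" "set cs \<subseteq> occupied N m n X" "successively (gap_le (g1, g2)) cs"
    using chain unfolding has_chain_def by blast
  define pick where "pick c = (SOME p. p \<in> X \<inter> cell N c)" for c
  have pick: "pick c \<in> X \<inter> cell N c" if "c \<in> occupied N m n X" for c
    using that someI_ex[of "\<lambda>p. p \<in> X \<inter> cell N c"] unfolding pick_def occupied_def by blast
  have in_rect: "pick c \<in> X \<inter> ({0<..<x} \<times> {0<..<y})" if c: "c \<in> occupied N m n X" for c
  proof -
    have "c \<in> grid m n" using c by (simp add: occupied_def)
    then have "real (Suc (fst c)) / real N < x" "real (Suc (snd c)) / real N < y"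
      using mn N by (auto simp: grid_def divide_less_eq mult.commute)
    moreover have "real (fst c) / real N < fst (pick c)" "real (snd c) / real N < snd (pick c)"
      using pick[OF c] unfolding cell_def by (auto simp: mem_Times_iff)
    then have "0 < fst (pick c)" "0 < snd (pick c)"
      by (meson divide_nonneg_nonneg le_less_trans of_nat_0_le_iff)+
    ultimately show ?thesis using pick[OF c] unfolding cell_def by (auto simp: mem_Times_iff)
  qed
  have step: "fst (pick c) < fst (pick d) \<and> snd (pick c) < snd (pick d) \<and> prec_h (h1, h2) (pick c) (pick d)"
    if c: "c \<in> set cs" and d: "d \<in> set cs" and cd: "gap_le (g1, g2) c d" for c d
  proof -
    have "real (Suc i) / real N + h \<le> real j / real N" if "i + g \<le> j" "real N * h + 1 \<le> real g" for i j g h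
    proof -
      have "real (Suc i) + real N * h \<le> real j" using that by linarith
      then have "(real (Suc i) + real N * h) / real N \<le> real j / real N" by (intro divide_right_mono) auto
      then show ?thesis using N by (simp add: add_divide_distrib)
    qed
    from this[of "fst c" g1 "fst d" h1] this[of "snd c" g2 "snd d" h2] cd g
    have "real (Suc (fst c)) / real N + h1 \<le> real (fst d) / real N"
         "real (Suc (snd c)) / real N + h2 \<le> real (snd d) / real N"
      by (simp_all add: gap_le_def)
    moreover have "pick c \<in> cell N c" "pick d \<in> cell N d" using pick c d cs(2) by blast+
    ultimately show ?thesis using h unfolding cell_def prec_h_def by (auto simp: mem_Times_iff)
  qed
  have "successively (\<lambda>p q. fst p < fst q \<and> snd p < snd q \<and> prec_h (h1, h2) p q) (map pick cs)"
    unfolding successively_map by (rule successively_mono[OF cs(3)]) (use step in auto)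
  moreover have "set (map pick cs) \<subseteq> X \<inter> ({0<..<x} \<times> {0<..<y})"
    using in_rect cs(2) by (simp only: set_map image_subset_iff) blast
  ultimately have "h_chain (h1, h2) X (x, y) (map pick cs)"
    unfolding h_chain_def by simp
  then show ?thesis using cs(1) by (intro exI[of _ "map pick cs"]) simp
qed

text \<open>
  If \<open>h1 = 0\<close>, consecutive points of a chain may lie in the same column of cells, and likewise for
  rows if \<open>h2 = 0\<close>. On the complement of this event every chain of points becomes strictly
  increasing on the grid.
\<close>

definition collision :: "nat \<Rightarrow> nat \<Rightarrow> nat \<Rightarrow> (real \<times> real) set \<Rightarrow> bool" where
  "collision N m n X \<longleftrightarrow>
     (\<exists>i<m. 2 \<le> card (X \<inter> ({real i / real N <.. real (Suc i) / real N} \<times> {0<..real n / real N}))) \<or>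
     (\<exists>j<n. 2 \<le> card (X \<inter> ({0<..real m / real N} \<times> {real j / real N <.. real (Suc j) / real N})))"

definition index :: "nat \<Rightarrow> real \<Rightarrow> nat" where
  "index N y = nat \<lceil>real N * y\<rceil> - 1"

lemma index_bounds:
  assumes "0 < N" "0 < y"
  shows "real (index N y) / real N < y" "y \<le> real (Suc (index N y)) / real N"
proof -
  have "0 < real N * y" using assms by simp
  then have "0 < \<lceil>real N * y\<rceil>" by simp
  then have "int (index N y) = \<lceil>real N * y\<rceil> - 1" unfolding index_def by arith
  then have i: "real (index N y) = of_int \<lceil>real N * y\<rceil> - 1" by (metis of_int_of_nat_eq of_int_diff of_int_1)
  have "real (index N y) < real N * y" "real N * y \<le> real (Suc (index N y))"
    using i ceiling_correct[of "real N * y"] by auto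
  then show "real (index N y) / real N < y" "y \<le> real (Suc (index N y)) / real N"
    using assms by (simp_all add: divide_less_eq le_divide_eq mult.commute)
qed

lemma index_less:
  assumes "0 < N" "0 < y" "real N * y \<le> real m"
  shows "index N y < m"
proof -
  have "real (index N y) < real m"
    using index_bounds(1)[OF assms(1,2)] assms by (simp add: divide_less_eq mult.commute)
  then show ?thesis by simp
qed

lemma index_gap:
  assumes N: "0 < N" and y: "0 < y" "y < y'" "y + h \<le> y'"
    and g: "real g \<le> real N * h \<or> g = 1" and ne: "index N y \<noteq> index N y'"
  shows "index N y + g \<le> index N y'"
proof (cases "real g \<le> real N * h")
  case True
  have "real (index N y) + real g < real (Suc (index N y'))"
  proof -
    have "real (index N y) < real N * y" "real N * y' \<le> real (Suc (index N y'))"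
      using index_bounds[OF N, of y] index_bounds[OF N, of y'] y N
      by (simp_all add: divide_less_eq le_divide_eq mult.commute)
    moreover have "real N * y + real N * h \<le> real N * y'"
      using y(3) mult_left_mono[of "y + h" y' "real N"] by (simp add: distrib_left)
    ultimately show ?thesis using True by linarith
  qed
  then show ?thesis by linarith
next
  case False
  have "real (index N y) / real N < real (Suc (index N y')) / real N"
    using index_bounds[OF N, of y] index_bounds[OF N, of y'] y by linarith
  then have "index N y < Suc (index N y')" using N by (simp add: divide_less_cancel)
  then show ?thesis using ne g False by simp
qed

text \<open>
  Rounding to the grid preserves gaps of at most \<open>N * h1\<close> and \<open>N * h2\<close> cells; a gap of one cell
  results from the absence of collisions.
\<close>

lemma cells_from_chain:
  assumes N: "0 < N" and fin: "\<And>B. bounded B \<Longrightarrow> finite (X \<inter> B)"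
    and g: "real g1 \<le> real N * h1 \<or> g1 = 1" "real g2 \<le> real N * h2 \<or> g2 = 1"
    and mn: "real N * x \<le> real m" "real N * y \<le> real n"
    and coll: "\<not> collision N m n X"
    and ps: "h_chain (h1, h2) X (x, y) ps"
  shows "has_chain (g1, g2) (occupied N m n X) UNIV (length ps)"
proof -
  define f where "f p = (index N (fst p), index N (snd p))" for p :: "real \<times> real"
  have pos: "0 < fst p \<and> fst p < x \<and> 0 < snd p \<and> snd p < y \<and> p \<in> X" if "p \<in> set ps" for p
    using ps that unfolding h_chain_def by (auto simp: mem_Times_iff)
  have le: "real N * fst p \<le> real m" "real N * snd p \<le> real n" if "p \<in> set ps" for p
    using pos[OF that] mn mult_left_mono[of "fst p" x "real N"] mult_left_mono[of "snd p" y "real N"] by linarith+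
  have idx: "index N (fst p) < m \<and> index N (snd p) < n" if "p \<in> set ps" for p
    using pos[OF that] le[OF that] by (auto intro!: index_less N)
  have occ: "f p \<in> occupied N m n X" if "p \<in> set ps" for p
    using pos[OF that] idx[OF that] index_bounds[OF N, of "fst p"] index_bounds[OF N, of "snd p"]
    unfolding occupied_def f_def cell_def grid_def by (auto simp: mem_Times_iff)
  have upper: "fst p \<le> real m / real N \<and> snd p \<le> real n / real N" if "p \<in> set ps" for p
    using le[OF that] N by (simp add: le_divide_eq mult.commute)
  have two: "2 \<le> card (X \<inter> B)" if "p \<in> X \<inter> B" "q \<in> X \<inter> B" "p \<noteq> q" "bounded B" for p q B
    using card_mono[OF fin[OF that(4)], of "{p, q}"] that by auto
  have ne: "index N (fst p) \<noteq> index N (fst q) \<and> index N (snd p) \<noteq> index N (snd q)"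
    if p: "p \<in> set ps" and q: "q \<in> set ps" and "p \<noteq> q" for p q
  proof (rule ccontr)
    assume "\<not> ?thesis"
    then consider "index N (fst p) = index N (fst q)" | "index N (snd p) = index N (snd q)" by blast
    then show False
    proof cases
      case 1
      let ?B = "{real (index N (fst p)) / real N <.. real (Suc (index N (fst p))) / real N} \<times> {0<..real n / real N}"
      have "p \<in> X \<inter> ?B" "q \<in> X \<inter> ?B"
        using pos[OF p] pos[OF q] upper[OF p] upper[OF q] 1 index_bounds[OF N, of "fst p"] index_bounds[OF N, of "fst q"]
        by (auto simp: mem_Times_iff)
      then have "2 \<le> card (X \<inter> ?B)" by (rule two) (use \<open>p \<noteq> q\<close> in \<open>auto intro: bounded_Times\<close>)
      then show False using coll idx[OF p] unfolding collision_def by blast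
    next
      case 2
      let ?B = "{0<..real m / real N} \<times> {real (index N (snd p)) / real N <.. real (Suc (index N (snd p))) / real N}"
      have "p \<in> X \<inter> ?B" "q \<in> X \<inter> ?B"
        using pos[OF p] pos[OF q] upper[OF p] upper[OF q] 2 index_bounds[OF N, of "snd p"] index_bounds[OF N, of "snd q"]
        by (auto simp: mem_Times_iff)
      then have "2 \<le> card (X \<inter> ?B)" by (rule two) (use \<open>p \<noteq> q\<close> in \<open>auto intro: bounded_Times\<close>)
      then show False using coll idx[OF p] unfolding collision_def by blast
    qed
  qed
  have step: "gap_le (g1, g2) (f p) (f q)"
    if p: "p \<in> set ps" and q: "q \<in> set ps" and r: "fst p < fst q \<and> snd p < snd q \<and> prec_h (h1, h2) p q" for p q
  proof -
    have "p \<noteq> q" using r by auto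
    from ne[OF p q this] show ?thesis
      using index_gap[OF N, of "fst p" "fst q" h1 g1] index_gap[OF N, of "snd p" "snd q" h2 g2] g r pos[OF p]
      unfolding gap_le_def f_def prec_h_def by simp
  qed
  have "successively (\<lambda>p q. fst p < fst q \<and> snd p < snd q \<and> prec_h (h1, h2) p q) ps"
    using ps unfolding h_chain_def by blast
  then have "successively (gap_le (g1, g2)) (map f ps)"
    unfolding successively_map by (rule successively_mono) (use step in auto)
  then show ?thesis
    unfolding has_chain_def using occ by (intro exI[of _ "map f ps"]) auto
qed

section \<open>Occupied cells of the Poisson process\<close>

lemma measure_lborel_Ioc_Times:
  fixes a b c d :: real
  assumes "a \<le> b" "c \<le> d"
  shows "measure lborel ({a<..b} \<times> {c<..d}) = (b - a) * (d - c)"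
proof -
  have "emeasure lborel ({a<..b} \<times> {c<..d}) = emeasure lborel {a<..b} * emeasure lborel {c<..d}"
    unfolding lborel_prod[symmetric] by (rule lborel.emeasure_pair_measure_Times) auto
  also have "\<dots> = ennreal ((b - a) * (d - c))"
    using assms by (simp add: ennreal_mult)
  finally show ?thesis using assms by (simp add: measure_def)
qed

lemma pmf_bernoulli_set:
  assumes "finite A" "Y \<subseteq> A" "0 \<le> p" "p \<le> 1"
  shows "pmf (bernoulli_set A p) Y = (\<Prod>c\<in>A. if c \<in> Y then p else 1 - p)"
proof -
  have "pmf (bernoulli_set A p) (Collect (\<lambda>c. c \<in> Y)) = pmf (Pi_pmf A False (\<lambda>_. bernoulli_pmf p)) (\<lambda>c. c \<in> Y)"
    unfolding bernoulli_set_def by (rule pmf_map_inj') (auto simp: inj_def)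
  also have "\<dots> = (\<Prod>c\<in>A. pmf (bernoulli_pmf p) (c \<in> Y))"
    using assms by (intro pmf_Pi') auto
  also have "\<dots> = (\<Prod>c\<in>A. if c \<in> Y then p else 1 - p)"
    using assms by (intro prod.cong) auto
  finally show ?thesis by simp
qed

lemma Ioc_Times_borel: "{a<..b::real} \<times> {c<..d::real} \<in> sets borel"
  by (intro borel_Times) auto

lemma Ioc_Times_bounded: "bounded ({a<..b::real} \<times> {c<..d::real})"
  by (intro bounded_Times) auto

lemma cell_borel: "cell N c \<in> sets borel"
  unfolding cell_def by (rule Ioc_Times_borel)

lemma cell_bounded: "bounded (cell N c)"
  unfolding cell_def by (rule Ioc_Times_bounded)

lemma greater_quotient_pos: "real i / real N < y \<Longrightarrow> 0 < y"
  by (rule le_less_trans[of 0 "real i / real N"]) simp_all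

lemma cell_quadrant: "cell N c \<subseteq> {0<..} \<times> {0<..}"
  unfolding cell_def by (auto intro: greater_quotient_pos)

lemma measure_cell:
  assumes "0 < N"
  shows "measure lborel (cell N c) = (1 / real N)\<^sup>2"
proof -
  have "measure lborel (cell N c) = (real (Suc (fst c)) / real N - real (fst c) / real N) *
      (real (Suc (snd c)) / real N - real (snd c) / real N)"
    unfolding cell_def by (rule measure_lborel_Ioc_Times) (auto intro: divide_right_mono)
  then show ?thesis by (simp add: diff_divide_distrib[symmetric] power2_eq_square)
qed

lemma cell_disjoint:
  assumes "0 < N" "c \<noteq> d"
  shows "cell N c \<inter> cell N d = {}"
proof -
  have "False" if "real i / real N < y" "y \<le> real (Suc i) / real N" "real j / real N < y"
      "y \<le> real (Suc j) / real N" "i \<noteq> j" for i j y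
  proof -
    have "real i / real N < real (Suc j) / real N" "real j / real N < real (Suc i) / real N" using that by linarith+
    then have "i < Suc j" "j < Suc i" using assms by (simp_all only: divide_less_cancel) auto
    then show False using that(5) by simp
  qed
  then show ?thesis using assms(2) unfolding cell_def prod_eq_iff by (auto simp: prod_eq_iff) blast+
qed

definition cell_prob :: "nat \<Rightarrow> real" where
  "cell_prob N = 1 - exp (- (1 / real N)\<^sup>2)"

lemma cell_prob_bounds:
  assumes "0 < N"
  shows "0 < cell_prob N" "cell_prob N \<le> 1" "cell_prob N \<le> (1 / real N)\<^sup>2"
  using assms exp_ge_add_one_self[of "- (1 / real N)\<^sup>2"] by (simp_all add: cell_prob_def)

locale quadrant_poisson = homogeneous_poisson_process M 1 "{0<..} \<times> {0<..}" \<Xi>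
  for M :: "'w measure" and \<Xi>
begin

text \<open>
  Disjoint cells have independent counts, so the occupied cells have the weights of a Bernoulli set.
\<close>

lemma occupied_config:
  assumes N: "0 < N" and Y: "Y \<subseteq> grid m n"
  shows "{\<omega> \<in> space M. occupied N m n (\<Xi> \<omega>) = Y} \<in> events"
    and "prob {\<omega> \<in> space M. occupied N m n (\<Xi> \<omega>) = Y} = pmf (bernoulli_set (grid m n) (cell_prob N)) Y"
proof -
  let ?X = "\<lambda>c \<omega>. card (\<Xi> \<omega> \<inter> cell N c)"
  let ?A = "\<lambda>c. if c \<in> Y then {0<..} else {0::nat}"
  have X_meas: "?X c \<in> measurable M (count_space UNIV)" for c
    by (rule count_measurable[OF cell_borel cell_bounded cell_quadrant])
  have zero: "?X c \<omega> = 0 \<longleftrightarrow> \<Xi> \<omega> \<inter> cell N c = {}" if "\<omega> \<in> space M" for c \<omega>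
    using locally_finite[OF that cell_bounded] by simp
  have E: "{\<omega> \<in> space M. occupied N m n (\<Xi> \<omega>) = Y} = space M \<inter> (\<Inter>c\<in>grid m n. ?X c -` ?A c \<inter> space M)"
    if "grid m n \<noteq> {}"
  proof (intro set_eqI iffI)
    fix \<omega> assume "\<omega> \<in> {\<omega> \<in> space M. occupied N m n (\<Xi> \<omega>) = Y}"
    then show "\<omega> \<in> space M \<inter> (\<Inter>c\<in>grid m n. ?X c -` ?A c \<inter> space M)"
      using zero by (auto simp: occupied_def)
  next
    fix \<omega> assume \<omega>: "\<omega> \<in> space M \<inter> (\<Inter>c\<in>grid m n. ?X c -` ?A c \<inter> space M)"
    then have "c \<in> Y \<longleftrightarrow> \<Xi> \<omega> \<inter> cell N c \<noteq> {}" if "c \<in> grid m n" for c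
      using zero[of \<omega> c] that by (auto split: if_splits)
    then show "\<omega> \<in> {\<omega> \<in> space M. occupied N m n (\<Xi> \<omega>) = Y}"
      using \<omega> Y unfolding occupied_def by auto
  qed
  have p0: "prob (?X c -` {0} \<inter> space M) = 1 - cell_prob N" for c
  proof -
    have "?X c -` {0} \<inter> space M = {\<omega> \<in> space M. ?X c \<omega> = 0}" by auto
    then show ?thesis
      using count_poisson[OF cell_borel cell_bounded cell_quadrant, of N c 0] measure_cell[OF N, of c]
      by (simp add: cell_prob_def)
  qed
  have p1: "prob (?X c -` {0<..} \<inter> space M) = cell_prob N" for c
  proof -
    have "?X c -` {0<..} \<inter> space M = space M - (?X c -` {0} \<inter> space M)" by auto
    moreover have "?X c -` {0} \<inter> space M \<in> events" using X_meas by (rule measurable_sets) simp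
    ultimately show ?thesis by (simp add: prob_compl p0)
  qed
  show ev: "{\<omega> \<in> space M. occupied N m n (\<Xi> \<omega>) = Y} \<in> events"
  proof (cases "grid m n = {}")
    case True
    then show ?thesis using Y by (simp add: occupied_def)
  next
    case False
    have "?X c -` ?A c \<inter> space M \<in> events" for c using X_meas by (rule measurable_sets) simp
    then have "(\<Inter>c\<in>grid m n. ?X c -` ?A c \<inter> space M) \<in> events"
      by (rule sets.finite_INT[OF finite_grid False])
    then show ?thesis unfolding E[OF False] by (rule sets.Int[OF sets.top])
  qed
  show "prob {\<omega> \<in> space M. occupied N m n (\<Xi> \<omega>) = Y} = pmf (bernoulli_set (grid m n) (cell_prob N)) Y"
  proof (cases "grid m n = {}")
    case True
    then show ?thesis using Y by (simp add: occupied_def bernoulli_set_def prob_space)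
  next
    case False
    let ?I = "prod_encode ` grid m n"
    have indep: "indep_vars (\<lambda>_. count_space UNIV) (\<lambda>i \<omega>. card (\<Xi> \<omega> \<inter> cell N (prod_decode i))) ?I"
    proof (rule count_indep)
      show "disjoint_family_on (\<lambda>i. cell N (prod_decode i)) ?I"
        unfolding disjoint_family_on_def using cell_disjoint[OF N] by (auto simp: prod_encode_eq)
    qed (auto simp: cell_borel cell_bounded cell_quadrant)
    have "prob (\<Inter>i\<in>?I. (\<lambda>\<omega>. card (\<Xi> \<omega> \<inter> cell N (prod_decode i))) -` ?A (prod_decode i) \<inter> space M)
      = (\<Prod>i\<in>?I. prob ((\<lambda>\<omega>. card (\<Xi> \<omega> \<inter> cell N (prod_decode i))) -` ?A (prod_decode i) \<inter> space M))"
      by (rule indep_varsD_finite[OF indep]) (use False in auto)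
    also have "\<dots> = (\<Prod>c\<in>grid m n. prob (?X c -` ?A c \<inter> space M))"
      by (subst prod.reindex) (auto simp: inj_prod_encode)
    also have "\<dots> = (\<Prod>c\<in>grid m n. if c \<in> Y then cell_prob N else 1 - cell_prob N)"
      by (intro prod.cong refl) (simp only: p0 p1 split: if_split, auto simp: p0 p1)
    also have "\<dots> = pmf (bernoulli_set (grid m n) (cell_prob N)) Y"
      using Y cell_prob_bounds[OF N] by (intro pmf_bernoulli_set[symmetric]) auto
    also have "(\<Inter>i\<in>?I. (\<lambda>\<omega>. card (\<Xi> \<omega> \<inter> cell N (prod_decode i))) -` ?A (prod_decode i) \<inter> space M)
        = {\<omega> \<in> space M. occupied N m n (\<Xi> \<omega>) = Y}"
      unfolding E[OF False] using False by auto
    finally show ?thesis .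
  qed
qed

lemma occupied_law:
  assumes N: "0 < N"
  shows "{\<omega> \<in> space M. P (occupied N m n (\<Xi> \<omega>))} \<in> events"
    and "prob {\<omega> \<in> space M. P (occupied N m n (\<Xi> \<omega>))} =
         measure_pmf.prob (bernoulli_set (grid m n) (cell_prob N)) {X. P X}"
proof -
  let ?S = "{Y \<in> Pow (grid m n). P Y}" and ?E = "\<lambda>Y. {\<omega> \<in> space M. occupied N m n (\<Xi> \<omega>) = Y}"
  have fin: "finite ?S" by simp
  have U: "{\<omega> \<in> space M. P (occupied N m n (\<Xi> \<omega>))} = (\<Union>Y\<in>?S. ?E Y)"
    by (auto simp: occupied_def)
  show "{\<omega> \<in> space M. P (occupied N m n (\<Xi> \<omega>))} \<in> events"
    unfolding U by (rule sets.finite_UN[OF fin]) (use occupied_config(1)[OF N] in auto)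
  have "prob (\<Union>Y\<in>?S. ?E Y) = (\<Sum>Y\<in>?S. prob (?E Y))"
    by (rule finite_measure_finite_Union[OF fin]) (use occupied_config(1)[OF N] in \<open>auto simp: disjoint_family_on_def\<close>)
  also have "\<dots> = (\<Sum>Y\<in>?S. pmf (bernoulli_set (grid m n) (cell_prob N)) Y)"
    by (intro sum.cong refl occupied_config(2)[OF N]) auto
  also have "\<dots> = measure_pmf.prob (bernoulli_set (grid m n) (cell_prob N)) ?S"
    by (rule measure_measure_pmf_finite[OF fin, symmetric])
  also have "\<dots> = measure_pmf.prob (bernoulli_set (grid m n) (cell_prob N)) {X. P X}"
    by (intro measure_pmf.finite_measure_eq_AE)
       (auto simp: AE_measure_pmf_iff dest: bernoulli_set_subset[OF finite_grid])
  finally show "prob {\<omega> \<in> space M. P (occupied N m n (\<Xi> \<omega>))} =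
         measure_pmf.prob (bernoulli_set (grid m n) (cell_prob N)) {X. P X}" unfolding U .
qed

text \<open>
  \<open>1 - exp (- \<lambda>) * (1 + \<lambda>) \<le> \<lambda>\<^sup>2\<close> since \<open>exp (- \<lambda>) \<ge> 1 - \<lambda>\<close>.
\<close>

lemma prob_two_points:
  assumes B: "B \<in> sets borel" "bounded B" "B \<subseteq> {0<..} \<times> {0<..}"
  shows "{\<omega> \<in> space M. 2 \<le> card (\<Xi> \<omega> \<inter> B)} \<in> events"
    and "prob {\<omega> \<in> space M. 2 \<le> card (\<Xi> \<omega> \<inter> B)} \<le> (measure lborel B)\<^sup>2"
proof -
  let ?E = "\<lambda>k. {\<omega> \<in> space M. card (\<Xi> \<omega> \<inter> B) = k}" and ?l = "measure lborel B"
  have ev: "?E k \<in> events" for k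
    using measurable_sets[OF count_measurable[OF B], of "{k}"] by (simp add: vimage_def Int_def conj_commute)
  have eq: "{\<omega> \<in> space M. 2 \<le> card (\<Xi> \<omega> \<inter> B)} = space M - (?E 0 \<union> ?E 1)" by auto
  show "{\<omega> \<in> space M. 2 \<le> card (\<Xi> \<omega> \<inter> B)} \<in> events" unfolding eq using ev by auto
  have "prob (?E 0 \<union> ?E 1) = prob (?E 0) + prob (?E 1)"
    by (rule finite_measure_Union) (use ev in auto)
  then have "prob {\<omega> \<in> space M. 2 \<le> card (\<Xi> \<omega> \<inter> B)} = 1 - (exp (- ?l) + exp (- ?l) * ?l)"
    unfolding eq using ev count_poisson[OF B, of 0] count_poisson[OF B, of 1] by (subst prob_compl) auto
  also have "\<dots> \<le> ?l\<^sup>2"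
  proof -
    have "(1 - ?l) * (1 + ?l) \<le> exp (- ?l) * (1 + ?l)"
      using exp_ge_add_one_self[of "- ?l"] by (intro mult_right_mono) (auto simp: add_nonneg_nonneg)
    then show ?thesis by (simp add: algebra_simps power2_eq_square)
  qed
  finally show "prob {\<omega> \<in> space M. 2 \<le> card (\<Xi> \<omega> \<inter> B)} \<le> ?l\<^sup>2" .
qed

lemma collision_prob:
  assumes N: "0 < N"
  shows "{\<omega> \<in> space M. collision N m n (\<Xi> \<omega>)} \<in> events"
    and "prob {\<omega> \<in> space M. collision N m n (\<Xi> \<omega>)} \<le>
       real m * (real n / (real N)\<^sup>2)\<^sup>2 + real n * (real m / (real N)\<^sup>2)\<^sup>2"
proof -
  let ?V = "\<lambda>i. {real i / real N <.. real (Suc i) / real N} \<times> {0<..real n / real N}"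
  let ?H = "\<lambda>j. {0<..real m / real N} \<times> {real j / real N <.. real (Suc j) / real N}"
  have V: "?V i \<in> sets borel" "bounded (?V i)" "?V i \<subseteq> {0<..} \<times> {0<..}" for i
    using Ioc_Times_borel Ioc_Times_bounded by (auto intro: greater_quotient_pos)
  have H: "?H i \<in> sets borel" "bounded (?H i)" "?H i \<subseteq> {0<..} \<times> {0<..}" for i
    using Ioc_Times_borel Ioc_Times_bounded by (auto intro: greater_quotient_pos)
  have mV: "measure lborel (?V i) = real n / (real N)\<^sup>2" and mH: "measure lborel (?H i) = real m / (real N)\<^sup>2" for i
    by (subst measure_lborel_Ioc_Times;
        simp add: diff_divide_distrib[symmetric] power2_eq_square divide_right_mono)+
  let ?EV = "\<lambda>i. {\<omega> \<in> space M. 2 \<le> card (\<Xi> \<omega> \<inter> ?V i)}" and ?EH = "\<lambda>j. {\<omega> \<in> space M. 2 \<le> card (\<Xi> \<omega> \<inter> ?H j)}"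
  have U: "{\<omega> \<in> space M. collision N m n (\<Xi> \<omega>)} = (\<Union>i<m. ?EV i) \<union> (\<Union>j<n. ?EH j)"
    unfolding collision_def by auto
  have ev: "(\<Union>i<m. ?EV i) \<in> events" "(\<Union>j<n. ?EH j) \<in> events"
    using prob_two_points(1)[OF V] prob_two_points(1)[OF H] by (auto intro!: sets.finite_UN)
  then show "{\<omega> \<in> space M. collision N m n (\<Xi> \<omega>)} \<in> events" unfolding U by auto
  have "prob ((\<Union>i<m. ?EV i) \<union> (\<Union>j<n. ?EH j)) \<le> prob (\<Union>i<m. ?EV i) + prob (\<Union>j<n. ?EH j)"
    by (rule measure_Un_le[OF ev])
  also have "prob (\<Union>i<m. ?EV i) \<le> (\<Sum>i<m. prob (?EV i))"
    by (rule measure_UNION_le) (use prob_two_points(1)[OF V] in auto)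
  also have "prob (\<Union>j<n. ?EH j) \<le> (\<Sum>j<n. prob (?EH j))"
    by (rule measure_UNION_le) (use prob_two_points(1)[OF H] in auto)
  also have "(\<Sum>i<m. prob (?EV i)) \<le> (\<Sum>i<m. (real n / (real N)\<^sup>2)\<^sup>2)"
    using prob_two_points(2)[OF V] unfolding mV by (intro sum_mono) auto
  also have "(\<Sum>j<n. prob (?EH j)) \<le> (\<Sum>j<n. (real m / (real N)\<^sup>2)\<^sup>2)"
    using prob_two_points(2)[OF H] unfolding mH by (intro sum_mono) auto
  finally show "prob {\<omega> \<in> space M. collision N m n (\<Xi> \<omega>)} \<le>
       real m * (real n / (real N)\<^sup>2)\<^sup>2 + real n * (real m / (real N)\<^sup>2)\<^sup>2"
    unfolding U by simp
qed

end

section \<open>Exponential tails for the Poisson process\<close>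

lemma sqrt_cell_prob_bounds:
  assumes "0 < N"
  shows "1 - (1 / real N)\<^sup>2 \<le> real N * sqrt (cell_prob N)" "real N * sqrt (cell_prob N) \<le> 1"
proof -
  let ?x = "(1 / real N)\<^sup>2"
  have x: "0 \<le> ?x" "?x \<le> 1" using assms by (simp_all add: power_le_one)
  have "exp (- ?x) \<le> 1 - ?x + ?x\<^sup>2" by (rule exp_minus_le_quadratic[OF x(1)])
  then have "?x * (1 - ?x) \<le> cell_prob N" by (simp add: cell_prob_def algebra_simps power2_eq_square)
  moreover have "?x * (1 - ?x)\<^sup>2 \<le> ?x * (1 - ?x)"
    using x by (intro mult_left_mono) (auto simp: power2_eq_square mult_left_le)
  ultimately have "(1 / real N * (1 - ?x))\<^sup>2 \<le> cell_prob N"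
    unfolding power_mult_distrib by linarith
  then have "1 / real N * (1 - ?x) \<le> sqrt (cell_prob N)" by (rule real_le_rsqrt)
  then show "1 - ?x \<le> real N * sqrt (cell_prob N)" using assms by (simp add: divide_le_eq mult.commute)
  have "sqrt (cell_prob N) \<le> sqrt ?x"
    using cell_prob_bounds(3)[OF assms] by (rule real_sqrt_le_mono)
  also have "\<dots> = 1 / real N" by simp
  finally show "real N * sqrt (cell_prob N) \<le> 1" using assms by (simp add: le_divide_eq mult.commute)
qed

text \<open>
  Up to the slope factor and asymptotically, this is the mean number of sources per unit length.
\<close>

lemma sqrt_cell_prob_limit: "(\<lambda>N. real N * sqrt (cell_prob N)) \<longlonglongrightarrow> 1"
proof (rule tendsto_sandwich)
  show "\<forall>\<^sub>F N in sequentially. 1 - (1 / real N)\<^sup>2 \<le> real N * sqrt (cell_prob N)"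
    using eventually_gt_at_top[of 0] by eventually_elim (rule sqrt_cell_prob_bounds)
  show "\<forall>\<^sub>F N in sequentially. real N * sqrt (cell_prob N) \<le> 1"
    using eventually_gt_at_top[of 0] by eventually_elim (rule sqrt_cell_prob_bounds)
  have "(\<lambda>N. 1 - (1 / real N)\<^sup>2) \<longlonglongrightarrow> 1 - 0\<^sup>2"
    by (intro tendsto_diff tendsto_const tendsto_power lim_const_over_n)
  then show "(\<lambda>N. 1 - (1 / real N)\<^sup>2) \<longlonglongrightarrow> 1" by simp
qed simp

text \<open>
  The choice of rates for a rectangle with sides \<open>t * X\<close> and \<open>t * Y\<close>: among all pairs of odds with
  product \<open>cell_prob N\<close>, it gives both sides the same mean, \<open>t * sqrt (X * Y)\<close> in the limit, and thereby
  minimises the sum of the means.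
\<close>

lemma balanced_odds:
  fixes X Y :: real
  assumes XY: "0 < X" "0 < Y" and N: "0 < N"
  defines "A \<equiv> sqrt (Y / X) * sqrt (cell_prob N)" and "B \<equiv> sqrt (X / Y) * sqrt (cell_prob N)"
  shows "0 < A" "0 < B" "A * B = cell_prob N"
    and "real m \<le> real N * (t * X) \<Longrightarrow> real m * A \<le> t * sqrt (X * Y)"
    and "real m \<le> real N * (t * Y) \<Longrightarrow> real m * B \<le> t * sqrt (X * Y)"
proof -
  have p: "0 < cell_prob N" by (rule cell_prob_bounds(1)[OF N])
  show "0 < A" "0 < B" using XY p by (simp_all add: A_def B_def)
  have "sqrt (Y / X) * sqrt (X / Y) = 1" using XY by (simp add: real_sqrt_mult[symmetric])
  moreover have "A * B = (sqrt (Y / X) * sqrt (X / Y)) * (sqrt (cell_prob N) * sqrt (cell_prob N))"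
    unfolding A_def B_def by (simp only: mult_ac)
  ultimately show "A * B = cell_prob N" using p by simp
  have aux: "real m * (sqrt (V / U) * sqrt (cell_prob N)) \<le> t * sqrt (U * V)"
    if "real m \<le> real N * (t * U)" "0 < U" "0 < V" for U V m
  proof -
    have t: "0 \<le> t * U" using that(1) N by (smt (verit) of_nat_0_le_iff of_nat_0_less_iff zero_le_mult_iff)
    have "real m * (sqrt (V / U) * sqrt (cell_prob N)) \<le> real N * (t * U) * (sqrt (V / U) * sqrt (cell_prob N))"
      using that p by (intro mult_right_mono) auto
    also have "\<dots> = (t * U) * sqrt (V / U) * (real N * sqrt (cell_prob N))" by simp
    also have "\<dots> \<le> (t * U) * sqrt (V / U) * 1"
      using t that sqrt_cell_prob_bounds(2)[OF N] by (intro mult_left_mono) auto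
    also have "U * sqrt (V / U) = sqrt (U * V)"
      using that by (simp add: real_sqrt_divide real_sqrt_mult real_div_sqrt field_simps)
    then have "(t * U) * sqrt (V / U) * 1 = t * sqrt (U * V)" by simp
    finally show ?thesis .
  qed
  show "real m \<le> real N * (t * X) \<Longrightarrow> real m * A \<le> t * sqrt (X * Y)"
    unfolding A_def using aux[of m X Y] XY by simp
  show "real m \<le> real N * (t * Y) \<Longrightarrow> real m * B \<le> t * sqrt (X * Y)"
    unfolding B_def using aux[of m Y X] XY by (simp add: mult.commute)
qed

context quadrant_poisson
begin

lemma rectangle_finite:
  assumes "\<omega> \<in> space M"
  shows "finite (\<Xi> \<omega> \<inter> ({0<..<x} \<times> {0<..<y}))"
  by (rule locally_finite[OF assms]) (intro bounded_Times, auto)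

lemma chain_event_upper:
  assumes N: "0 < N" and d: "real (Suc d1) \<le> real N * h1 \<or> d1 = 0" "real (Suc d2) \<le> real N * h2 \<or> d2 = 0"
    and mn: "real N * x \<le> real m" "real N * y \<le> real n"
  shows "prob {\<omega> \<in> space M. Suc k \<le> longest_chain (h1, h2) (\<Xi> \<omega>) (x, y)} \<le>
     real m * (real n / (real N)\<^sup>2)\<^sup>2 + real n * (real m / (real N)\<^sup>2)\<^sup>2 +
     measure_pmf.prob (bernoulli_set (grid (m - k * d1) (n - k * d2)) (cell_prob N)) {X. has_chain (1, 1) X UNIV (Suc k)}"
proof -
  let ?C = "{\<omega> \<in> space M. collision N m n (\<Xi> \<omega>)}"
  let ?H = "{\<omega> \<in> space M. has_chain (Suc d1, Suc d2) (occupied N m n (\<Xi> \<omega>)) UNIV (Suc k)}"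
  have H: "?H \<in> events" "prob ?H = measure_pmf.prob (bernoulli_set (grid (m - k * d1) (n - k * d2)) (cell_prob N))
      {X. has_chain (1, 1) X UNIV (Suc k)}"
    using occupied_law[OF N, of "\<lambda>Y. has_chain (Suc d1, Suc d2) Y UNIV (Suc k)" m n]
    unfolding prob_has_chain_gap by auto
  have "{\<omega> \<in> space M. Suc k \<le> longest_chain (h1, h2) (\<Xi> \<omega>) (x, y)} \<subseteq> ?C \<union> ?H"
  proof
    fix \<omega> assume \<omega>: "\<omega> \<in> {\<omega> \<in> space M. Suc k \<le> longest_chain (h1, h2) (\<Xi> \<omega>) (x, y)}"
    then obtain ps where ps: "h_chain (h1, h2) (\<Xi> \<omega>) (x, y) ps" "length ps = Suc k"
      using longest_chain_ge_iff[of "\<Xi> \<omega>" "(x, y)" "Suc k" "(h1, h2)"] rectangle_finite by auto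
    show "\<omega> \<in> ?C \<union> ?H"
      using cells_from_chain[OF N _ _ _ mn _ ps(1), of "Suc d1" "Suc d2"] locally_finite d ps(2) \<omega> by auto
  qed
  then have "prob {\<omega> \<in> space M. Suc k \<le> longest_chain (h1, h2) (\<Xi> \<omega>) (x, y)} \<le> prob (?C \<union> ?H)"
    using H(1) collision_prob(1)[OF N] by (intro finite_measure_mono) auto
  also have "\<dots> \<le> prob ?C + prob ?H" by (rule measure_Un_le[OF collision_prob(1)[OF N] H(1)])
  finally show ?thesis using collision_prob(2)[OF N, of m n] H(2) by linarith
qed

lemma chain_event_lower:
  assumes N: "0 < N" and h: "0 \<le> h1" "0 \<le> h2"
    and d: "real N * h1 \<le> real d1" "real N * h2 \<le> real d2"
    and mn: "real m < real N * x" "real n < real N * y"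
    and mn': "m' \<le> m - k * d1" "n' \<le> n - k * d2"
  shows "prob {\<omega> \<in> space M. longest_chain (h1, h2) (\<Xi> \<omega>) (x, y) < Suc k} \<le>
     measure_pmf.prob (bernoulli_set (grid m' n') (cell_prob N)) {X. \<not> has_chain (1, 1) X UNIV (Suc k)}"
proof -
  let ?H = "{\<omega> \<in> space M. \<not> has_chain (Suc d1, Suc d2) (occupied N m n (\<Xi> \<omega>)) UNIV (Suc k)}"
  let ?Q = "\<lambda>X. has_chain (1, 1) X UNIV (Suc k)"
  let ?\<mu> = "bernoulli_set (grid (m - k * d1) (n - k * d2)) (cell_prob N)"
  have compl: "measure_pmf.prob \<mu> {X. \<not> R X} = 1 - measure_pmf.prob \<mu> {X. R X}" for \<mu> :: "'x pmf" and R
    using measure_pmf.prob_compl[of "{X. R X}" \<mu>] by (simp add: Compl_eq_Diff_UNIV[symmetric] Collect_neg_eq)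
  have H: "?H \<in> events" "prob ?H = measure_pmf.prob ?\<mu> {X. \<not> ?Q X}"
    using occupied_law[OF N, of "\<lambda>Y. \<not> has_chain (Suc d1, Suc d2) Y UNIV (Suc k)" m n]
    unfolding compl prob_has_chain_gap by auto
  have "{\<omega> \<in> space M. longest_chain (h1, h2) (\<Xi> \<omega>) (x, y) < Suc k} \<subseteq> ?H"
  proof
    fix \<omega> assume "\<omega> \<in> {\<omega> \<in> space M. longest_chain (h1, h2) (\<Xi> \<omega>) (x, y) < Suc k}"
    then have \<omega>: "\<omega> \<in> space M" "longest_chain (h1, h2) (\<Xi> \<omega>) (x, y) < Suc k" by simp_all
    have "\<not> has_chain (Suc d1, Suc d2) (occupied N m n (\<Xi> \<omega>)) UNIV (Suc k)"
    proof
      assume "has_chain (Suc d1, Suc d2) (occupied N m n (\<Xi> \<omega>)) UNIV (Suc k)"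
      then have "\<exists>ps. h_chain (h1, h2) (\<Xi> \<omega>) (x, y) ps \<and> length ps = Suc k"
        using d by (intro chain_from_cells[OF N _ _ h mn]) auto
      then have "Suc k \<le> longest_chain (h1, h2) (\<Xi> \<omega>) (x, y)"
        using longest_chain_ge_iff[of "\<Xi> \<omega>" "(x, y)" "Suc k" "(h1, h2)"] rectangle_finite[OF \<omega>(1)] by simp
      then show False using \<omega>(2) by simp
    qed
    then show "\<omega> \<in> ?H" using \<omega>(1) by simp
  qed
  then have "prob {\<omega> \<in> space M. longest_chain (h1, h2) (\<Xi> \<omega>) (x, y) < Suc k} \<le> prob ?H"
    using H(1) by (rule finite_measure_mono)
  also have "\<dots> = 1 - measure_pmf.prob ?\<mu> {X. ?Q X}" unfolding H(2) compl ..
  also have "measure_pmf.prob (bernoulli_set (grid m' n') (cell_prob N)) {X. ?Q X} \<le> measure_pmf.prob ?\<mu> {X. ?Q X}"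
  proof (rule bernoulli_set_prob_mono[OF finite_grid])
    show "grid m' n' \<subseteq> grid (m - k * d1) (n - k * d2)" using mn' by (auto simp: grid_def)
  qed (erule has_chain_mono[OF _ Int_lower1])
  then have "1 - measure_pmf.prob ?\<mu> {X. ?Q X} \<le> measure_pmf.prob (bernoulli_set (grid m' n') (cell_prob N)) {X. \<not> ?Q X}"
    unfolding compl by simp
  finally show ?thesis .
qed

lemma Suc_ceiling:
  fixes x :: real
  assumes "0 < x"
  obtains k where "real k < x" "x \<le> real (Suc k)" "\<And>j. x \<le> real j \<longleftrightarrow> Suc k \<le> j"
proof
  define k where "k = nat \<lceil>x\<rceil> - 1"
  have "0 < \<lceil>x\<rceil>" using assms by simp
  then have "int (Suc k) = \<lceil>x\<rceil>" unfolding k_def by arith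
  then have k: "real (Suc k) = of_int \<lceil>x\<rceil>" by (metis of_int_of_nat_eq)
  show "real k < x" "x \<le> real (Suc k)" using k by linarith+
  then show "x \<le> real j \<longleftrightarrow> Suc k \<le> j" for j by linarith
qed

text \<open>
  For large \<open>t\<close>, a chain of about \<open>F * t\<close> points leaves a rectangle with sides less than \<open>t * X\<close> and
  \<open>t * Y\<close> after the gaps are removed, and this rectangle typically holds only \<open>2 * t * sqrt (X * Y) < F * t\<close> points. The
  bound for the grid is uniform in \<open>N\<close> and the collision term vanishes as \<open>N\<close> tends to infinity.
\<close>

lemma longest_chain_upper_tail:
  fixes h1 h2 a b F X Y :: real
  assumes h: "0 \<le> h1" "0 \<le> h2" and ab: "0 < a" "0 < b" and F: "0 < F"
    and XY: "0 < X" "0 < Y" "a - F * h1 < X" "b - F * h2 < Y" "2 * sqrt (X * Y) < F"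
  shows "\<exists>c>0. \<exists>t0>0. \<forall>t\<ge>t0.
    prob {\<omega> \<in> space M. F * t \<le> real (longest_chain (h1, h2) (\<Xi> \<omega>) (a * t, b * t))} \<le> 2 * exp (- c * t)"
proof -
  let ?L = "\<lambda>\<omega> t. real (longest_chain (h1, h2) (\<Xi> \<omega>) (a * t, b * t))"
  define R where "R = sqrt (X * Y)"
  have R: "0 < R" using XY by (simp add: R_def)
  define e where "e = min 1 ((F - 2 * R) / (2 * R))"
  have e: "0 < e" "e \<le> 2" "(2 + 2 * e) * R \<le> F"
  proof -
    show "0 < e" "e \<le> 2" using XY R unfolding e_def R_def[symmetric] by auto
    have "e * R \<le> (F - 2 * R) / (2 * R) * R" using R by (intro mult_right_mono) (auto simp: e_def)
    also have "\<dots> = (F - 2 * R) / 2" using R by simp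
    finally show "(2 + 2 * e) * R \<le> F" by (simp add: algebra_simps)
  qed
  define \<delta> where "\<delta> = min (X - (a - F * h1)) (Y - (b - F * h2))"
  have \<delta>: "0 < \<delta>" "\<delta> \<le> X - (a - F * h1)" "\<delta> \<le> Y - (b - F * h2)" using XY by (auto simp: \<delta>_def)
  define t0 where "t0 = (1 + h1 + h2) / \<delta>"
  have "prob {\<omega> \<in> space M. F * t \<le> ?L \<omega> t} \<le> 2 * exp (- (e\<^sup>2 / 4 * R) * t)"
    if t: "t0 \<le> t" for t
  proof -
    have t0: "0 < t0" using \<delta> h by (simp add: t0_def)
    then have tp: "0 < t" using t by simp
    have t\<delta>: "1 + h1 + h2 \<le> t * \<delta>" using t \<delta> by (simp add: t0_def divide_le_eq mult.commute)
    have "0 < F * t" using F tp by simp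
    then obtain k where k: "F * t \<le> real (Suc k)" "\<And>j. F * t \<le> real j \<longleftrightarrow> Suc k \<le> j"
      using Suc_ceiling by blast
    have event: "{\<omega> \<in> space M. F * t \<le> ?L \<omega> t} = {\<omega> \<in> space M. Suc k \<le> longest_chain (h1, h2) (\<Xi> \<omega>) (a * t, b * t)}"
      using k(2) by blast
    define u v where "u = a * t + 1" and "v = b * t + 1"
    have bound: "prob {\<omega> \<in> space M. Suc k \<le> longest_chain (h1, h2) (\<Xi> \<omega>) (a * t, b * t)} \<le>
        (u * v\<^sup>2 + v * u\<^sup>2) / real N + 2 * exp (- (e\<^sup>2 / 4) * (t * R))"
      if N: "1 + 2 * k \<le> N" for N
    proof -
      have N0: "0 < N" using N by simp
      have shape: "real (nat \<lceil>real N * (z * t)\<rceil> - k * (nat \<lfloor>real N * h\<rfloor> - 1)) \<le> real N * (t * Z)"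
        if z: "0 < z" and hh: "0 \<le> h" "1 + h \<le> t * \<delta>" "\<delta> \<le> Z - (z - F * h)" "0 < Z" for z h Z
      proof (cases "k * (nat \<lfloor>real N * h\<rfloor> - 1) \<le> nat \<lceil>real N * (z * t)\<rceil>")
        case True
        have "real (nat \<lceil>real N * (z * t)\<rceil>) \<le> real N * (z * t) + 1"
          using z tp N0 by (simp add: ceiling_correct[THEN conjunct1] less_imp_le)
        moreover have "real k * (real N * h - 2) \<le> real k * real (nat \<lfloor>real N * h\<rfloor> - 1)"
          by (intro mult_left_mono) (simp, linarith, simp)
        ultimately have "real (nat \<lceil>real N * (z * t)\<rceil> - k * (nat \<lfloor>real N * h\<rfloor> - 1)) \<le>
            real N * (z * t) + 1 - real k * (real N * h - 2)"
          using True by (simp add: of_nat_diff)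
        also have "\<dots> = real N * (z * t) - real k * (real N * h) + (1 + 2 * real k)" by (simp add: algebra_simps)
        also have "\<dots> \<le> real N * (z * t) - (F * t - 1) * (real N * h) + real N"
        proof -
          have "(F * t - 1) * (real N * h) \<le> real k * (real N * h)"
            using k(1) hh by (intro mult_right_mono) auto
          moreover have "1 + 2 * real k \<le> real N" using N by linarith
          ultimately show ?thesis by linarith
        qed
        also have "\<dots> = real N * (t * (z - F * h) + (1 + h))" by (simp add: algebra_simps)
        also have "\<dots> \<le> real N * (t * (z - F * h) + t * \<delta>)" using hh by (intro mult_left_mono) auto
        also have "\<dots> = real N * (t * ((z - F * h) + \<delta>))" by (simp add: algebra_simps)
        also have "\<dots> \<le> real N * (t * Z)" using hh tp by (intro mult_left_mono) auto
        finally show ?thesis .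
      next
        case False
        then have "nat \<lceil>real N * (z * t)\<rceil> - k * (nat \<lfloor>real N * h\<rfloor> - 1) = 0"
          by (intro diff_is_0_eq') linarith
        moreover have "0 \<le> real N * (t * Z)" using hh(4) tp by simp
        ultimately show ?thesis by (simp only: of_nat_0)
      qed
      let ?m = "nat \<lceil>real N * (a * t)\<rceil>" and ?n = "nat \<lceil>real N * (b * t)\<rceil>"
      let ?d1 = "nat \<lfloor>real N * h1\<rfloor> - 1" and ?d2 = "nat \<lfloor>real N * h2\<rfloor> - 1"
      let ?A = "sqrt (Y / X) * sqrt (cell_prob N)" and ?B = "sqrt (X / Y) * sqrt (cell_prob N)"
      note o = balanced_odds[OF XY(1,2) N0]
      have d: "real (Suc (nat \<lfloor>real N * h\<rfloor> - 1)) \<le> real N * h \<or> nat \<lfloor>real N * h\<rfloor> - 1 = 0" if "0 \<le> h" for h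
      proof (cases "nat \<lfloor>real N * h\<rfloor> - 1 = 0")
        case False
        then have "Suc (nat \<lfloor>real N * h\<rfloor> - 1) = nat \<lfloor>real N * h\<rfloor>" by simp
        then show ?thesis using that by simp
      qed simp
      have mA: "real (?m - k * ?d1) * ?A \<le> t * R"
        unfolding R_def using h \<delta> t\<delta> XY ab by (intro o(4) shape) auto
      have nB: "real (?n - k * ?d2) * ?B \<le> t * R"
        unfolding R_def using h \<delta> t\<delta> XY ab by (intro o(5) shape) auto
      have "measure_pmf.prob (bernoulli_set (grid (?m - k * ?d1) (?n - k * ?d2)) (cell_prob N)) {X. has_chain (1, 1) X UNIV (Suc k)}
        \<le> measure_pmf.prob (bernoulli_set (grid (?m - k * ?d1) (?n - k * ?d2)) (?A * ?B))
             {X. \<exists>j. has_chain (1, 1) X UNIV j \<and> F * t \<le> real j}"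
        unfolding o(3) using k(1) by (intro measure_pmf.finite_measure_mono) auto
      also have "\<dots> \<le> 2 * exp (- (e\<^sup>2 / 4) * (t * R))"
      proof (rule strict_chain_upper_tail[OF o(1,2) _ mA order_refl nB order_refl])
        show "?A * ?B \<le> 1" unfolding o(3) by (rule cell_prob_bounds(2)[OF N0])
        have "t * ((2 + 2 * e) * R) \<le> t * F" using e(3) tp by simp
        then show "t * R + t * R + 2 * e * (t * R) \<le> F * t" by (simp add: algebra_simps)
      qed (use e in auto)
      finally have chain: "measure_pmf.prob (bernoulli_set (grid (?m - k * ?d1) (?n - k * ?d2)) (cell_prob N))
          {X. has_chain (1, 1) X UNIV (Suc k)} \<le> 2 * exp (- (e\<^sup>2 / 4) * (t * R))" .
      have ceil: "real (nat \<lceil>real N * (z * t)\<rceil>) / real N \<le> z * t + 1" if "0 < z" for z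
      proof -
        have "real (nat \<lceil>real N * (z * t)\<rceil>) \<le> real N * (z * t) + 1"
          using N0 that tp by (simp add: ceiling_correct[THEN conjunct1] less_imp_le)
        then have "real (nat \<lceil>real N * (z * t)\<rceil>) \<le> real N * (z * t) + real N" using N0 by linarith
        then show ?thesis using N0 by (simp add: divide_le_eq algebra_simps)
      qed
      have mu: "real ?m / real N \<le> u" and nv: "real ?n / real N \<le> v" using ceil ab by (simp_all add: u_def v_def)
      have "real ?m * (real ?n / (real N)\<^sup>2)\<^sup>2 + real ?n * (real ?m / (real N)\<^sup>2)\<^sup>2 =
          ((real ?m / real N) * (real ?n / real N)\<^sup>2 + (real ?n / real N) * (real ?m / real N)\<^sup>2) / real N"
        using N0 by (simp add: power2_eq_square field_simps)
      also have "\<dots> \<le> (u * v\<^sup>2 + v * u\<^sup>2) / real N"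
      proof -
        have mono: "(x * y\<^sup>2 + y * x\<^sup>2) / real N \<le> (u * v\<^sup>2 + v * u\<^sup>2) / real N"
          if "0 \<le> x" "0 \<le> y" "x \<le> u" "y \<le> v" for x y
          using that by (intro divide_right_mono add_mono mult_mono power_mono) auto
        show ?thesis by (rule mono[OF _ _ mu nv]; intro divide_nonneg_nonneg of_nat_0_le_iff)
      qed
      finally have coll: "real ?m * (real ?n / (real N)\<^sup>2)\<^sup>2 + real ?n * (real ?m / (real N)\<^sup>2)\<^sup>2 \<le>
          (u * v\<^sup>2 + v * u\<^sup>2) / real N" .
      have "prob {\<omega> \<in> space M. Suc k \<le> longest_chain (h1, h2) (\<Xi> \<omega>) (a * t, b * t)} \<le>
        real ?m * (real ?n / (real N)\<^sup>2)\<^sup>2 + real ?n * (real ?m / (real N)\<^sup>2)\<^sup>2 +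
        measure_pmf.prob (bernoulli_set (grid (?m - k * ?d1) (?n - k * ?d2)) (cell_prob N)) {X. has_chain (1, 1) X UNIV (Suc k)}"
        using d[OF h(1)] d[OF h(2)] by (intro chain_event_upper[OF N0]) (auto simp: real_nat_ceiling_ge)
      then show ?thesis using coll chain by linarith
    qed
    have "(\<lambda>N. (u * v\<^sup>2 + v * u\<^sup>2) / real N + 2 * exp (- (e\<^sup>2 / 4) * (t * R))) \<longlonglongrightarrow> 0 + 2 * exp (- (e\<^sup>2 / 4) * (t * R))"
      by (intro tendsto_add tendsto_const lim_const_over_n)
    then have "prob {\<omega> \<in> space M. Suc k \<le> longest_chain (h1, h2) (\<Xi> \<omega>) (a * t, b * t)} \<le> 0 + 2 * exp (- (e\<^sup>2 / 4) * (t * R))"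
      by (rule LIMSEQ_le_const) (use bound in blast)
    then show ?thesis unfolding event by (simp add: mult_ac)
  qed
  moreover have "0 < e\<^sup>2 / 4 * R" "0 < t0" using e R \<delta> h by (simp_all add: t0_def)
  ultimately show ?thesis by blast
qed

text \<open>
  After the gaps are removed there remains a rectangle that contains one with sides \<open>t * X\<close> and
  \<open>t * Y\<close>, which typically holds a chain of \<open>2 * t * sqrt (X * Y) > F * t\<close> points. A single grid,
  fine enough for the given \<open>t\<close>, suffices.
\<close>

lemma longest_chain_lower_tail:
  fixes h1 h2 a b F X Y :: real
  assumes h: "0 \<le> h1" "0 \<le> h2" and F: "0 < F"
    and XY: "0 < X" "0 < Y" "X < a - F * h1" "Y < b - F * h2" "F < 2 * sqrt (X * Y)"
  shows "\<exists>C. \<exists>c>0. \<exists>t0>0. \<forall>t\<ge>t0.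
    prob {\<omega> \<in> space M. real (longest_chain (h1, h2) (\<Xi> \<omega>) (a * t, b * t)) < F * t} \<le> C * exp (- c * t)"
proof -
  let ?L = "\<lambda>\<omega> t. real (longest_chain (h1, h2) (\<Xi> \<omega>) (a * t, b * t))"
  define R where "R = sqrt (X * Y)"
  have R: "0 < R" using XY by (simp add: R_def)
  have gap: "0 < 2 * R - F" using XY by (simp add: R_def)
  define \<eta> where "\<eta> = (2 * R - F) / (10 * R)"
  have \<eta>: "0 < \<eta>" "\<eta> \<le> 1" "(2 - 5 * \<eta>) * R = R + F / 2"
    using R gap F by (simp_all add: \<eta>_def field_simps)
  define K where "K = nat \<lceil>1 / \<eta>\<^sup>2\<rceil>"
  have "1 / \<eta>\<^sup>2 \<le> real K" unfolding K_def by (rule real_nat_ceiling_ge)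
  moreover have \<eta>2: "0 < \<eta>\<^sup>2" using \<eta> by simp
  ultimately have "0 < real K" using divide_pos_pos[of 1 "\<eta>\<^sup>2"] by linarith
  with \<open>1 / \<eta>\<^sup>2 \<le> real K\<close> \<eta>2 have K: "0 < K" "1 / real K \<le> \<eta>\<^sup>2"
    by (simp_all add: divide_le_eq mult.commute)
  define e where "e = \<eta>\<^sup>2 / 9"
  have e: "0 < e" using \<eta> by (simp add: e_def)
  define t0 where "t0 = 2 / (2 * R - F)"
  have "prob {\<omega> \<in> space M. ?L \<omega> t < F * t}
      \<le> (2 + 6 * real K) * exp (- (e\<^sup>2 / 4 * R) * t)" if t: "t0 \<le> t" for t
  proof -
    have t0: "0 < t0" using gap by (simp add: t0_def)
    then have tp: "0 < t" using t by simp
    have "2 \<le> t * (2 * R - F)" using t gap by (simp add: t0_def divide_le_eq)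
    moreover have "(2 - 5 * \<eta>) * (t * R) = t * ((2 - 5 * \<eta>) * R)" by (simp only: mult_ac)
    then have "(2 - 5 * \<eta>) * (t * R) = t * (R + F / 2)" by (simp only: \<eta>(3))
    moreover have "F * t + 1 \<le> t * (R + F / 2)" using \<open>2 \<le> t * (2 * R - F)\<close> by (simp add: algebra_simps)
    ultimately have tR: "F * t + 1 \<le> (2 - 5 * \<eta>) * (t * R)" by linarith
    have Ft: "0 < F * t" using F tp by simp
    obtain k where k: "real k < F * t" "F * t \<le> real (Suc k)" "\<And>j. F * t \<le> real j \<longleftrightarrow> Suc k \<le> j"
      using Suc_ceiling[OF Ft] by blast
    have event: "{\<omega> \<in> space M. ?L \<omega> t < F * t} = {\<omega> \<in> space M. longest_chain (h1, h2) (\<Xi> \<omega>) (a * t, b * t) < Suc k}"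
      using k(3) by (simp only: not_le[symmetric])
    define s where "s = t * R"
    have s: "0 < s" using tp R by (simp add: s_def)

    \<comment> \<open>The lower tail bound wants sides that split into \<^term>\<open>K\<close> equal blocks.\<close>
    define side where "side Z N = K * nat \<lfloor>real N * (t * Z) / real K\<rfloor>" for Z N
    have side_upper: "real (side Z N) \<le> real N * (t * Z)" if "0 < Z" for Z N
    proof -
      have "0 \<le> real N * (t * Z) / real K" using that tp by simp
      then have "real (nat \<lfloor>real N * (t * Z) / real K\<rfloor>) \<le> real N * (t * Z) / real K" by simp
      then have "real K * real (nat \<lfloor>real N * (t * Z) / real K\<rfloor>) \<le> real K * (real N * (t * Z) / real K)"
        by (rule mult_left_mono) simp
      then show ?thesis using K by (simp add: side_def)
    qed
    have side_lower: "real N * (t * Z) - real K \<le> real (side Z N)" for Z N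
    proof -
      have "real N * (t * Z) / real K - 1 \<le> real (nat \<lfloor>real N * (t * Z) / real K\<rfloor>)" by linarith
      then have "real K * (real N * (t * Z) / real K - 1) \<le> real K * real (nat \<lfloor>real N * (t * Z) / real K\<rfloor>)"
        by (rule mult_left_mono) simp
      then show ?thesis using K by (simp add: side_def right_diff_distrib)
    qed

    \<comment> \<open>The rounding costs at most \<^term>\<open>K\<close> cells, which is negligible on a fine grid.\<close>
    have dens: "\<forall>\<^sub>F N in sequentially. (1 - e) * s \<le>
        real (side U N) * (sqrt (V / U) * sqrt (cell_prob N) / (1 + sqrt (V / U) * sqrt (cell_prob N)))"
      if UV: "0 < U" "0 < V" "R = sqrt (U * V)" for U V
    proof -
      let ?r = "sqrt (V / U)"
      let ?lo = "\<lambda>N. (t * U * ?r * (real N * sqrt (cell_prob N)) - real K * ?r * sqrt (cell_prob N)) /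
          (1 + ?r * sqrt (cell_prob N))"
      have "(\<lambda>N. real N * sqrt (cell_prob N) * (1 / real N)) \<longlonglongrightarrow> 1 * 0"
        by (intro tendsto_mult sqrt_cell_prob_limit lim_const_over_n)
      moreover have "\<forall>\<^sub>F N in sequentially. real N * sqrt (cell_prob N) * (1 / real N) = sqrt (cell_prob N)"
        using eventually_gt_at_top[of 0] by eventually_elim simp
      ultimately have p0: "(\<lambda>N. sqrt (cell_prob N)) \<longlonglongrightarrow> 0"
        using Lim_transform_eventually by fastforce
      have "U * ?r = R"
        using UV by (simp add: real_sqrt_divide real_sqrt_mult real_div_sqrt field_simps)
      then have val: "(t * U * ?r * 1 - real K * ?r * 0) / (1 + ?r * 0) = s" by (simp add: s_def)
      have "?lo \<longlonglongrightarrow> (t * U * ?r * 1 - real K * ?r * 0) / (1 + ?r * 0)"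
        by (intro tendsto_divide tendsto_diff tendsto_add tendsto_mult tendsto_const p0 sqrt_cell_prob_limit) auto
      then have "?lo \<longlonglongrightarrow> s" unfolding val .
      moreover have "(1 - e) * s < s" using e s by simp
      ultimately have "\<forall>\<^sub>F N in sequentially. (1 - e) * s < ?lo N" by (rule order_tendstoD(1))
      then show ?thesis using eventually_gt_at_top[of 0]
      proof eventually_elim
        case (elim N)
        let ?A = "?r * sqrt (cell_prob N)"
        have A: "0 \<le> ?A" using UV cell_prob_bounds(1)[of N] elim(2) by simp
        have "?lo N = (real N * (t * U) - real K) * (?A / (1 + ?A))" by (simp add: algebra_simps)
        also have "\<dots> \<le> real (side U N) * (?A / (1 + ?A))"
          using side_lower A by (intro mult_right_mono) auto
        finally show ?case using elim(1) by simp
      qed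
    qed
    have room: "\<forall>\<^sub>F N in sequentially. side Z N \<le> nat (\<lceil>real N * (z * t)\<rceil> - 1) - k * nat \<lceil>real N * hh\<rceil>"
      if zZ: "0 < Z" "Z < z - F * hh" "0 \<le> hh" for z Z hh
    proof -
      define \<gamma> where "\<gamma> = t * (z - F * hh - Z)"
      have \<gamma>: "0 < \<gamma>" using zZ tp by (simp add: \<gamma>_def)
      have "\<forall>\<^sub>F N in sequentially. (1 + F * t) / \<gamma> \<le> real N"
        using filterlim_real_sequentially by (auto simp: filterlim_at_top)
      then show ?thesis
      proof eventually_elim
        case (elim N)
        have big: "1 + F * t \<le> real N * \<gamma>" using elim \<gamma> by (simp add: divide_le_eq)
        have expand: "real N * \<gamma> = real N * (z * t) - F * t * (real N * hh) - real N * (t * Z)"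
          by (simp add: \<gamma>_def algebra_simps)
        have "0 \<le> real N * hh" using zZ by simp
        then have "real (nat \<lceil>real N * hh\<rceil>) \<le> real N * hh + 1" by linarith
        then have "real k * real (nat \<lceil>real N * hh\<rceil>) \<le> (F * t) * (real N * hh + 1)"
          using k(1) Ft by (intro mult_mono) auto
        moreover have "real N * (z * t) - 1 \<le> real_of_int (\<lceil>real N * (z * t)\<rceil> - 1)" by linarith
        ultimately have "real N * (t * Z) + real (k * nat \<lceil>real N * hh\<rceil>) \<le> real_of_int (\<lceil>real N * (z * t)\<rceil> - 1)"
          using big unfolding expand of_nat_mult distrib_left mult_1_right by linarith
        with side_upper[OF zZ(1), of N]
        have "real (side Z N + k * nat \<lceil>real N * hh\<rceil>) \<le> real_of_int (\<lceil>real N * (z * t)\<rceil> - 1)" by simp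
        then have "int (side Z N + k * nat \<lceil>real N * hh\<rceil>) \<le> \<lceil>real N * (z * t)\<rceil> - 1"
          by (metis of_int_le_iff of_int_of_nat_eq)
        then show ?case by linarith
      qed
    qed
    have "\<forall>\<^sub>F N in sequentially. 0 < N \<and>
        (1 - e) * s \<le> real (side X N) * (sqrt (Y / X) * sqrt (cell_prob N) / (1 + sqrt (Y / X) * sqrt (cell_prob N))) \<and>
        (1 - e) * s \<le> real (side Y N) * (sqrt (X / Y) * sqrt (cell_prob N) / (1 + sqrt (X / Y) * sqrt (cell_prob N))) \<and>
        side X N \<le> nat (\<lceil>real N * (a * t)\<rceil> - 1) - k * nat \<lceil>real N * h1\<rceil> \<and>
        side Y N \<le> nat (\<lceil>real N * (b * t)\<rceil> - 1) - k * nat \<lceil>real N * h2\<rceil>"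
      using XY h by (intro eventually_conj eventually_gt_at_top dens room) (auto simp: R_def mult.commute)
    then obtain N where N: "0 < N"
        "(1 - e) * s \<le> real (side X N) * (sqrt (Y / X) * sqrt (cell_prob N) / (1 + sqrt (Y / X) * sqrt (cell_prob N)))"
        "(1 - e) * s \<le> real (side Y N) * (sqrt (X / Y) * sqrt (cell_prob N) / (1 + sqrt (X / Y) * sqrt (cell_prob N)))"
        "side X N \<le> nat (\<lceil>real N * (a * t)\<rceil> - 1) - k * nat \<lceil>real N * h1\<rceil>"
        "side Y N \<le> nat (\<lceil>real N * (b * t)\<rceil> - 1) - k * nat \<lceil>real N * h2\<rceil>"
      using eventually_happens'[OF sequentially_bot] by blast
    note o = balanced_odds[OF XY(1,2) N(1)]
    have "0 \<le> F * h1" "0 \<le> F * h2" using F h by simp_all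
    then have az: "0 < a" "0 < b" using XY by linarith+
    have width: "real (nat (\<lceil>real N * (z * t)\<rceil> - 1)) < real N * (z * t)" if "0 < z" for z
    proof -
      have "0 < real N * (z * t)" using that tp N(1) by simp
      then show ?thesis by linarith
    qed
    have chain: "prob {\<omega> \<in> space M. longest_chain (h1, h2) (\<Xi> \<omega>) (a * t, b * t) < Suc k} \<le>
      measure_pmf.prob (bernoulli_set (grid (side X N) (side Y N)) (cell_prob N)) {X. \<not> has_chain (1, 1) X UNIV (Suc k)}"
      by (rule chain_event_lower[OF N(1) h _ _ width[OF az(1)] width[OF az(2)] N(4,5)]) (auto simp: real_nat_ceiling_ge)
    have "measure_pmf.prob (bernoulli_set (grid (side X N) (side Y N))
          (sqrt (Y / X) * sqrt (cell_prob N) * (sqrt (X / Y) * sqrt (cell_prob N)))) {X. \<not> has_chain (1, 1) X UNIV (Suc k)}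
        \<le> (2 + 6 * real K) * exp (- (e\<^sup>2 / 4) * s)"
    proof (rule strict_chain_lower_tail[OF o(1,2) _ s \<eta>(1,2) K e_def])
      show "sqrt (Y / X) * sqrt (cell_prob N) * (sqrt (X / Y) * sqrt (cell_prob N)) \<le> 1"
        unfolding o(3) by (rule cell_prob_bounds(2)[OF N(1)])
      show "side X N = K * nat \<lfloor>real N * (t * X) / real K\<rfloor>" "side Y N = K * nat \<lfloor>real N * (t * Y) / real K\<rfloor>"
        by (simp_all add: side_def)
      show "real (side X N) * (sqrt (Y / X) * sqrt (cell_prob N)) \<le> s"
        unfolding s_def R_def by (rule o(4)[OF side_upper[OF XY(1)]])
      show "real (side Y N) * (sqrt (X / Y) * sqrt (cell_prob N)) \<le> s"
        unfolding s_def R_def by (rule o(5)[OF side_upper[OF XY(2)]])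
      show "real (Suc k) \<le> (2 - 5 * \<eta>) * s" using k(1) tR unfolding s_def by linarith
    qed (use N in auto)
    then have "prob {\<omega> \<in> space M. longest_chain (h1, h2) (\<Xi> \<omega>) (a * t, b * t) < Suc k} \<le>
        (2 + 6 * real K) * exp (- (e\<^sup>2 / 4) * s)"
      using chain unfolding o(3) by linarith
    moreover have "- (e\<^sup>2 / 4) * s = - (e\<^sup>2 / 4 * R) * t" by (simp add: s_def)
    ultimately show ?thesis unfolding event by (simp only:)
  qed
  moreover have "0 < e\<^sup>2 / 4 * R" "0 < t0" using e R gap by (simp_all add: t0_def)
  ultimately show ?thesis by blast
qed

end

section \<open>The limit shape as a fixed point\<close>

text \<open>
  With \<open>u = a * h2\<close>, \<open>v = b * h1\<close> and \<open>D = sqrt ((u - v)\<^sup>2 + a * b)\<close>, rationalising the quotient gives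
  \<open>2 * a * b / (u + v + D)\<close>. In this form the two cases of the definition agree.
\<close>

lemma limit_shape_fixpoint:
  fixes h1 h2 a b :: real
  assumes h: "0 \<le> h1" "0 \<le> h2" and ab: "0 < a" "0 < b"
  defines "f \<equiv> limit_shape (h1, h2) a b"
  shows "0 < f" "0 < a - f * h1" "0 < b - f * h2" "f = 2 * sqrt ((a - f * h1) * (b - f * h2))"
proof -
  define u v D where "u = a * h2" and "v = b * h1" and "D = sqrt ((u - v)\<^sup>2 + a * b)"
  have D2: "D\<^sup>2 = (u - v)\<^sup>2 + a * b" using ab by (simp add: D_def)
  have D: "\<bar>u - v\<bar> < D" "0 < D"
  proof -
    have "sqrt ((u - v)\<^sup>2) < D" unfolding D_def using ab by (intro real_sqrt_less_mono) simp
    then show "\<bar>u - v\<bar> < D" by simp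
    then show "0 < D" by linarith
  qed
  have uv: "0 \<le> u" "0 \<le> v" using h ab by (simp_all add: u_def v_def)
  have S: "0 < u + v + D" using uv D by linarith
  have prod: "a * b * (4 * (h1 * h2) - 1) = (u + v - D) * (u + v + D)"
  proof -
    have "(u + v - D) * (u + v + D) = (u + v)\<^sup>2 - D\<^sup>2" by (simp add: algebra_simps power2_eq_square)
    also have "\<dots> = 4 * (u * v) - a * b" unfolding D2 by (simp add: algebra_simps power2_eq_square)
    finally show ?thesis by (simp add: u_def v_def algebra_simps)
  qed
  have f: "f = 2 * (a * b) / (u + v + D)"
  proof (cases "h1 * h2 = 1 / 4")
    case True
    then have "4 * (h1 * h2) - 1 = 0" by simp
    then have "(u + v - D) * (u + v + D) = 0" using prod by (simp only: mult_zero_right)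
    then have "u + v = D" using S by simp
    then show ?thesis using True D unfolding f_def limit_shape_def Let_def
      by (simp add: u_def v_def add.commute mult.commute)
  next
    case False
    then have ne: "4 * (h1 * h2) - 1 \<noteq> 0" by simp
    have "f = 2 * (u + v - D) / (4 * (h1 * h2) - 1)"
      using False unfolding f_def limit_shape_def Let_def
      by (simp add: u_def v_def D_def algebra_simps)
    also have "\<dots> = 2 * (a * b) / (u + v + D)"
      using ne S prod by (simp add: frac_eq_eq algebra_simps)
    finally show ?thesis .
  qed
  show "0 < f" unfolding f using ab S by simp
  have af: "a - f * h1 = a * (D + (u - v)) / (u + v + D)" "b - f * h2 = b * (D - (u - v)) / (u + v + D)"
    unfolding f using S by (simp_all add: u_def v_def field_simps)
  show "0 < a - f * h1" "0 < b - f * h2" unfolding af using ab D S by (auto intro!: divide_pos_pos mult_pos_pos)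
  have "(a - f * h1) * (b - f * h2) = a * b * (D\<^sup>2 - (u - v)\<^sup>2) / (u + v + D)\<^sup>2"
    unfolding af by (simp add: power2_eq_square algebra_simps)
  also have "\<dots> = (a * b / (u + v + D))\<^sup>2" unfolding D2 by (simp add: power_divide power2_eq_square)
  also have "a * b / (u + v + D) = f / 2"
  proof -
    have "f = 2 * (a * b / (u + v + D))" unfolding f by (simp only: times_divide_eq_right)
    then show ?thesis by linarith
  qed
  finally have "sqrt ((a - f * h1) * (b - f * h2)) = f / 2" using \<open>0 < f\<close> by simp
  then show "f = 2 * sqrt ((a - f * h1) * (b - f * h2))" by simp
qed

text \<open>
  The rectangle that remains at \<open>F = f\<close> has sides proportional to \<open>a - f * h1\<close> and \<open>b - f * h2\<close> and holds
  exactly \<open>f\<close>. Scaling both sides by a factor \<open>q\<close> slightly above or below 1 scales this value by \<open>q\<close>,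
  which leaves the margins required by the two tail bounds.
\<close>

lemma (in quadrant_poisson) longest_chain_deviation:
  fixes h1 h2 a b \<epsilon> :: real
  assumes h: "0 \<le> h1" "0 \<le> h2" and ab: "0 < a" "0 < b" and \<epsilon>: "0 < \<epsilon>"
  defines "f \<equiv> limit_shape (h1, h2) a b"
  shows "\<exists>C. \<exists>c>0. \<exists>t0>0. \<forall>t\<ge>t0.
    prob {\<omega> \<in> space M. (f + \<epsilon>) * t \<le> real (longest_chain (h1, h2) (\<Xi> \<omega>) (a * t, b * t))} \<le> C * exp (- c * t) \<and>
    prob {\<omega> \<in> space M. real (longest_chain (h1, h2) (\<Xi> \<omega>) (a * t, b * t)) < (f - \<epsilon>) * t} \<le> C * exp (- c * t)"
proof -
  note fp = limit_shape_fixpoint[OF h ab, folded f_def]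
  let ?X = "a - f * h1" and ?Y = "b - f * h2"
  have scale: "2 * sqrt (q * ?X * (q * ?Y)) = q * f" if "0 < q" for q
  proof -
    have "q * ?X * (q * ?Y) = q\<^sup>2 * (?X * ?Y)" by (simp only: power2_eq_square mult_ac)
    then have "2 * sqrt (q * ?X * (q * ?Y)) = q * (2 * sqrt (?X * ?Y))" using that by (simp add: real_sqrt_mult)
    then show ?thesis using fp(4) by simp
  qed
  let ?L = "\<lambda>\<omega> t. real (longest_chain (h1, h2) (\<Xi> \<omega>) (a * t, b * t))"
  have up: "\<exists>c>0. \<exists>t0>0. \<forall>t\<ge>t0. prob {\<omega> \<in> space M. (f + \<epsilon>) * t \<le> ?L \<omega> t} \<le> 2 * exp (- c * t)"
  proof -
    define q where "q = 1 + \<epsilon> / (2 * f)"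
    have q: "1 < q" "q * f < f + \<epsilon>" using fp(1) \<epsilon> by (simp_all add: q_def distrib_right)
    have "?X < q * ?X" "?Y < q * ?Y" using q fp by simp_all
    moreover have "a - (f + \<epsilon>) * h1 \<le> ?X" "b - (f + \<epsilon>) * h2 \<le> ?Y"
      using h \<epsilon> by (auto intro!: mult_right_mono)
    ultimately have "a - (f + \<epsilon>) * h1 < q * ?X" "b - (f + \<epsilon>) * h2 < q * ?Y" by linarith+
    then show ?thesis
      using fp q \<epsilon> scale[of q] by (intro longest_chain_upper_tail[OF h ab, of _ "q * ?X" "q * ?Y"]) auto
  qed
  have down: "\<exists>C. \<exists>c>0. \<exists>t0>0. \<forall>t\<ge>t0. prob {\<omega> \<in> space M. ?L \<omega> t < (f - \<epsilon>) * t} \<le> C * exp (- c * t)"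
  proof (cases "0 < f - \<epsilon>")
    case True
    define q where "q = 1 - \<epsilon> / (2 * f)"
    have q: "0 < q" "q < 1" "f - \<epsilon> < q * f" using fp(1) \<epsilon> True by (simp_all add: q_def left_diff_distrib divide_less_eq)
    have "q * ?X < ?X" "q * ?Y < ?Y" using q fp by simp_all
    moreover have "?X \<le> a - (f - \<epsilon>) * h1" "?Y \<le> b - (f - \<epsilon>) * h2"
      using h \<epsilon> by (auto intro!: mult_right_mono)
    ultimately have "q * ?X < a - (f - \<epsilon>) * h1" "q * ?Y < b - (f - \<epsilon>) * h2" by linarith+
    then show ?thesis
      using fp q True scale[of q] by (intro longest_chain_lower_tail[OF h, of _ "q * ?X" "q * ?Y"]) auto
  next
    case False
    have "{\<omega> \<in> space M. ?L \<omega> t < (f - \<epsilon>) * t} = {}" if "1 \<le> t" for t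
    proof -
      have "(f - \<epsilon>) * t \<le> 0" using False that by (simp add: mult_nonpos_nonneg)
      then show ?thesis by (auto simp: not_less intro: order_trans)
    qed
    then have "prob {\<omega> \<in> space M. ?L \<omega> t < (f - \<epsilon>) * t} \<le> 0 * exp (- 1 * t)" if "1 \<le> t" for t
      using that by (simp only: measure_empty)
    then show ?thesis
      by - (rule exI[of _ 0], rule exI[of _ 1], rule conjI[OF zero_less_one], rule exI[of _ 1],
          rule conjI[OF zero_less_one], blast)
  qed
  from up obtain c1 t1 where 1: "c1 > 0" "t1 > 0" "\<And>t. t \<ge> t1 \<Longrightarrow> prob {\<omega> \<in> space M. (f + \<epsilon>) * t \<le> ?L \<omega> t} \<le> 2 * exp (- c1 * t)"
    by blast
  from down obtain C c2 t2 where 2: "c2 > 0" "t2 > 0" "\<And>t. t \<ge> t2 \<Longrightarrow> prob {\<omega> \<in> space M. ?L \<omega> t < (f - \<epsilon>) * t} \<le> C * exp (- c2 * t)"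
    by blast
  have mono: "C' * exp (- c' * t) \<le> max 2 C * exp (- min c1 c2 * t)" if "C' \<le> max 2 C" "min c1 c2 \<le> c'" "0 < t" for C' c' t
    using that by (intro mult_mono) auto
  show ?thesis
  proof (intro exI conjI allI impI)
    show "min c1 c2 > 0" "max t1 t2 > 0" using 1 2 by auto
    fix t assume t: "t \<ge> max t1 t2"
    show "prob {\<omega> \<in> space M. (f + \<epsilon>) * t \<le> ?L \<omega> t} \<le> max 2 C * exp (- min c1 c2 * t)"
      using t 1(2) by (intro order_trans[OF 1(3) mono]) auto
    show "prob {\<omega> \<in> space M. ?L \<omega> t < (f - \<epsilon>) * t} \<le> max 2 C * exp (- min c1 c2 * t)"
      using t 2(2) by (intro order_trans[OF 2(3) mono]) auto
  qed
qed

section \<open>Measurability of the longest chain\<close>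

lemma finite_lists_eventually:
  assumes "finite A" "\<And>ps. set ps \<subseteq> A \<Longrightarrow> length ps = k \<Longrightarrow> \<forall>\<^sub>F n in F. P ps n"
  shows "\<forall>\<^sub>F n in F. \<forall>ps. set ps \<subseteq> A \<and> length ps = k \<longrightarrow> P ps n"
proof -
  have "\<forall>\<^sub>F n in F. \<forall>ps\<in>{ps. set ps \<subseteq> A \<and> length ps = k}. P ps n"
    using assms(2) by (intro eventually_ball_finite finite_lists_length_eq[OF assms(1)]) auto
  then show ?thesis by simp
qed

definition separated :: "real \<Rightarrow> real \<Rightarrow> (real \<times> real) list \<Rightarrow> bool" where
  "separated u v = successively (\<lambda>p q. fst p + u \<le> fst q \<and> snd p + v \<le> snd q)"

text \<open>
  A finite chain with strict inequalities has a positive minimal gap, so the strict condition is a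
  countable union of closed ones.
\<close>

lemma strict_prec_iff_separated:
  assumes h: "0 \<le> h1" "0 \<le> h2"
  shows "successively (\<lambda>p q. fst p < fst q \<and> snd p < snd q \<and> prec_h (h1, h2) p q) ps \<longleftrightarrow>
     (\<exists>r. separated (max h1 (inverse (real (Suc r)))) (max h2 (inverse (real (Suc r)))) ps)"
proof
  let ?R = "\<lambda>p q. fst p < fst q \<and> snd p < snd q \<and> prec_h (h1, h2) p q"
  assume s: "successively ?R ps"
  have lim: "\<forall>\<^sub>F r in sequentially. inverse (real (Suc r)) < d" if "0 < d" for d
    using order_tendstoD(2)[OF LIMSEQ_inverse_real_of_nat that] .
  have "\<forall>\<^sub>F r in sequentially. fst p + max h1 (inverse (real (Suc r))) \<le> fst q \<and>
       snd p + max h2 (inverse (real (Suc r))) \<le> snd q" if "?R p q" for p q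
    using lim[of "fst q - fst p"] lim[of "snd q - snd p"] that
    by (auto simp: prec_h_def max_def elim: eventually_elim2)
  then have "\<forall>\<^sub>F r in sequentially. \<forall>z\<in>set ps \<times> set ps. ?R (fst z) (snd z) \<longrightarrow>
      fst (fst z) + max h1 (inverse (real (Suc r))) \<le> fst (snd z) \<and>
      snd (fst z) + max h2 (inverse (real (Suc r))) \<le> snd (snd z)"
    by (intro eventually_ball_finite) (auto simp: eventually_conj_iff)
  then obtain r where r: "\<forall>z\<in>set ps \<times> set ps. ?R (fst z) (snd z) \<longrightarrow>
      fst (fst z) + max h1 (inverse (real (Suc r))) \<le> fst (snd z) \<and>
      snd (fst z) + max h2 (inverse (real (Suc r))) \<le> snd (snd z)"
    using eventually_happens'[OF sequentially_bot] by blast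
  have "separated (max h1 (inverse (real (Suc r)))) (max h2 (inverse (real (Suc r)))) ps"
    unfolding separated_def by (rule successively_mono[OF s]) (use r in force)
  then show "\<exists>r. separated (max h1 (inverse (real (Suc r)))) (max h2 (inverse (real (Suc r)))) ps" ..
next
  assume "\<exists>r. separated (max h1 (inverse (real (Suc r)))) (max h2 (inverse (real (Suc r)))) ps"
  then obtain r where r: "separated (max h1 (inverse (real (Suc r)))) (max h2 (inverse (real (Suc r)))) ps" ..
  moreover have "0 < max h1 (inverse (real (Suc r)))" "0 < max h2 (inverse (real (Suc r)))"
    "h1 \<le> max h1 (inverse (real (Suc r)))" "h2 \<le> max h2 (inverse (real (Suc r)))"
    by (auto simp: less_max_iff_disj)
  ultimately show "successively (\<lambda>p q. fst p < fst q \<and> snd p < snd q \<and> prec_h (h1, h2) p q) ps"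
    unfolding separated_def prec_h_def fst_conv snd_conv by (elim successively_mono) linarith
qed

definition cell_separated :: "real \<Rightarrow> real \<Rightarrow> nat \<Rightarrow> (nat \<times> nat) list \<Rightarrow> bool" where
  "cell_separated u v N = successively (\<lambda>c d.
     real N * u + real (fst c) \<le> real (fst d) + 1 \<and> real N * v + real (snd c) \<le> real (snd d) + 1)"

text \<open>
  Chains of cells that satisfy the condition up to \<open>2 / N\<close> yield chains of points that satisfy it up
  to \<open>2 / N\<close>. As \<open>S\<close> is finite, there are only finitely many candidates, so one that fails the closed
  condition is excluded by every sufficiently fine grid.
\<close>

lemma separated_iff_cells:
  assumes fin: "finite S" and S: "S \<subseteq> {0<..} \<times> {0<..}"
  shows "(\<exists>ps. length ps = k \<and> set ps \<subseteq> S \<and> separated u v ps) \<longleftrightarrow>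
     (\<forall>n. \<exists>cs. length cs = k \<and> (\<forall>c\<in>set cs. S \<inter> cell (Suc n) c \<noteq> {}) \<and> cell_separated u v (Suc n) cs)"
    (is "?L \<longleftrightarrow> (\<forall>n. ?C n)")
proof
  assume ?L
  then obtain ps where ps: "length ps = k" "set ps \<subseteq> S" "separated u v ps" by blast
  show "\<forall>n. ?C n"
  proof
    fix n
    let ?N = "Suc n"
    define f where "f p = (index ?N (fst p), index ?N (snd p))" for p :: "real \<times> real"
    have cellf: "p \<in> cell ?N (f p)" if "p \<in> S" for p
      using that S index_bounds[of ?N "fst p"] index_bounds[of ?N "snd p"]
      by (auto simp: cell_def f_def mem_Times_iff)
    have step: "real ?N * w + real i \<le> real j + 1"
      if "real i / real ?N < y" "y' \<le> real (Suc j) / real ?N" "y + w \<le> y'" for i j y y' w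
    proof -
      have "w \<le> (real (Suc j) - real i) / real ?N" using that unfolding diff_divide_distrib by linarith
      then have "w * real ?N \<le> real (Suc j) - real i" by (subst (asm) pos_le_divide_eq) simp_all
      then show ?thesis by (simp add: algebra_simps)
    qed
    have "successively (\<lambda>c d. real ?N * u + real (fst c) \<le> real (fst d) + 1 \<and>
        real ?N * v + real (snd c) \<le> real (snd d) + 1) (map f ps)"
      unfolding successively_map
    proof (rule successively_mono[OF ps(3)[unfolded separated_def]])
      fix p q assume pq: "p \<in> set ps" "q \<in> set ps" "fst p + u \<le> fst q \<and> snd p + v \<le> snd q"
      then have "p \<in> cell ?N (f p)" "q \<in> cell ?N (f q)" using cellf ps(2) by blast+
      then show "real ?N * u + real (fst (f p)) \<le> real (fst (f q)) + 1 \<and>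
          real ?N * v + real (snd (f p)) \<le> real (snd (f q)) + 1"
        using pq(3) step[of "fst (f p)" "fst p" "fst q" "fst (f q)" u]
          step[of "snd (f p)" "snd p" "snd q" "snd (f q)" v]
        unfolding cell_def mem_Times_iff greaterThanAtMost_iff by blast
    qed
    then have "cell_separated u v ?N (map f ps)" unfolding cell_separated_def .
    moreover have "\<forall>c\<in>set (map f ps). S \<inter> cell ?N c \<noteq> {}" using cellf ps(2) by auto
    ultimately show "?C n" using ps(1) by (intro exI[of _ "map f ps"]) simp
  qed
next
  assume C: "\<forall>n. ?C n"
  let ?near = "\<lambda>ps n. separated (u - 2 / real (Suc n)) (v - 2 / real (Suc n)) ps"
  show ?L
  proof (rule ccontr)
    assume no: "\<not> ?L"
    have "\<forall>\<^sub>F n in sequentially. \<not> ?near ps n" if ps: "set ps \<subseteq> S" "length ps = k" for ps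
    proof -
      have "\<not> separated u v ps" using no ps by blast
      then obtain i where i: "Suc i < length ps"
          "\<not> (fst (ps ! i) + u \<le> fst (ps ! Suc i) \<and> snd (ps ! i) + v \<le> snd (ps ! Suc i))"
        unfolding separated_def successively_conv_nth by blast
      define d where "d = max (fst (ps ! i) + u - fst (ps ! Suc i)) (snd (ps ! i) + v - snd (ps ! Suc i))"
      have d: "0 < d" using i(2) by (auto simp: d_def max_def)
      have "(\<lambda>n. 2 * inverse (real (Suc n))) \<longlonglongrightarrow> 2 * 0"
        by (intro tendsto_mult tendsto_const LIMSEQ_inverse_real_of_nat)
      then have "\<forall>\<^sub>F n in sequentially. 2 * inverse (real (Suc n)) < d" using d by (intro order_tendstoD(2)) auto
      then show ?thesis
      proof eventually_elim
        case (elim n)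
        show ?case
        proof
          assume "?near ps n"
          then have "fst (ps ! i) + (u - 2 / real (Suc n)) \<le> fst (ps ! Suc i)"
              "snd (ps ! i) + (v - 2 / real (Suc n)) \<le> snd (ps ! Suc i)"
            using i(1) unfolding separated_def successively_conv_nth by blast+
          then have "d \<le> 2 / real (Suc n)" unfolding d_def by linarith
          then show False using elim by (simp add: divide_inverse)
        qed
      qed
    qed
    then have "\<forall>\<^sub>F n in sequentially. \<forall>ps. set ps \<subseteq> S \<and> length ps = k \<longrightarrow> \<not> ?near ps n"
      by (rule finite_lists_eventually[OF fin])
    then obtain n where n: "\<And>ps. set ps \<subseteq> S \<Longrightarrow> length ps = k \<Longrightarrow> \<not> ?near ps n"
      using eventually_happens'[OF sequentially_bot] by blast
    let ?N = "Suc n"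
    obtain cs where cs: "length cs = k" "\<forall>c\<in>set cs. S \<inter> cell ?N c \<noteq> {}" "cell_separated u v ?N cs"
      using C by blast
    then obtain pick where pick: "\<forall>c\<in>set cs. pick c \<in> S \<inter> cell ?N c"
      using bchoice[of "set cs" "\<lambda>c p. p \<in> S \<inter> cell ?N c"] by blast
    have step: "y + (w - 2 / real ?N) \<le> y'"
      if "y \<le> real (Suc i) / real ?N" "real j / real ?N < y'" "real ?N * w + real i \<le> real j + 1" for i j y y' w
    proof -
      have "(real ?N * w + real i) / real ?N \<le> (real j + 1) / real ?N" using that(3) by (rule divide_right_mono) simp
      then have "w + real i / real ?N \<le> real j / real ?N + 1 / real ?N" by (simp add: add_divide_distrib del: of_nat_Suc)
      moreover have "real (Suc i) / real ?N = real i / real ?N + 1 / real ?N" by (simp add: add_divide_distrib)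
      moreover have "2 / real ?N = 1 / real ?N + 1 / real ?N" by simp
      ultimately show ?thesis using that(1,2) by linarith
    qed
    have "separated (u - 2 / real ?N) (v - 2 / real ?N) (map pick cs)"
      unfolding separated_def successively_map
    proof (rule successively_mono[OF cs(3)[unfolded cell_separated_def]])
      fix c d assume "c \<in> set cs" "d \<in> set cs" and cd: "real ?N * u + real (fst c) \<le> real (fst d) + 1 \<and>
        real ?N * v + real (snd c) \<le> real (snd d) + 1"
      then have "pick c \<in> cell ?N c" "pick d \<in> cell ?N d" using pick by blast+
      then show "fst (pick c) + (u - 2 / real ?N) \<le> fst (pick d) \<and> snd (pick c) + (v - 2 / real ?N) \<le> snd (pick d)"
        using cd unfolding cell_def mem_Times_iff greaterThanAtMost_iff by (intro conjI step) blast+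
    qed
    then show False using n[of "map pick cs"] pick cs(1) by auto
  qed
qed

context quadrant_poisson
begin

lemma hit_event:
  assumes "B \<in> sets borel" "bounded B" "B \<subseteq> {0<..} \<times> {0<..}"
  shows "{\<omega> \<in> space M. \<Xi> \<omega> \<inter> B \<noteq> {}} \<in> events"
proof -
  have "{\<omega> \<in> space M. \<Xi> \<omega> \<inter> B \<noteq> {}} = (\<lambda>\<omega>. card (\<Xi> \<omega> \<inter> B)) -` {0<..} \<inter> space M"
    using locally_finite[OF _ assms(2)] by (auto simp: card_gt_0_iff)
  then show ?thesis using measurable_sets[OF count_measurable[OF assms]] by simp
qed

text \<open>
  The previous two lemmas express the event by countably many statements that a Borel set is hit by
  the process.
\<close>

lemma chain_event:
  assumes h: "0 \<le> h1" "0 \<le> h2"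
  shows "{\<omega> \<in> space M. k \<le> longest_chain (h1, h2) (\<Xi> \<omega>) (x, y)} \<in> events"
proof -
  let ?R = "{0<..<x} \<times> {0<..<y}"
  let ?u = "\<lambda>r. max h1 (inverse (real (Suc r)))" and ?v = "\<lambda>r. max h2 (inverse (real (Suc r)))"
  have iff: "k \<le> longest_chain (h1, h2) (\<Xi> \<omega>) (x, y) \<longleftrightarrow>
     (\<exists>r. \<forall>n. \<exists>cs. (length cs = k \<and> cell_separated (?u r) (?v r) (Suc n) cs) \<and>
        (\<forall>c\<in>set cs. \<Xi> \<omega> \<inter> (?R \<inter> cell (Suc n) c) \<noteq> {}))" if \<omega>: "\<omega> \<in> space M" for \<omega>
  proof -
    have "k \<le> longest_chain (h1, h2) (\<Xi> \<omega>) (x, y) \<longleftrightarrow> (\<exists>ps. h_chain (h1, h2) (\<Xi> \<omega>) (x, y) ps \<and> length ps = k)"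
      using longest_chain_ge_iff[of "\<Xi> \<omega>" "(x, y)"] rectangle_finite[OF \<omega>] by simp
    also have "\<dots> \<longleftrightarrow> (\<exists>r. \<exists>ps. length ps = k \<and> set ps \<subseteq> \<Xi> \<omega> \<inter> ?R \<and> separated (?u r) (?v r) ps)"
      unfolding h_chain_def strict_prec_iff_separated[OF h] fst_conv snd_conv by blast
    also have "\<dots> \<longleftrightarrow> (\<exists>r. \<forall>n. \<exists>cs. length cs = k \<and> (\<forall>c\<in>set cs. \<Xi> \<omega> \<inter> ?R \<inter> cell (Suc n) c \<noteq> {}) \<and>
        cell_separated (?u r) (?v r) (Suc n) cs)"
      using rectangle_finite[OF \<omega>, of x y] by (subst separated_iff_cells) auto
    finally show ?thesis by (simp only: Int_assoc conj_ac)
  qed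
  have hit: "{\<omega> \<in> space M. \<Xi> \<omega> \<inter> (?R \<inter> cell N c) \<noteq> {}} \<in> events" for N c
  proof (rule hit_event)
    show "?R \<inter> cell N c \<in> sets borel" using cell_borel by (intro sets.Int borel_Times) auto
    show "bounded (?R \<inter> cell N c)" by (intro bounded_Int disjI2 cell_bounded)
  qed (use cell_quadrant in auto)
  have "{\<omega> \<in> space M. \<exists>r. \<forall>n. \<exists>cs. (length cs = k \<and> cell_separated (?u r) (?v r) (Suc n) cs) \<and>
        (\<forall>c\<in>set cs. \<Xi> \<omega> \<inter> (?R \<inter> cell (Suc n) c) \<noteq> {})} \<in> events"
    by (intro sets.sets_Collect_countable_Ex sets.sets_Collect_countable_All sets.sets_Collect_conj
          sets.sets_Collect_const sets.sets_Collect_finite_All hit finite_set)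
  also have "{\<omega> \<in> space M. \<exists>r. \<forall>n. \<exists>cs. (length cs = k \<and> cell_separated (?u r) (?v r) (Suc n) cs) \<and>
        (\<forall>c\<in>set cs. \<Xi> \<omega> \<inter> (?R \<inter> cell (Suc n) c) \<noteq> {})} =
      {\<omega> \<in> space M. k \<le> longest_chain (h1, h2) (\<Xi> \<omega>) (x, y)}"
    using iff by (intro Collect_cong conj_cong refl) simp
  finally show ?thesis .
qed

lemma longest_chain_measurable:
  assumes h: "0 \<le> h1" "0 \<le> h2"
  shows "(\<lambda>\<omega>. real (longest_chain (h1, h2) (\<Xi> \<omega>) (x, y))) \<in> borel_measurable M"
proof (rule borel_measurableI_ge)
  fix z :: real
  have "z \<le> real n \<longleftrightarrow> nat \<lceil>z\<rceil> \<le> n" for n by linarith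
  then show "{\<omega> \<in> space M. z \<le> real (longest_chain (h1, h2) (\<Xi> \<omega>) (x, y))} \<in> events"
    using chain_event[OF h, of "nat \<lceil>z\<rceil>"] by simp
qed

lemma longest_chain_mono:
  assumes "\<omega> \<in> space M" "x \<le> x'" "y \<le> y'"
  shows "longest_chain h (\<Xi> \<omega>) (x, y) \<le> longest_chain h (\<Xi> \<omega>) (x', y')"
proof -
  have "finite (\<Xi> \<omega> \<inter> ({0<..<fst (x, y)} \<times> {0<..<snd (x, y)}))" for x y
    using rectangle_finite[OF assms(1), of x y] by simp
  note iff = longest_chain_ge_iff[OF this]
  obtain ps where ps: "h_chain h (\<Xi> \<omega>) (x, y) ps" "length ps = longest_chain h (\<Xi> \<omega>) (x, y)"
    using iff[of "longest_chain h (\<Xi> \<omega>) (x, y)" h x y] by blast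
  have "({0<..<x} \<times> {0<..<y}) \<subseteq> ({0<..<x'} \<times> {0<..<y'})" using assms(2,3) by auto
  then have "h_chain h (\<Xi> \<omega>) (x', y') ps" using ps(1) unfolding h_chain_def fst_conv snd_conv by blast
  then show ?thesis using iff[of "longest_chain h (\<Xi> \<omega>) (x, y)" h x' y'] ps(2) by blast
qed

lemma longest_chain_le_count:
  assumes "\<omega> \<in> space M"
  shows "longest_chain h (\<Xi> \<omega>) (x, y) \<le> card (\<Xi> \<omega> \<inter> ({0<..<x} \<times> {0<..<y}))"
proof -
  have fin: "finite (\<Xi> \<omega> \<inter> ({0<..<fst (x, y)} \<times> {0<..<snd (x, y)}))"
    using rectangle_finite[OF assms, of x y] by simp
  obtain ps where ps: "h_chain h (\<Xi> \<omega>) (x, y) ps" "length ps = longest_chain h (\<Xi> \<omega>) (x, y)"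
    using longest_chain_ge_iff[OF fin, of "longest_chain h (\<Xi> \<omega>) (x, y)" h] by blast
  from h_chain_length_le[OF fin ps(1)] show ?thesis unfolding ps(2) by simp
qed

lemma count_second_moment:
  assumes xy: "0 \<le> x" "0 \<le> y"
  defines "R \<equiv> {0<..<x} \<times> {0<..<y}"
  shows "(\<integral>\<^sup>+\<omega>. ennreal ((real (card (\<Xi> \<omega> \<inter> R)))\<^sup>2) \<partial>M) = ennreal ((x * y)\<^sup>2 + x * y)"
proof -
  define l where "l = x * y"
  have l: "0 \<le> l" using xy by (simp add: l_def)
  have R: "R \<in> sets borel" "bounded R" "R \<subseteq> {0<..} \<times> {0<..}"
    unfolding R_def by (auto intro!: borel_Times bounded_Times)
  have mR: "measure lborel R = l"
  proof -
    have "emeasure lborel R = emeasure lborel {0<..<x} * emeasure lborel {0<..<y}"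
      unfolding lborel_prod[symmetric] R_def by (rule lborel.emeasure_pair_measure_Times) auto
    then show ?thesis using xy by (simp add: measure_def l_def ennreal_mult[symmetric])
  qed
  let ?N = "\<lambda>\<omega>. card (\<Xi> \<omega> \<inter> R)" and ?E = "\<lambda>k. {\<omega> \<in> space M. card (\<Xi> \<omega> \<inter> R) = k}"
  let ?w = "\<lambda>k. exp (- l) * l ^ k / fact k"
  have ev: "?E k \<in> events" for k
    using measurable_sets[OF count_measurable[OF R], of "{k}"] by (simp add: vimage_def Int_def conj_commute)
  have pE: "emeasure M (?E k) = ennreal (?w k)" for k
    using count_poisson[OF R, of k] by (simp add: emeasure_eq_measure mR)
  have "(\<integral>\<^sup>+\<omega>. ennreal ((real (?N \<omega>))\<^sup>2) \<partial>M) = (\<integral>\<^sup>+\<omega>. (\<Sum>k. ennreal ((real k)\<^sup>2) * indicator (?E k) \<omega>) \<partial>M)"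
  proof (rule nn_integral_cong)
    fix \<omega> assume \<omega>: "\<omega> \<in> space M"
    have "(\<Sum>k. ennreal ((real k)\<^sup>2) * indicator (?E k) \<omega>) =
        (\<Sum>k\<in>{?N \<omega>}. ennreal ((real k)\<^sup>2) * indicator (?E k) \<omega>)"
      by (rule suminf_finite) (auto simp: indicator_def)
    then show "ennreal ((real (?N \<omega>))\<^sup>2) = (\<Sum>k. ennreal ((real k)\<^sup>2) * indicator (?E k) \<omega>)"
      using \<omega> by simp
  qed
  also have "\<dots> = (\<Sum>k. \<integral>\<^sup>+\<omega>. ennreal ((real k)\<^sup>2) * indicator (?E k) \<omega> \<partial>M)"
    by (rule nn_integral_suminf) (use ev in measurable)
  also have "\<dots> = (\<Sum>k. ennreal ((real k)\<^sup>2 * ?w k))"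
    using l by (simp add: nn_integral_cmult_indicator[OF ev] pE ennreal_mult[symmetric])
  also have "\<dots> = ennreal (l\<^sup>2 + l)"
  proof (rule suminf_ennreal_eq)
    have exp_sum: "(\<lambda>k. l ^ k / fact k) sums exp l"
      using exp_converges[of l] by (simp add: divide_inverse mult.commute)
    have "(\<lambda>k. real (Suc k) * (l ^ Suc k / fact (Suc k))) sums (l * exp l)"
      using sums_mult[OF exp_sum, of l] by (simp add: field_simps del: of_nat_Suc)
    then have first: "(\<lambda>k. real k * (l ^ k / fact k)) sums (l * exp l)"
      by (subst (asm) sums_Suc_iff) simp
    have "(\<lambda>k. l * (real k * (l ^ k / fact k) + l ^ k / fact k)) sums (l * (l * exp l + exp l))"
      by (intro sums_mult sums_add first exp_sum)
    moreover have "l * (real k * (l ^ k / fact k) + l ^ k / fact k) = (real (Suc k))\<^sup>2 * (l ^ Suc k / fact (Suc k))" for k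
    proof -
      have "(real (Suc k))\<^sup>2 * (l ^ Suc k / fact (Suc k)) = real (Suc k) * (l * (l ^ k / fact k))"
        by (simp add: power2_eq_square field_simps del: of_nat_Suc)
      moreover have "l * (real k * A + A) = real (Suc k) * (l * A)" for A by (simp add: algebra_simps)
      ultimately show ?thesis by (simp only:)
    qed
    ultimately have "(\<lambda>k. (real (Suc k))\<^sup>2 * (l ^ Suc k / fact (Suc k))) sums (l * (l * exp l + exp l))" by simp
    then have "(\<lambda>k. (real k)\<^sup>2 * (l ^ k / fact k)) sums (l * (l * exp l + exp l))"
      by (subst (asm) sums_Suc_iff) simp
    from sums_mult[OF this, of "exp (- l)"]
    have "(\<lambda>k. exp (- l) * ((real k)\<^sup>2 * (l ^ k / fact k))) sums (exp (- l) * (l * (l * exp l + exp l)))" .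
    moreover have "exp (- l) * (l * (l * exp l + exp l)) = exp (- l) * exp l * (l\<^sup>2 + l)"
      by (simp only: power2_eq_square distrib_left mult_ac)
    then have "exp (- l) * (l * (l * exp l + exp l)) = l\<^sup>2 + l" by (simp add: exp_minus)
    moreover have "exp (- l) * ((real k)\<^sup>2 * (l ^ k / fact k)) = (real k)\<^sup>2 * ?w k" for k by simp
    ultimately show "(\<lambda>k. (real k)\<^sup>2 * ?w k) sums (l\<^sup>2 + l)" by (simp only:)
  qed (use l in auto)
  finally show ?thesis by (simp add: l_def)
qed

end

section \<open>The law of large numbers\<close>

text \<open>
  A monotone function is squeezed between its values at neighbouring integers, whose ratio tends
  to 1.
\<close>

lemma ratio_tendsto_of_integers:
  fixes g :: "real \<Rightarrow> real"
  assumes mono: "\<And>s t. s \<le> t \<Longrightarrow> g s \<le> g t" and f: "0 \<le> f"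
    and int: "\<And>\<epsilon>. 0 < \<epsilon> \<Longrightarrow> \<forall>\<^sub>F n in sequentially. (f - \<epsilon>) * real n \<le> g (real n) \<and> g (real n) \<le> (f + \<epsilon>) * real n"
  shows "((\<lambda>t. g t / t) \<longlongrightarrow> f) at_top"
proof (rule tendstoI)
  fix e :: real assume e: "0 < e"
  define \<epsilon> where "\<epsilon> = e / 2"
  have \<epsilon>: "0 < \<epsilon>" using e by (simp add: \<epsilon>_def)
  obtain n0 where n0: "\<And>n. n0 \<le> n \<Longrightarrow> (f - \<epsilon>) * real n \<le> g (real n) \<and> g (real n) \<le> (f + \<epsilon>) * real n"
    using int[OF \<epsilon>] unfolding eventually_sequentially by blast
  show "\<forall>\<^sub>F t in at_top. dist (g t / t) f < e"
    using eventually_gt_at_top[of "max (real n0 + 1) ((f + \<epsilon>) / \<epsilon>)"]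
  proof eventually_elim
    case (elim t)
    have t: "real n0 + 1 < t" "f + \<epsilon> < \<epsilon> * t" using elim \<epsilon> by (simp_all add: divide_less_eq mult.commute)
    have tp: "0 < t" using t(1) by simp
    define n where "n = nat \<lfloor>t\<rfloor>"
    have n: "real n \<le> t" "t < real n + 1" "n0 \<le> n" using t(1) tp unfolding n_def by linarith+
    have "g t \<le> g (real (Suc n))" using n by (intro mono) simp
    also have "\<dots> \<le> (f + \<epsilon>) * real (Suc n)" using n0[of "Suc n"] n by simp
    also have "\<dots> \<le> (f + \<epsilon>) * (t + 1)" using n f \<epsilon> by (intro mult_left_mono) auto
    finally have upper: "g t - f * t \<le> \<epsilon> * t + (f + \<epsilon>)" by (simp add: algebra_simps)
    have "f * (t - 1) - \<epsilon> * t \<le> f * real n - \<epsilon> * real n"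
      using n f \<epsilon> by (intro diff_mono mult_left_mono) auto
    also have "\<dots> \<le> g (real n)" using n0[OF n(3)] by (simp add: left_diff_distrib)
    also have "\<dots> \<le> g t" using n by (intro mono) simp
    finally have lower: "f * t - g t \<le> \<epsilon> * t + f" by (simp add: algebra_simps)
    have "\<bar>g t - f * t\<bar> < e * t" using upper lower t(2) \<epsilon> unfolding \<epsilon>_def by (simp add: abs_less_iff)
    moreover have "g t / t - f = (g t - f * t) / t" using tp by (simp add: diff_divide_distrib)
    ultimately show ?case using tp by (simp add: dist_real_def abs_divide divide_less_eq)
  qed
qed

context quadrant_poisson
begin

lemma longest_chain_AE:
  assumes h: "0 \<le> h1" "0 \<le> h2" and ab: "0 < a" "0 < b"
  shows "AE \<omega> in M. ((\<lambda>t. real (longest_chain (h1, h2) (\<Xi> \<omega>) (a * t, b * t)) / t)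
            \<longlongrightarrow> limit_shape (h1, h2) a b) at_top"
proof -
  define f where "f = limit_shape (h1, h2) a b"
  have f: "0 < f" unfolding f_def by (rule limit_shape_fixpoint[OF h ab])
  let ?L = "\<lambda>\<omega> t. real (longest_chain (h1, h2) (\<Xi> \<omega>) (a * t, b * t))"
  have "AE \<omega> in M. \<forall>\<^sub>F n in sequentially. (f - \<epsilon>) * real n \<le> ?L \<omega> (real n) \<and> ?L \<omega> (real n) \<le> (f + \<epsilon>) * real n"
    if \<epsilon>: "0 < \<epsilon>" for \<epsilon>
  proof -
    obtain C c t0 where c: "0 < c" "\<And>t. t0 \<le> t \<Longrightarrow>
        prob {\<omega> \<in> space M. (f + \<epsilon>) * t \<le> ?L \<omega> t} \<le> C * exp (- c * t) \<and>
        prob {\<omega> \<in> space M. ?L \<omega> t < (f - \<epsilon>) * t} \<le> C * exp (- c * t)"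
      using longest_chain_deviation[OF h ab \<epsilon>] unfolding f_def by blast
    define U V where "U n = {\<omega> \<in> space M. (f + \<epsilon>) * real n \<le> ?L \<omega> (real n)}"
      and "V n = {\<omega> \<in> space M. ?L \<omega> (real n) < (f - \<epsilon>) * real n}" for n :: nat
    have ev: "U n \<in> events" "V n \<in> events" for n
      unfolding U_def V_def using longest_chain_measurable[OF h] by measurable
    have "summable (\<lambda>n. prob (U n \<union> V n))"
    proof (rule summable_comparison_test_ev)
      have "\<forall>\<^sub>F n in sequentially. t0 \<le> real n"
        using filterlim_real_sequentially by (auto simp: filterlim_at_top)
      then show "\<forall>\<^sub>F n in sequentially. norm (prob (U n \<union> V n)) \<le> 2 * C * exp (- c) ^ n"
      proof eventually_elim
        case (elim n)
        have "prob (U n \<union> V n) \<le> prob (U n) + prob (V n)" by (rule measure_Un_le[OF ev])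
        also have "\<dots> \<le> 2 * C * exp (- c * real n)" using c(2)[OF elim] unfolding U_def V_def by linarith
        also have "exp (- c * real n) = exp (- c) ^ n" by (simp add: exp_of_nat_mult[symmetric] mult.commute)
        finally show ?case by simp
      qed
      show "summable (\<lambda>n. 2 * C * exp (- c) ^ n)"
        using c(1) by (intro summable_mult summable_geometric) simp
    qed
    then have "AE \<omega> in M. \<forall>\<^sub>F n in sequentially. \<omega> \<in> space M - (U n \<union> V n)"
      using ev by (intro borel_cantelli_AE1) (auto simp: emeasure_eq_measure)
    then show ?thesis
    proof (rule AE_mp, intro AE_I2 impI)
      fix \<omega> assume "\<forall>\<^sub>F n in sequentially. \<omega> \<in> space M - (U n \<union> V n)"
      then show "\<forall>\<^sub>F n in sequentially. (f - \<epsilon>) * real n \<le> ?L \<omega> (real n) \<and> ?L \<omega> (real n) \<le> (f + \<epsilon>) * real n"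
        by eventually_elim (auto simp: U_def V_def not_less not_le)
    qed
  qed
  then have "AE \<omega> in M. \<forall>r. \<forall>\<^sub>F n in sequentially. (f - inverse (real (Suc r))) * real n \<le> ?L \<omega> (real n) \<and>
      ?L \<omega> (real n) \<le> (f + inverse (real (Suc r))) * real n"
    unfolding AE_all_countable by simp
  then show ?thesis
  proof (rule AE_mp, intro AE_I2 impI)
    fix \<omega> assume \<omega>: "\<omega> \<in> space M" and r: "\<forall>r. \<forall>\<^sub>F n in sequentially. (f - inverse (real (Suc r))) * real n \<le> ?L \<omega> (real n) \<and>
      ?L \<omega> (real n) \<le> (f + inverse (real (Suc r))) * real n"
    show "((\<lambda>t. ?L \<omega> t / t) \<longlongrightarrow> limit_shape (h1, h2) a b) at_top"
      unfolding f_def[symmetric]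
    proof (rule ratio_tendsto_of_integers)
      show "?L \<omega> s \<le> ?L \<omega> t" if "s \<le> t" for s t
        using longest_chain_mono[OF \<omega>, of "a * s" "a * t" "b * s" "b * t" "(h1, h2)"] that ab by simp
      fix \<epsilon> :: real assume "0 < \<epsilon>"
      then obtain k where k: "inverse (real (Suc k)) < \<epsilon>" using reals_Archimedean by blast
      from r[rule_format, of k]
      show "\<forall>\<^sub>F n in sequentially. (f - \<epsilon>) * real n \<le> ?L \<omega> (real n) \<and> ?L \<omega> (real n) \<le> (f + \<epsilon>) * real n"
      proof eventually_elim
        case (elim n)
        have "(f - \<epsilon>) * real n \<le> (f - inverse (real (Suc k))) * real n"
          "(f + inverse (real (Suc k))) * real n \<le> (f + \<epsilon>) * real n"
          using k by (auto intro!: mult_right_mono)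
        then show ?case using elim by linarith
      qed
    qed (use f in simp)
  qed
qed

lemma count_square_integral:
  assumes "0 \<le> x" "0 \<le> y"
  shows "integrable M (\<lambda>\<omega>. (real (card (\<Xi> \<omega> \<inter> ({0<..<x} \<times> {0<..<y}))))\<^sup>2)"
    and "(\<integral>\<omega>. (real (card (\<Xi> \<omega> \<inter> ({0<..<x} \<times> {0<..<y}))))\<^sup>2 \<partial>M) = (x * y)\<^sup>2 + x * y"
proof -
  have "(\<lambda>\<omega>. card (\<Xi> \<omega> \<inter> ({0<..<x} \<times> {0<..<y}))) \<in> measurable M (count_space UNIV)"
    by (rule count_measurable) (auto intro!: borel_Times bounded_Times)
  then have "(\<lambda>\<omega>. (real (card (\<Xi> \<omega> \<inter> ({0<..<x} \<times> {0<..<y}))))\<^sup>2) \<in> borel_measurable M"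
    by measurable
  then have "has_bochner_integral M (\<lambda>\<omega>. (real (card (\<Xi> \<omega> \<inter> ({0<..<x} \<times> {0<..<y}))))\<^sup>2) ((x * y)\<^sup>2 + x * y)"
    using count_second_moment[OF assms] assms by (intro has_bochner_integral_nn_integral) auto
  then show "integrable M (\<lambda>\<omega>. (real (card (\<Xi> \<omega> \<inter> ({0<..<x} \<times> {0<..<y}))))\<^sup>2)"
    "(\<integral>\<omega>. (real (card (\<Xi> \<omega> \<inter> ({0<..<x} \<times> {0<..<y}))))\<^sup>2 \<partial>M) = (x * y)\<^sup>2 + x * y"
    by (simp_all add: has_bochner_integral_iff)
qed

lemma longest_chain_integrable:
  assumes h: "0 \<le> h1" "0 \<le> h2" and xy: "0 \<le> x" "0 \<le> y"
  shows "integrable M (\<lambda>\<omega>. real (longest_chain (h1, h2) (\<Xi> \<omega>) (x, y)))"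
proof (rule Bochner_Integration.integrable_bound[OF count_square_integral(1)[OF xy] longest_chain_measurable[OF h]])
  show "AE \<omega> in M. norm (real (longest_chain (h1, h2) (\<Xi> \<omega>) (x, y))) \<le>
      norm ((real (card (\<Xi> \<omega> \<inter> ({0<..<x} \<times> {0<..<y}))))\<^sup>2)"
  proof (intro AE_I2)
    fix \<omega> assume "\<omega> \<in> space M"
    then have "longest_chain (h1, h2) (\<Xi> \<omega>) (x, y) \<le> card (\<Xi> \<omega> \<inter> ({0<..<x} \<times> {0<..<y}))"
      by (rule longest_chain_le_count)
    also have "\<dots> \<le> (card (\<Xi> \<omega> \<inter> ({0<..<x} \<times> {0<..<y})))\<^sup>2" by (simp add: power2_nat_le_imp_le)
    finally show "norm (real (longest_chain (h1, h2) (\<Xi> \<omega>) (x, y))) \<le>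
      norm ((real (card (\<Xi> \<omega> \<inter> ({0<..<x} \<times> {0<..<y}))))\<^sup>2)"
      by (simp add: of_nat_power[symmetric] del: of_nat_power)
  qed
qed

text \<open>
  Off the deviation event the integrand is at most \<open>\<epsilon>\<close>. On it, the length is bounded by the number
  \<open>N\<close> of points, and \<open>N \<le> t ^ 4 + N\<^sup>2 / t ^ 4\<close>: the first term meets an exponentially small
  probability, and after division by \<open>t\<close> the second one has a mean of order \<open>1 / t\<close>, because the second
  moment of \<open>N\<close> is of order \<open>t ^ 4\<close>.
\<close>

lemma longest_chain_L1:
  assumes h: "0 \<le> h1" "0 \<le> h2" and ab: "0 < a" "0 < b"
  shows "((\<lambda>t. \<integral>\<omega>. \<bar>real (longest_chain (h1, h2) (\<Xi> \<omega>) (a * t, b * t)) / t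
                    - limit_shape (h1, h2) a b\<bar> \<partial>M) \<longlongrightarrow> 0) at_top"
proof (rule tendstoI)
  fix e :: real assume e: "0 < e"
  define f where "f = limit_shape (h1, h2) a b"
  have f: "0 < f" unfolding f_def by (rule limit_shape_fixpoint[OF h ab])
  let ?L = "\<lambda>\<omega> t. real (longest_chain (h1, h2) (\<Xi> \<omega>) (a * t, b * t))"
  let ?N = "\<lambda>\<omega> t. real (card (\<Xi> \<omega> \<inter> ({0<..<a * t} \<times> {0<..<b * t})))"
  define \<epsilon> where "\<epsilon> = e / 2"
  have \<epsilon>: "0 < \<epsilon>" using e by (simp add: \<epsilon>_def)
  obtain C c t0 where c: "0 < c" "\<And>t. t0 \<le> t \<Longrightarrow>
      prob {\<omega> \<in> space M. (f + \<epsilon>) * t \<le> ?L \<omega> t} \<le> C * exp (- c * t) \<and>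
      prob {\<omega> \<in> space M. ?L \<omega> t < (f - \<epsilon>) * t} \<le> C * exp (- c * t)"
    using longest_chain_deviation[OF h ab \<epsilon>] unfolding f_def by blast
  define B where "B t = {\<omega> \<in> space M. (f + \<epsilon>) * t \<le> ?L \<omega> t} \<union> {\<omega> \<in> space M. ?L \<omega> t < (f - \<epsilon>) * t}" for t
  have UV: "{\<omega> \<in> space M. (f + \<epsilon>) * t \<le> ?L \<omega> t} \<in> events" "{\<omega> \<in> space M. ?L \<omega> t < (f - \<epsilon>) * t} \<in> events" for t
    using longest_chain_measurable[OF h] by measurable
  have B: "B t \<in> events" for t
    unfolding B_def using UV by (rule sets.Un)
  have bound: "(\<integral>\<omega>. \<bar>?L \<omega> t / t - f\<bar> \<partial>M) \<le> \<epsilon> + (f + t ^ 3) * (2 * C * exp (- c * t)) + ((a * b)\<^sup>2 + a * b) / t"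
    if t: "1 \<le> t" "t0 \<le> t" for t
  proof -
    have pointwise: "\<bar>?L \<omega> t / t - f\<bar> \<le> \<epsilon> + (f + t ^ 3) * indicator (B t) \<omega> + (?N \<omega> t)\<^sup>2 / t ^ 5"
      if \<omega>: "\<omega> \<in> space M" for \<omega>
    proof (cases "\<omega> \<in> B t")
      case False
      then have "(f - \<epsilon>) * t \<le> ?L \<omega> t" "?L \<omega> t < (f + \<epsilon>) * t" using \<omega> by (auto simp: B_def not_less not_le)
      then have "f - \<epsilon> \<le> ?L \<omega> t / t" "?L \<omega> t / t < f + \<epsilon>" using t by (simp_all add: le_divide_eq divide_less_eq)
      then have "\<bar>?L \<omega> t / t - f\<bar> \<le> \<epsilon>" by linarith
      moreover have "0 \<le> (?N \<omega> t)\<^sup>2 / t ^ 5" using t by simp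
      ultimately show ?thesis using False by simp
    next
      case True
      have LN: "?L \<omega> t \<le> ?N \<omega> t" using longest_chain_le_count[OF \<omega>] by simp
      have "?N \<omega> t \<le> t ^ 4 + (?N \<omega> t)\<^sup>2 / t ^ 4"
      proof (cases "?N \<omega> t \<le> t ^ 4")
        case True
        then show ?thesis using t by (simp add: add_increasing2)
      next
        case False
        then have "?N \<omega> t * t ^ 4 \<le> ?N \<omega> t * ?N \<omega> t" by (intro mult_left_mono) auto
        then have "?N \<omega> t \<le> (?N \<omega> t)\<^sup>2 / t ^ 4" using t by (simp add: le_divide_eq power2_eq_square)
        then show ?thesis using t by (simp add: add_increasing)
      qed
      then have "?L \<omega> t / t \<le> (t ^ 4 + (?N \<omega> t)\<^sup>2 / t ^ 4) / t" using LN t by (intro divide_right_mono) auto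
      also have "\<dots> = t ^ 3 + (?N \<omega> t)\<^sup>2 / t ^ 5" using t by (simp add: add_divide_distrib power_numeral_reduce)
      finally have "?L \<omega> t / t \<le> t ^ 3 + (?N \<omega> t)\<^sup>2 / t ^ 5" .
      moreover have "0 \<le> ?L \<omega> t / t" using t by simp
      ultimately have "\<bar>?L \<omega> t / t - f\<bar> \<le> f + (t ^ 3 + (?N \<omega> t)\<^sup>2 / t ^ 5)" using f by linarith
      then show ?thesis using True \<epsilon> by simp
    qed
    have ab_t: "0 \<le> a * t" "0 \<le> b * t" using ab t by simp_all
    note sq = count_square_integral[OF ab_t]
    have i0: "integrable M (\<lambda>\<omega>. \<epsilon>)" by simp
    have i1: "integrable M (\<lambda>\<omega>. (f + t ^ 3) * indicator (B t) \<omega>)"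
      using B by (intro integrable_mult_right integrable_real_indicator) (auto simp: emeasure_eq_measure)
    have i2: "integrable M (\<lambda>\<omega>. (?N \<omega> t)\<^sup>2 / t ^ 5)"
      using sq(1) by (rule integrable_divide)
    have "(\<integral>\<omega>. \<bar>?L \<omega> t / t - f\<bar> \<partial>M) \<le> (\<integral>\<omega>. \<epsilon> + (f + t ^ 3) * indicator (B t) \<omega> + (?N \<omega> t)\<^sup>2 / t ^ 5 \<partial>M)"
      using pointwise longest_chain_integrable[OF h ab_t]
      by (intro integral_mono Bochner_Integration.integrable_add i0 i1 i2) auto
    also have "\<dots> = (\<integral>\<omega>. \<epsilon> \<partial>M) + (\<integral>\<omega>. (f + t ^ 3) * indicator (B t) \<omega> \<partial>M) + (\<integral>\<omega>. (?N \<omega> t)\<^sup>2 / t ^ 5 \<partial>M)"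
      by (simp only: Bochner_Integration.integral_add Bochner_Integration.integrable_add i0 i1 i2)
    also have "\<dots> = \<epsilon> + (f + t ^ 3) * prob (B t) + ((a * t * (b * t))\<^sup>2 + a * t * (b * t)) / t ^ 5"
    proof -
      have "(\<integral>\<omega>. (?N \<omega> t)\<^sup>2 / t ^ 5 \<partial>M) = ((a * t * (b * t))\<^sup>2 + a * t * (b * t)) / t ^ 5"
        unfolding integral_divide_zero sq(2) ..
      moreover have "(\<integral>\<omega>. (f + t ^ 3) * indicator (B t) \<omega> \<partial>M) = (f + t ^ 3) * prob (B t)"
        using B by (simp add: sets.Int_space_eq2)
      moreover have "(\<integral>\<omega>. \<epsilon> \<partial>M) = \<epsilon>" by (simp add: prob_space)
      ultimately show ?thesis by (simp only:)
    qed
    also have "\<dots> \<le> \<epsilon> + (f + t ^ 3) * (2 * C * exp (- c * t)) + ((a * b)\<^sup>2 + a * b) / t"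
    proof (intro add_mono mult_left_mono order_refl)
      have "prob (B t) \<le> prob {\<omega> \<in> space M. (f + \<epsilon>) * t \<le> ?L \<omega> t} + prob {\<omega> \<in> space M. ?L \<omega> t < (f - \<epsilon>) * t}"
        unfolding B_def by (rule measure_Un_le[OF UV])
      then show "prob (B t) \<le> 2 * C * exp (- c * t)" using c(2)[OF t(2)] by linarith
      have "(a * t * (b * t))\<^sup>2 + a * t * (b * t) \<le> ((a * b)\<^sup>2 + a * b) * t ^ 4"
      proof -
        have "t\<^sup>2 \<le> t ^ 4" using t by (intro power_increasing) auto
        then have "(a * b) * t\<^sup>2 \<le> (a * b) * t ^ 4" using ab by (intro mult_left_mono) auto
        then show ?thesis by (simp add: power2_eq_square power_numeral_reduce algebra_simps)
      qed
      then have "((a * t * (b * t))\<^sup>2 + a * t * (b * t)) / t ^ 5 \<le> ((a * b)\<^sup>2 + a * b) * t ^ 4 / t ^ 5"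
        using t by (intro divide_right_mono) auto
      also have "\<dots> = ((a * b)\<^sup>2 + a * b) / t" using t by (simp add: power_numeral_reduce)
      finally show "((a * t * (b * t))\<^sup>2 + a * t * (b * t)) / t ^ 5 \<le> ((a * b)\<^sup>2 + a * b) / t" .
    qed (use f t in simp)
    finally show ?thesis .
  qed
  have "((\<lambda>t. \<epsilon> + (f + t ^ 3) * (2 * C * exp (- c * t)) + ((a * b)\<^sup>2 + a * b) / t) \<longlongrightarrow> \<epsilon>) at_top"
    using c(1) by real_asymp
  then have "\<forall>\<^sub>F t in at_top. \<epsilon> + (f + t ^ 3) * (2 * C * exp (- c * t)) + ((a * b)\<^sup>2 + a * b) / t < e"
    by (rule order_tendstoD) (use e in \<open>simp add: \<epsilon>_def\<close>)
  then show "\<forall>\<^sub>F t in at_top. dist (\<integral>\<omega>. \<bar>?L \<omega> t / t - limit_shape (h1, h2) a b\<bar> \<partial>M) 0 < e"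
    unfolding f_def[symmetric] using eventually_ge_at_top[of "max 1 t0"]
  proof eventually_elim
    case (elim t)
    have "0 \<le> (\<integral>\<omega>. \<bar>?L \<omega> t / t - f\<bar> \<partial>M)" by simp
    then show ?case using bound[of t] elim by (simp add: dist_real_def)
  qed
qed

end

theorem proposition3:
  fixes M :: "'w measure" and \<Xi> :: "'w \<Rightarrow> (real \<times> real) set"
    and h1 h2 a b :: real
  assumes "homogeneous_poisson_process M 1 ({0<..} \<times> {0<..}) \<Xi>"
    and "h1 \<ge> 0" and "h2 \<ge> 0" and "a > 0" and "b > 0"
  shows "(AE \<omega> in M. ((\<lambda>t. real (longest_chain (h1, h2) (\<Xi> \<omega>) (a * t, b * t)) / t)
            \<longlongrightarrow> limit_shape (h1, h2) a b) at_top) \<and>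
         (\<forall>t>0. integrable M (\<lambda>\<omega>. real (longest_chain (h1, h2) (\<Xi> \<omega>) (a * t, b * t)) / t)) \<and>
         ((\<lambda>t. \<integral>\<omega>. \<bar>real (longest_chain (h1, h2) (\<Xi> \<omega>) (a * t, b * t)) / t
                    - limit_shape (h1, h2) a b\<bar> \<partial>M) \<longlongrightarrow> 0) at_top"
proof -
  interpret quadrant_poisson M \<Xi>
    unfolding quadrant_poisson_def by (rule assms(1))
  show ?thesis
    using longest_chain_AE[OF assms(2-5)] longest_chain_L1[OF assms(2-5)]
      longest_chain_integrable[OF assms(2,3)] assms(4,5) by simp
qed

end
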